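(* Consider the rigid body system $$\dot R=R[\omega]_\times,\qquad J\dot\omega=[J\omega]_\times\omega+\tau,\qquad (R,\omega)\in SO(3)\times\mathbb{R}^3,$$ and the auxiliary system $\dot{\hat R}=\hat R[\beta]_\times$, $\hat R\in SO(3)$ (arbitrary initial condition), under the hybrid control law for $(\tau,\beta,q)$ specified in the context. Assume that $n\ge 2$ vector measurements $b_i=R^\top r_i$, corresponding to constant known inertial vectors $r_i\in\mathbb{R}^3$, $i=1,\dots,n$, are available, and that at least three of the vectors $r_i$ are linearly independent. If, for $h=1,2$, the potential function $\mathcal{U}_h$ is centrally synergistic with synergistic gap exceeding $\delta_h>0$, then the set $$\bar{\mathcal{A}}=\{(X,\omega,q)\in\mathcal{D}_X\times\mathbb{R}^3\times\mathcal{D}_q:\ X_1=X_2=I,\ \omega=0\}$$ is globally asymptotically stable for the resulting closed-loop hybrid system (given explicitly in the context).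
   Context: Notation. $[\omega]_\times$ is the skew-symmetric matrix with $[\omega]_\times x=\omega\times x$; $\mathrm{vex}$ is the inverse of $[\cdot]_\times$; $\psi(M)=\mathrm{vex}((M-M^\top)/2)$ for $M\in\mathbb{R}^{3\times3}$; $\mathcal{R}_a(\theta,u)=e^{\theta[u]_\times}$. $J\in\mathbb{R}^{3\times3}$ is the constant (symmetric positive definite) inertia matrix; $R_d\in SO(3)$ is a constant desired attitude. Gradients on $SO(3)$ are relative to the metric $\langle R\Omega_1,R\Omega_2\rangle_R=\mathrm{tr}(\Omega_1^\top\Omega_2)$. Set-up. $Y_1=\hat R$, $Y_2=R_d$, $X_h=RY_h^\top$ for $h=1,2$. $\mathcal{Q}\subset\mathbb{N}$ is a finite index set, $X=(X_1,X_2)\in\mathcal{D}_X:=SO(3)\times SO(3)$, $q=(q_1,q_2)\in\mathcal{D}_q:=\mathcal{Q}\times\mathcal{Q}$. For $h=1,2$: $A_h=\sum_{i=1}^n\rho_{ih}r_ir_i^\top$ with $\rho_{ih}>0$; $W_h=\mathrm{tr}(A_h)I-A_h$ with extreme eigenvalues $\lambda_{\min}^{W_h},\lambda_{\max}^{W_h}$; $\xi_h=\lambda_{\min}^{W_h}/\lambda_{\max}^{W_h}$; $u_h\in\mathbb{S}^2$ arbitrary; nonzero scalars $k_{hq}$, $q\in\mathcal{Q}$, with $|k_{hq}|<\frac{1}{2\lambda_{\max}^{W_h}\sqrt{6-\max\{1,4\xi_h^2\}}}$; and $$V_{A_h}(R)=\mathrm{tr}(A_h(I-R)),\quad \theta_{hq}(R)=2\arcsin(k_{hq}V_{A_h}(R)),\quad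 \Gamma_h(R,q)=R\,\mathcal{R}_a(\theta_{hq}(R),u_h),$$ $$\mathcal{U}_h(R,q)=V_{A_h}(\Gamma_h(R,q)),\qquad \Theta_h(R,q)=\mathcal{R}_a(\theta_{hq}(R),u_h)^\top+\frac{4k_{hq}u_h\psi(A_hR)^\top}{\sqrt{1-k_{hq}^2V_{A_h}^2(R)}} .$$ Each $\mathcal{U}_h$ is a potential function on $SO(3)\times\mathcal{Q}$ with respect to $\mathcal{A}=\{I\}\times\mathcal{Q}$: it is nonnegative, continuously differentiable in $R$, and vanishes exactly on $\mathcal{A}$. It is centrally synergistic with gap exceeding $\delta_h>0$ if $$\min_{(R,p)\in\Psi_{\mathcal{U}_h}\setminus\mathcal{A}}\big[\mathcal{U}_h(R,p)-\min_{s\in\mathcal{Q}}\mathcal{U}_h(R,s)\big]>\delta_h,$$ where $\Psi_{\mathcal{U}_h}=\{(R,p)\in SO(3)\times\mathcal{Q}:\nabla_R\mathcal{U}_h(R,p)=0\}$. Hybrid control law. Let $\mu_h(X_h,q_h)=\mathcal{U}_h(X_h,q_h)-\min_{p\in\mathcal{Q}}\mathcal{U}_h(X_h,p)$, $$C=\{(X,q)\in\mathcal{D}_X\times\mathcal{D}_q:\mu_1(X_1,q_1)\le\delta_1\text{ and }\mu_2(X_2,q_2)\le\delta_2\},$$ $$D=\{(X,q)\in\mathcal{D}_X\times\mathcal{D}_q:\mu_1(X_1,q_1)\ge\delta_1\text{ or }\mu_2(X_2,q_2)\ge\delta_2\},$$ $$g(X)=\{(q_1,q_2)\in\mathcal{Q}\times\mathcal{Q}: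 q_h\in\arg\min_{p\in\mathcal{Q}}\mathcal{U}_h(X_h,p),\ h=1,2\}.$$ While $(X,q)\in C$ (flow): $\tau=-2\sum_{h=1}^2Y_h^\top\Theta_h(X_h,q_h)^\top\psi(A_h\Gamma_h(X_h,q_h))$, $\beta=Y_1^\top\Theta_1(X_1,q_1)^\top\psi(A_1\Gamma_1(X_1,q_1))$, $\dot q=0$. When $(X,q)\in D$ (jump): $\tau^+=\tau$, $\beta^+=\beta$, $q^+\in g(X)$. Closed-loop system, with state $(X,\omega,q)\in\mathcal{D}_X\times\mathbb{R}^3\times\mathcal{D}_q$ (autonomous, since $Y_2=R_d$ is constant and $Y_1=X_1^\top X_2Y_2$): for $(X,q)\in C$, $$\dot X_1=X_1\big[Y_1\omega-\Theta_1(X_1,q_1)^\top\psi(A_1\Gamma_1(X_1,q_1))\big]_\times,\qquad \dot X_2=X_2[Y_2\omega]_\times,$$ $$J\dot\omega=[J\omega]_\times\omega-2\sum_{h=1}^2Y_h^\top\Theta_h(X_h,q_h)^\top\psi(A_h\Gamma_h(X_h,q_h)),\qquad\dot q=0;$$ for $(X,q)\in D$: $X^+=X$, $\omega^+=\omega$, $q^+\in g(X)$. Solutions are in the standard sense of hybrid systems: hybrid arcs on hybrid time domains, i.e. unions of intervals $[t_j,t_{j+1}]\times\{j\}$ with $0=t_0\le t_1\le\cdots$ (the last interval possibly half-open or unbounded), locally absolutely continuous in $t$ for each $j$, flowing in $C$ and jumping from $D$. Globally asymptotically stable means stable and globally attractive. *)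

theory Defs
  imports "HOL-Analysis.Analysis"
begin

section \<open>Hybrid systems\<close>

text \<open>A hybrid time domain is a finite or infinite union of \<open>[t j, t (j + 1)] \<times> {j}\<close>; if it is
  finite, the last interval (here \<open>L\<close>) may also be half-open or unbounded.\<close>

definition hybrid_time_domain :: "(real \<times> nat) set \<Rightarrow> bool" where
  "hybrid_time_domain E \<longleftrightarrow> (\<exists>t :: nat \<Rightarrow> real. t 0 = 0 \<and> incseq t \<and>
     (E = (\<Union>j. {t j..t (Suc j)} \<times> {j}) \<or>
      (\<exists>N L. L \<noteq> {} \<and> (L = {t N..t (Suc N)} \<or> L = {t N..<t (Suc N)} \<or> L = {t N..}) \<and>
         E = (\<Union>j<N. {t j..t (Suc j)} \<times> {j}) \<union> L \<times> {N})))"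

definition abs_continuous_on :: "real \<Rightarrow> real \<Rightarrow> (real \<Rightarrow> 'a::real_normed_vector) \<Rightarrow> bool" where
  "abs_continuous_on a b f \<longleftrightarrow> (\<forall>\<epsilon>>0. \<exists>\<eta>>0. \<forall>(m::nat) c d.
     (\<forall>i<m. a \<le> c i \<and> c i \<le> d i \<and> d i \<le> b) \<and>
     disjoint_family_on (\<lambda>i. {c i<..<d i}) {..<m} \<and> (\<Sum>i<m. d i - c i) < \<eta>
     \<longrightarrow> (\<Sum>i<m. norm (f (d i) - f (c i))) < \<epsilon>)"

definition locally_abs_continuous_on :: "real set \<Rightarrow> (real \<Rightarrow> 'a::real_normed_vector) \<Rightarrow> bool" where
  "locally_abs_continuous_on I f \<longleftrightarrow> (\<forall>a b. a \<le> b \<and> {a..b} \<subseteq> I \<longrightarrow> abs_continuous_on a b f)"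

text \<open>The data of a hybrid system: \<open>x' \<in> flow_map x\<close> while \<open>x \<in> flow_set\<close>, and
  \<open>x\<^sup>+ \<in> jump_map x\<close> when \<open>x \<in> jump_set\<close>. Both maps are set-valued.\<close>

record 'a hybrid_system =
  flow_set :: "'a set"
  flow_map :: "'a \<Rightarrow> 'a set"
  jump_set :: "'a set"
  jump_map :: "'a \<Rightarrow> 'a set"

definition hybrid_solution ::
  "'a::euclidean_space hybrid_system \<Rightarrow> (real \<times> nat) set \<Rightarrow> (real \<times> nat \<Rightarrow> 'a) \<Rightarrow> bool" where
  "hybrid_solution H E \<phi> \<longleftrightarrow>
     hybrid_time_domain E \<and>
     \<phi> (0, 0) \<in> flow_set H \<union> jump_set H \<and>
     (\<forall>j. let I = {t. (t, j) \<in> E} in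
        locally_abs_continuous_on I (\<lambda>t. \<phi> (t, j)) \<and>
        (\<forall>t \<in> interior I. \<phi> (t, j) \<in> flow_set H) \<and>
        (AE t in lebesgue. t \<in> I \<longrightarrow>
           (\<exists>v \<in> flow_map H (\<phi> (t, j)). ((\<lambda>s. \<phi> (s, j)) has_vector_derivative v) (at t within I)))) \<and>
     (\<forall>t j. (t, j) \<in> E \<and> (t, Suc j) \<in> E \<longrightarrow>
        \<phi> (t, j) \<in> jump_set H \<and> \<phi> (t, Suc j) \<in> jump_map H (\<phi> (t, j)))"

definition maximal_solution ::
  "'a::euclidean_space hybrid_system \<Rightarrow> (real \<times> nat) set \<Rightarrow> (real \<times> nat \<Rightarrow> 'a) \<Rightarrow> bool" where
  "maximal_solution H E \<phi> \<longleftrightarrow> hybrid_solution H E \<phi> \<and>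
     (\<nexists>E' \<phi>'. hybrid_solution H E' \<phi>' \<and> E \<subset> E' \<and> (\<forall>p\<in>E. \<phi>' p = \<phi> p))"

definition complete_domain :: "(real \<times> nat) set \<Rightarrow> bool" where
  "complete_domain E \<longleftrightarrow> (\<forall>K. \<exists>(t, j) \<in> E. K \<le> t + real j)"

definition stable_set :: "'a::euclidean_space hybrid_system \<Rightarrow> 'a set \<Rightarrow> bool" where
  "stable_set H A \<longleftrightarrow> (\<forall>\<epsilon>>0. \<exists>\<eta>>0. \<forall>E \<phi>. hybrid_solution H E \<phi> \<and> infdist (\<phi> (0, 0)) A \<le> \<eta>
     \<longrightarrow> (\<forall>p\<in>E. infdist (\<phi> p) A \<le> \<epsilon>))"

text \<open>Attractivity without the prefix ``pre'': completeness of all maximal solutions is part of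
  the requirement.\<close>

definition globally_attractive :: "'a::euclidean_space hybrid_system \<Rightarrow> 'a set \<Rightarrow> bool" where
  "globally_attractive H A \<longleftrightarrow> (\<forall>E \<phi>. maximal_solution H E \<phi> \<longrightarrow>
     complete_domain E \<and>
     (\<forall>\<epsilon>>0. \<exists>K. \<forall>(t, j) \<in> E. K \<le> t + real j \<longrightarrow> infdist (\<phi> (t, j)) A < \<epsilon>))"

definition globally_asymptotically_stable :: "'a::euclidean_space hybrid_system \<Rightarrow> 'a set \<Rightarrow> bool" where
  "globally_asymptotically_stable H A \<longleftrightarrow> stable_set H A \<and> globally_attractive H A"


section \<open>Matrices and the rotation group\<close>

definition SO3 :: "(real^3^3) set" where
  "SO3 = {R. rotation_matrix R}"

definition skew :: "real^3 \<Rightarrow> real^3^3" where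
  "skew \<omega> = matrix (cross3 \<omega>)"

text \<open>Only meaningful on skew-symmetric matrices, which are the range of \<^const>\<open>skew\<close>.\<close>

definition vex :: "real^3^3 \<Rightarrow> real^3" where
  "vex = inv skew"

definition psi :: "real^3^3 \<Rightarrow> real^3" where
  "psi M = vex ((1/2) *\<^sub>R (M - transpose M))"

definition outer_product :: "real^3 \<Rightarrow> real^3 \<Rightarrow> real^3^3" where
  "outer_product x y = (\<chi> i j. x $ i * y $ j)"

text \<open>The library's \<^const>\<open>exp\<close> and \<open>(^)\<close> do not refer to matrix multiplication on this type.\<close>

definition matrix_exp :: "real^3^3 \<Rightarrow> real^3^3" where
  "matrix_exp M = (\<Sum>m. (((**) M ^^ m) (mat 1)) /\<^sub>R fact m)"

definition axis_rotation :: "real \<Rightarrow> real^3 \<Rightarrow> real^3^3" where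
  "axis_rotation \<theta> u = matrix_exp (\<theta> *\<^sub>R skew u)"

definition pos_def :: "real^3^3 \<Rightarrow> bool" where
  "pos_def M \<longleftrightarrow> transpose M = M \<and> (\<forall>v. v \<noteq> 0 \<longrightarrow> 0 < v \<bullet> (M *v v))"

definition eigenvalues :: "real^3^3 \<Rightarrow> real set" where
  "eigenvalues M = {l. \<exists>v. v \<noteq> 0 \<and> M *v v = l *\<^sub>R v}"

definition lambda_min :: "real^3^3 \<Rightarrow> real" where
  "lambda_min M = Min (eigenvalues M)"

definition lambda_max :: "real^3^3 \<Rightarrow> real" where
  "lambda_max M = Max (eigenvalues M)"

definition SO3_tangent :: "real^3^3 \<Rightarrow> (real^3^3) set" where
  "SO3_tangent R = {R ** \<Omega> | \<Omega>. transpose \<Omega> = - \<Omega>}"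

text \<open>The metric \<open>\<langle>R \<Omega>\<^sub>1, R \<Omega>\<^sub>2\<rangle>\<^sub>R = tr (\<Omega>\<^sub>1\<^sup>T \<Omega>\<^sub>2)\<close>, in terms of \<open>Z\<^sub>i = R \<Omega>\<^sub>i\<close>.\<close>

definition SO3_metric :: "real^3^3 \<Rightarrow> real^3^3 \<Rightarrow> real^3^3 \<Rightarrow> real" where
  "SO3_metric R Z1 Z2 = trace (transpose (transpose R ** Z1) ** (transpose R ** Z2))"

text \<open>\<open>G\<close> is the Riemannian gradient at \<open>R\<close> of the restriction of \<open>f\<close> to the rotation group. The
  derivative within \<^const>\<open>SO3\<close> is uniquely determined on tangent vectors.\<close>

definition has_SO3_gradient :: "(real^3^3 \<Rightarrow> real) \<Rightarrow> real^3^3 \<Rightarrow> real^3^3 \<Rightarrow> bool" where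
  "has_SO3_gradient f G R \<longleftrightarrow> G \<in> SO3_tangent R \<and>
     (\<exists>f'. (f has_derivative f') (at R within SO3) \<and> (\<forall>Z \<in> SO3_tangent R. f' Z = SO3_metric R G Z))"


section \<open>Potential functions and synergy\<close>

text \<open>In this section \<open>k\<close> is the single scalar belonging to one index \<open>h\<close> and one mode.\<close>

definition trace_potential :: "real^3^3 \<Rightarrow> real^3^3 \<Rightarrow> real" where
  "trace_potential A R = trace (A ** (mat 1 - R))"

definition warp_angle :: "real^3^3 \<Rightarrow> real \<Rightarrow> real^3^3 \<Rightarrow> real" where
  "warp_angle A k R = 2 * arcsin (k * trace_potential A R)"

definition warp :: "real^3^3 \<Rightarrow> real^3 \<Rightarrow> real \<Rightarrow> real^3^3 \<Rightarrow> real^3^3" where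
  "warp A u k R = R ** axis_rotation (warp_angle A k R) u"

definition warped_potential :: "real^3^3 \<Rightarrow> real^3 \<Rightarrow> real \<Rightarrow> real^3^3 \<Rightarrow> real" where
  "warped_potential A u k R = trace_potential A (warp A u k R)"

definition warp_Theta :: "real^3^3 \<Rightarrow> real^3 \<Rightarrow> real \<Rightarrow> real^3^3 \<Rightarrow> real^3^3" where
  "warp_Theta A u k R = transpose (axis_rotation (warp_angle A k R) u) +
     (4 * k / sqrt (1 - k\<^sup>2 * (trace_potential A R)\<^sup>2)) *\<^sub>R outer_product u (psi (A ** R))"

definition innovation :: "real^3^3 \<Rightarrow> real^3 \<Rightarrow> real \<Rightarrow> real^3^3 \<Rightarrow> real^3" where
  "innovation A u k R = transpose (warp_Theta A u k R) *v psi (A ** warp A u k R)"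

definition W_matrix :: "real^3^3 \<Rightarrow> real^3^3" where
  "W_matrix A = trace A *\<^sub>R mat 1 - A"

definition xi :: "real^3^3 \<Rightarrow> real" where
  "xi A = lambda_min (W_matrix A) / lambda_max (W_matrix A)"

text \<open>Here and below the finite mode set \<open>Q \<subseteq> \<nat>\<close> is a set of reals, so that the mode is an ordinary
  component of a Euclidean state and \<open>q' = 0\<close> an ordinary differential equation.\<close>

definition critical_points :: "real set \<Rightarrow> (real^3^3 \<Rightarrow> real \<Rightarrow> real) \<Rightarrow> ((real^3^3) \<times> real) set" where
  "critical_points Q U = {(R, p). R \<in> SO3 \<and> p \<in> Q \<and> has_SO3_gradient (\<lambda>S. U S p) 0 R}"

text \<open>The minimum over the critical points off \<open>{I} \<times> Q\<close> (a compact set for the potentials below) is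
  written as an infimum.\<close>

definition centrally_synergistic ::
  "real set \<Rightarrow> (real^3^3 \<Rightarrow> real \<Rightarrow> real) \<Rightarrow> real \<Rightarrow> bool" where
  "centrally_synergistic Q U \<delta> \<longleftrightarrow>
     (INF (R, p) \<in> critical_points Q U - {mat 1} \<times> Q. U R p - (MIN s\<in>Q. U R s)) > \<delta>"


section \<open>The closed loop\<close>

text \<open>The state is \<open>(X, \<omega>, q)\<close>. The index \<open>h = 1, 2\<close> ranges over the type \<^typ>\<open>2\<close>, so
  \<open>X $ h\<close> and \<open>q $ h\<close> are the components of the pairs \<open>X\<close> and \<open>q\<close>.\<close>

type_synonym state = "((real^3^3)^2) \<times> (real^3) \<times> (real^2)"

text \<open>\<open>Y\<^sub>1\<close> is the observer attitude and \<open>Y\<^sub>2\<close> the desired attitude, both recovered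
  from \<open>X\<close> and \<open>Rd\<close>.\<close>

definition ref_attitude :: "real^3^3 \<Rightarrow> (real^3^3)^2 \<Rightarrow> (real^3^3)^2" where
  "ref_attitude Rd X = (\<chi> h. if h = 1 then transpose (X $ 1) ** X $ 2 ** Rd else Rd)"

context
  fixes A :: "2 \<Rightarrow> real^3^3" and u :: "2 \<Rightarrow> real^3" and k :: "2 \<Rightarrow> real \<Rightarrow> real"
begin

definition potential :: "2 \<Rightarrow> real^3^3 \<Rightarrow> real \<Rightarrow> real" where
  "potential h R p = warped_potential (A h) (u h) (k h p) R"

definition innov :: "(real^3^3)^2 \<Rightarrow> real^2 \<Rightarrow> 2 \<Rightarrow> real^3" where
  "innov X q h = innovation (A h) (u h) (k h (q $ h)) (X $ h)"

definition torque :: "real^3^3 \<Rightarrow> (real^3^3)^2 \<Rightarrow> real^2 \<Rightarrow> real^3" where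
  "torque Rd X q = - 2 *\<^sub>R (\<Sum>h\<in>UNIV. transpose (ref_attitude Rd X $ h) *v innov X q h)"

definition observer_rate :: "real^3^3 \<Rightarrow> (real^3^3)^2 \<Rightarrow> real^2 \<Rightarrow> real^3" where
  "observer_rate Rd X q = transpose (ref_attitude Rd X $ 1) *v innov X q 1"

definition synergy_gap :: "real set \<Rightarrow> 2 \<Rightarrow> real^3^3 \<Rightarrow> real \<Rightarrow> real" where
  "synergy_gap Q h R p = potential h R p - (MIN s\<in>Q. potential h R s)"

definition closed_loop ::
  "real set \<Rightarrow> (2 \<Rightarrow> real) \<Rightarrow> real^3^3 \<Rightarrow> real^3^3 \<Rightarrow> state hybrid_system" where
  "closed_loop Q \<delta> J Rd = \<lparr>
     flow_set = {(X, \<omega>, q). (\<forall>h. X $ h \<in> SO3) \<and> (\<forall>h. q $ h \<in> Q) \<and>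
                            (\<forall>h. synergy_gap Q h (X $ h) (q $ h) \<le> \<delta> h)},
     flow_map = (\<lambda>(X, \<omega>, q). {(X', \<omega>', q').
        X' $ 1 = X $ 1 ** skew (ref_attitude Rd X $ 1 *v \<omega> - innov X q 1) \<and>
        X' $ 2 = X $ 2 ** skew (ref_attitude Rd X $ 2 *v \<omega>) \<and>
        J *v \<omega>' = skew (J *v \<omega>) *v \<omega> + torque Rd X q \<and>
        q' = 0}),
     jump_set = {(X, \<omega>, q). (\<forall>h. X $ h \<in> SO3) \<and> (\<forall>h. q $ h \<in> Q) \<and>
                            (\<exists>h. synergy_gap Q h (X $ h) (q $ h) \<ge> \<delta> h)},
     jump_map = (\<lambda>(X, \<omega>, q). {(X', \<omega>', q'). X' = X \<and> \<omega>' = \<omega> \<and>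
        (\<forall>h. is_arg_min (\<lambda>p. potential h (X $ h) p) (\<lambda>p. p \<in> Q) (q' $ h))})\<rparr>"

end

definition target_set :: "real set \<Rightarrow> state set" where
  "target_set Q = {(X, \<omega>, q). (\<forall>h. X $ h = mat 1) \<and> \<omega> = 0 \<and> (\<forall>h. q $ h \<in> Q)}"

text \<open>The flow map is the one produced by the plant \<open>R' = R [\<omega>]\<^sub>\<times>\<close>, \<open>J \<omega>' = [J \<omega>]\<^sub>\<times> \<omega> + \<tau>\<close> and the observer
  \<open>Rh' = Rh [\<beta>]\<^sub>\<times>\<close> in the coordinates \<open>X\<^sub>h = R Y\<^sub>h\<^sup>T\<close>, with \<open>\<tau>\<close> and \<open>\<beta>\<close> given by \<^const>\<open>torque\<close> and
  \<^const>\<open>observer_rate\<close>.\<close>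

lemma skew_mult [simp]: "skew x *v y = cross3 x y"
  by (simp add: skew_def matrix_def matrix_vector_mult_def vec_eq_iff cross3_simps forall_3 axis_def)

lemma transpose_skew: "transpose (skew x) = - skew x"
  by (simp add: skew_def matrix_def transpose_def vec_eq_iff cross3_simps forall_3 axis_def)

lemma skew_rotate:
  assumes "Y \<in> SO3" shows "Y ** skew x ** transpose Y = skew (Y *v x)"
proof -
  have rot: "rotation_matrix Y" using assms by (simp add: SO3_def)
  then have Y: "Y ** transpose Y = mat 1"
    by (simp add: rotation_matrix_def orthogonal_matrix_def)
  have "(Y ** skew x ** transpose Y) *v z = skew (Y *v x) *v z" for z
  proof -
    have "(Y ** skew x ** transpose Y) *v z = Y *v (cross3 x (transpose Y *v z))"
      by (metis matrix_vector_mul_assoc skew_mult)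
    also have "\<dots> = cross3 (Y *v x) (Y *v (transpose Y *v z))"
      using rot by (simp add: cross_rotation_matrix)
    also have "Y *v (transpose Y *v z) = z"
      by (simp add: matrix_vector_mul_assoc Y del: transpose_matrix_vector)
    finally show ?thesis by simp
  qed
  then show ?thesis by (simp add: matrix_eq)
qed

lemma skew_diff: "skew (x - y) = skew x - skew y"
  by (simp add: matrix_eq matrix_vector_mult_diff_rdistrib cross3_simps forall_3)

lemma bounded_bilinear_matrix_mult: "bounded_bilinear ((**) :: real^3^3 \<Rightarrow> real^3^3 \<Rightarrow> real^3^3)"
  by (rule bilinear_conv_bounded_bilinear[THEN iffD1])
     (auto simp: bilinear_def linear_iff matrix_matrix_mult_def vec_eq_iff sum.distrib
        algebra_simps sum_distrib_left)

lemma bounded_linear_transpose: "bounded_linear (transpose :: real^3^3 \<Rightarrow> real^3^3)"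
  by (rule linear_conv_bounded_linear[THEN iffD1])
     (auto simp: linear_iff transpose_def vec_eq_iff)

lemma plant_and_observer_give_flow_map:
  fixes R Rh :: "real \<Rightarrow> real^3^3" and \<omega> :: "real \<Rightarrow> real^3"
  assumes SO3: "R t \<in> SO3" "Rh t \<in> SO3" "Rd \<in> SO3"
    and X: "\<And>s. X s = (\<chi> h. if h = 1 then R s ** transpose (Rh s) else R s ** transpose Rd)"
    and R: "(R has_vector_derivative R t ** skew (\<omega> t)) (at t within S)"
    and \<omega>: "(\<omega> has_vector_derivative w) (at t within S)"
           "J *v w = skew (J *v \<omega> t) *v \<omega> t + torque A u k Rd (X t) q"
    and Rh: "(Rh has_vector_derivative Rh t ** skew (observer_rate A u k Rd (X t) q)) (at t within S)"
  shows "\<exists>v \<in> flow_map (closed_loop A u k Q \<delta> J Rd) (X t, \<omega> t, q).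
           ((\<lambda>s. (X s, \<omega> s, q)) has_vector_derivative v) (at t within S)"
proof -
  have orth: "transpose M ** M = mat 1" "M ** transpose M = mat 1" if "M \<in> SO3" for M :: "real^3^3"
    using that by (auto simp: SO3_def rotation_matrix_def orthogonal_matrix_def)
  note tr = bounded_linear.has_vector_derivative[OF bounded_linear_transpose]
  note mul = bounded_bilinear.has_vector_derivative[OF bounded_bilinear_matrix_mult]
  define b where "b = observer_rate A u k Rd (X t) q"
  define z where "z = innov A u k (X t) q 1"
  have Y1: "ref_attitude Rd (X t) $ 1 = Rh t"
  proof -
    have "ref_attitude Rd (X t) $ 1 = Rh t ** (transpose (R t) ** R t) ** (transpose Rd ** Rd)"
      by (simp add: ref_attitude_def X matrix_transpose_mul matrix_mul_assoc)
    then show ?thesis by (simp add: orth SO3)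
  qed
  have Y2: "ref_attitude Rd (X t) $ 2 = Rd"
    by (simp add: ref_attitude_def)
  have Rhb: "Rh t *v b = z"
    by (simp add: b_def z_def observer_rate_def Y1 matrix_vector_mul_assoc orth SO3
      del: transpose_matrix_vector)
  define D1 where "D1 = R t ** transpose (Rh t ** skew b) + R t ** skew (\<omega> t) ** transpose (Rh t)"
  define D2 where "D2 = R t ** skew (\<omega> t) ** transpose Rd"
  have d1: "((\<lambda>s. R s ** transpose (Rh s)) has_vector_derivative D1) (at t within S)"
    using mul[OF R tr[OF Rh]] by (simp add: D1_def b_def)
  have d2: "((\<lambda>s. R s ** transpose Rd) has_vector_derivative D2) (at t within S)"
    using mul[OF R has_vector_derivative_const, of "transpose Rd"]
    by (simp add: D2_def bounded_bilinear.zero_right[OF bounded_bilinear_matrix_mult])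
  define X' :: "(real^3^3)^2" where "X' = (\<chi> h. if h = 1 then D1 else D2)"
  have dX: "(X has_vector_derivative X') (at t within S)"
  proof -
    have lin: "bounded_linear (axis i :: real^3^3 \<Rightarrow> (real^3^3)^2)" for i
      by (rule linear_conv_bounded_linear[THEN iffD1]) (auto simp: linear_iff axis_def vec_eq_iff)
    note ax = bounded_linear.has_vector_derivative[OF lin]
    have X_eq: "X = (\<lambda>s. axis 1 (R s ** transpose (Rh s)) + axis 2 (R s ** transpose Rd))"
      by (simp add: fun_eq_iff vec_eq_iff X axis_def forall_2)
    have X'_eq: "X' = axis 1 D1 + axis 2 D2"
      by (simp add: vec_eq_iff X'_def axis_def forall_2)
    show ?thesis
      unfolding X_eq X'_eq by (intro has_vector_derivative_add ax d1 d2)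
  qed
  have key: "M ** transpose N ** skew (N *v x) = M ** skew x ** transpose N"
    if "N \<in> SO3" for M N :: "real^3^3" and x
  proof -
    have "M ** transpose N ** skew (N *v x) = M ** (transpose N ** N) ** skew x ** transpose N"
      by (simp only: skew_rotate[OF that, symmetric] matrix_mul_assoc)
    then show ?thesis by (simp add: orth that)
  qed
  have X1: "X' $ 1 = X t $ 1 ** skew (ref_attitude Rd (X t) $ 1 *v \<omega> t - innov A u k (X t) q 1)"
  proof -
    have "R t ** transpose (Rh t ** skew b) = - (R t ** skew b ** transpose (Rh t))"
      by (simp add: matrix_transpose_mul transpose_skew matrix_mul_assoc
        bounded_bilinear.minus_left[OF bounded_bilinear_matrix_mult]
        bounded_bilinear.minus_right[OF bounded_bilinear_matrix_mult])
    then have "X' $ 1 = R t ** skew (\<omega> t - b) ** transpose (Rh t)"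
      by (simp add: X'_def D1_def skew_diff
        bounded_bilinear.diff_left[OF bounded_bilinear_matrix_mult]
        bounded_bilinear.diff_right[OF bounded_bilinear_matrix_mult])
    also have "\<dots> = R t ** transpose (Rh t) ** skew (Rh t *v (\<omega> t - b))"
      by (simp add: key SO3)
    also have "Rh t *v (\<omega> t - b) = Rh t *v \<omega> t - z"
      by (simp add: matrix_vector_mult_diff_distrib Rhb)
    finally show ?thesis by (simp add: Y1 z_def) (simp add: X)
  qed
  have X2: "X' $ 2 = X t $ 2 ** skew (ref_attitude Rd (X t) $ 2 *v \<omega> t)"
    by (simp add: Y2 key SO3 X'_def D2_def) (simp add: X key SO3)
  have "((\<lambda>s. (X s, \<omega> s, q)) has_vector_derivative (X', w, 0)) (at t within S)"
    by (intro has_vector_derivative_Pair dX \<omega> has_vector_derivative_const)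
  moreover have "(X', w, 0) \<in> flow_map (closed_loop A u k Q \<delta> J Rd) (X t, \<omega> t, q)"
    using X1 X2 \<omega>(2) by (simp add: closed_loop_def)
  ultimately show ?thesis by blast
qed

end

theory Submission
  imports Defs "HOL-Complex_Analysis.Great_Picard"
begin

text \<open>The energy \<open>V = U\<^sub>1 + U\<^sub>2 + \<omega> \<bullet> J \<omega> / 2\<close> satisfies \<open>V' = - 2 |innov\<^sub>1|\<^sup>2\<close> along the flow and
  drops by at least \<open>min \<delta>\<^sub>1 \<delta>\<^sub>2\<close> at every jump. This gives stability and bounds the number of jumps.
  A solution that neither flows for ever nor jumps for ever can be prolonged, by Peano's theorem or by a
  jump, so after its last jump a maximal solution flows for ever. On that tail Barbalat's lemma replaces
  the invariance principle. The gain bound enters only through \<open>2 |k| lambda_max W < 1\<close>, which keeps the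
  warp angle smooth on the rotation group and makes the identity the only zero of \<open>U\<^sub>h\<close>.\<close>

subsection \<open>Absolutely continuous functions\<close>

text \<open>Solutions are only absolutely continuous with an almost-everywhere derivative, so each
  flow segment is first shown to be a classical solution: the right-hand side is continuous along
  the trajectory, hence the derivative exists everywhere on the segment. The damping acts through
  \<open>innov\<close> with index 1 alone, so the energy derivative controls neither
  \<open>\<omega>\<close> nor \<open>X $ 2\<close>; both are recovered from the coupling in the
  dynamics, since the rate of \<open>X $ 1\<close> contains \<open>\<omega>\<close> and the
  acceleration contains the torque of index 2. Synergy enters at one point: in the direction
  \<open>R ** skew w\<close> the potential changes at rate
  \<open>2 * (innovation \<bullet> w)\<close>, so a zero of the innovation is a critical point, and
  a critical point other than the identity has a gap above \<open>\<delta> h\<close>, which the flow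
  set excludes. The same factor 2 stands in the torque, where it cancels the exchange between
  potential and kinetic energy. Potentials are differentiated in the space of all matrices, on an
  open neighbourhood of \<open>SO3\<close>; the rotation constraint is restored separately, as an
  invariant of the flow.\<close>

lemma abs_continuous_on_sum_lt:
  assumes "abs_continuous_on a b f" "0 < e"
  obtains \<eta> where "0 < \<eta>"
    "\<And>(S::'i set) c d. \<lbrakk>finite S; \<And>i. i \<in> S \<Longrightarrow> a \<le> c i \<and> c i \<le> d i \<and> d i \<le> b;
       disjoint_family_on (\<lambda>i. {c i<..<d i}) S; (\<Sum>i\<in>S. d i - c i) < \<eta>\<rbrakk>
     \<Longrightarrow> (\<Sum>i\<in>S. norm (f (d i) - f (c i))) < e"
proof -
  obtain \<eta> where "0 < \<eta>" and \<eta>: "\<forall>(m::nat) c d.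
     (\<forall>i<m. a \<le> c i \<and> c i \<le> d i \<and> d i \<le> b) \<and>
     disjoint_family_on (\<lambda>i. {c i<..<d i}) {..<m} \<and> (\<Sum>i<m. d i - c i) < \<eta>
     \<longrightarrow> (\<Sum>i<m. norm (f (d i) - f (c i))) < e"
    using assms(1)[unfolded abs_continuous_on_def, rule_format, OF assms(2)] by (elim exE conjE)
  show thesis
  proof (rule that[OF \<open>0 < \<eta>\<close>])
    fix S :: "'i set" and c d :: "'i \<Rightarrow> real"
    assume S: "finite S" "\<And>i. i \<in> S \<Longrightarrow> a \<le> c i \<and> c i \<le> d i \<and> d i \<le> b"
       "disjoint_family_on (\<lambda>i. {c i<..<d i}) S" "(\<Sum>i\<in>S. d i - c i) < \<eta>"
    \<comment> \<open>The definition numbers the intervals by an initial segment of the naturals,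
      while the pieces of a tagged division form an arbitrary finite set; this bijection
      translates.\<close>
    obtain h where h: "bij_betw h {..<card S} S"
      using ex_bij_betw_nat_finite[OF \<open>finite S\<close>] by (auto simp: atLeast0LessThan)
    have hS: "h i \<in> S" if "i < card S" for i
      using h that by (auto simp: bij_betw_def)
    have "(\<Sum>i<card S. norm (f ((d \<circ> h) i) - f ((c \<circ> h) i))) < e"
    proof (rule \<eta>[rule_format], intro conjI)
      show "\<forall>i<card S. a \<le> (c \<circ> h) i \<and> (c \<circ> h) i \<le> (d \<circ> h) i \<and> (d \<circ> h) i \<le> b"
        using S hS by simp
      show "disjoint_family_on (\<lambda>i. {(c \<circ> h) i<..<(d \<circ> h) i}) {..<card S}"
        unfolding disjoint_family_on_def
      proof (intro ballI impI)
        fix i j assume "i \<in> {..<card S}" "j \<in> {..<card S}" "i \<noteq> j"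
        then have "h i \<in> S" "h j \<in> S" "h i \<noteq> h j"
          using h hS by (auto simp: bij_betw_def inj_on_def)
        then show "{(c \<circ> h) i<..<(d \<circ> h) i} \<inter> {(c \<circ> h) j<..<(d \<circ> h) j} = {}"
          using S(3) unfolding disjoint_family_on_def o_def by blast
      qed
      show "(\<Sum>i<card S. (d \<circ> h) i - (c \<circ> h) i) < \<eta>"
        using S(4) sum.reindex_bij_betw[OF h, of "\<lambda>i. d i - c i"] by simp
    qed
    then show "(\<Sum>i\<in>S. norm (f (d i) - f (c i))) < e"
      using sum.reindex_bij_betw[OF h, of "\<lambda>i. norm (f (d i) - f (c i))"] by simp
  qed
qed

text \<open>The intervals of a fine tagged division whose tags lie in the exceptional null set have small
  total length, so absolute continuity controls them; the others are handled as in the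
  fundamental theorem of calculus.\<close>

lemma abs_continuous_fundamental_theorem:
  fixes f :: "real \<Rightarrow> 'a::banach"
  assumes "a \<le> b" "abs_continuous_on a b f" "negligible N"
    and vecd: "\<And>x. x \<in> {a..b} - N \<Longrightarrow> (f has_vector_derivative g x) (at x within {a..b})"
  shows "(g has_integral (f b - f a)) {a..b}"
proof -
  \<comment> \<open>With the value 0 on \<open>N\<close>, an interval tagged in \<open>N\<close>
    contributes only the increment of \<open>f\<close> to the error.\<close>
  define G where "G x = (if x \<in> N then 0 else g x)" for x
  have "(G has_integral (f b - f a)) (cbox a b)"
    unfolding has_integral
  proof safe
    fix e :: real assume "e > 0"
    \<comment> \<open>The summand 1 keeps the denominator positive when \<open>a = b\<close> and
      makes the estimate below strict.\<close>
    define e1 where "e1 = e / (2 * (b - a + 1))"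
    have "e1 > 0" using \<open>e > 0\<close> \<open>a \<le> b\<close> by (simp add: e1_def)
    have "e1 * (b - a) < e / 2"
      using \<open>e > 0\<close> \<open>a \<le> b\<close> by (simp add: e1_def field_simps)
    have "\<forall>x. \<exists>d>0. x \<in> {a..b} - N \<longrightarrow>
         (\<forall>y\<in>{a..b}. norm (y-x) < d \<longrightarrow> norm (f y - f x - (y-x) *\<^sub>R g x) \<le> e1 * norm (y-x))"
    proof
      fix x
      show "\<exists>d>0. x \<in> {a..b} - N \<longrightarrow>
         (\<forall>y\<in>{a..b}. norm (y-x) < d \<longrightarrow> norm (f y - f x - (y-x) *\<^sub>R g x) \<le> e1 * norm (y-x))"
        using vecd[of x, unfolded has_vector_derivative_def has_derivative_within_alt] \<open>e1 > 0\<close>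
        by (cases "x \<in> {a..b} - N") (blast, use zero_less_one in blast)
    qed
    then obtain d where d: "\<And>x. 0 < d x"
                 "\<And>x y. \<lbrakk>x \<in> {a..b} - N; y \<in> {a..b}; norm (y-x) < d x\<rbrakk>
                        \<Longrightarrow> norm (f y - f x - (y-x) *\<^sub>R g x) \<le> e1 * norm (y-x)"
      by metis
    obtain \<eta> where "0 < \<eta>" and \<eta>:
      "\<And>(S::(real \<times> real set) set) c d. \<lbrakk>finite S; \<And>i. i \<in> S \<Longrightarrow> a \<le> c i \<and> c i \<le> d i \<and> d i \<le> b;
       disjoint_family_on (\<lambda>i. {c i<..<d i}) S; (\<Sum>i\<in>S. d i - c i) < \<eta>\<rbrakk>
     \<Longrightarrow> (\<Sum>i\<in>S. norm (f (d i) - f (c i))) < e / 2"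
      by (rule abs_continuous_on_sum_lt[OF assms(2) half_gt_zero[OF \<open>e > 0\<close>]]) blast
    \<comment> \<open>The Riemann sum of the indicator over a tagged division is exactly the total
      length of the intervals tagged in \<open>N\<close>; integral zero makes it smaller than
      \<open>\<eta>\<close> for fine divisions.\<close>
    have "((indicator N :: real \<Rightarrow> real) has_integral 0) (cbox a b)"
      using assms(3) by (simp add: negligible_def)
    then obtain \<gamma> where \<gamma>: "gauge \<gamma>"
      "\<forall>p. p tagged_division_of (cbox a b) \<and> \<gamma> fine p \<longrightarrow>
         norm ((\<Sum>(x,K)\<in>p. measure lborel K *\<^sub>R (indicator N x :: real)) - 0) < \<eta>"
      using \<open>0 < \<eta>\<close> unfolding has_integral by (elim allE[of _ \<eta>] impE exE conjE)
    show "\<exists>\<gamma>. gauge \<gamma> \<and> (\<forall>p. p tagged_division_of (cbox a b) \<and> \<gamma> fine p \<longrightarrow>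
      norm ((\<Sum>(x, k)\<in>p. measure lborel k *\<^sub>R G x) - (f b - f a)) < e)"
    proof (intro exI conjI allI impI; (elim conjE)?)
      show "gauge (\<lambda>x. ball x (d x) \<inter> \<gamma> x)"
        by (intro gauge_Int gauge_ball_dependent \<gamma>(1)) (simp add: d(1))
    next
      fix p assume p: "p tagged_division_of (cbox a b)" and fine: "(\<lambda>x. ball x (d x) \<inter> \<gamma> x) fine p"
      have fin: "finite p" using p by (rule tagged_division_of_finite)
      have fine1: "(\<lambda>x. ball x (d x)) fine p" and fine2: "\<gamma> fine p"
        using fine by (auto simp: fine_Int)
      have fba: "f b - f a = (\<Sum>(x,K)\<in>p. f(Sup K) - f(Inf K))"
        and ba: "b - a = (\<Sum>(x,K)\<in>p. Sup K - Inf K)"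
        using additive_tagged_division_1[OF \<open>a \<le> b\<close>, of p f]
          additive_tagged_division_1[OF \<open>a \<le> b\<close>, of p "\<lambda>x. x"] p by auto
      have K: "\<exists>u v. K = {u..v} \<and> u \<le> v \<and> x \<in> K \<and> K \<subseteq> {a..b} \<and> Inf K = u \<and> Sup K = v \<and> a \<le> u \<and> v \<le> b"
        if xK: "(x,K) \<in> p" for x K
      proof -
        obtain u v where "K = cbox u v" "x \<in> K" "K \<subseteq> cbox a b"
          using tagged_division_ofD(2-4)[OF p xK] by blast
        then show ?thesis by (intro exI[of _ u] exI[of _ v]) auto
      qed
      define S where "S = {q\<in>p. fst q \<in> N}"
      have S: "finite S" "S \<subseteq> p" using fin by (auto simp: S_def)
      have bound1: "norm (\<Sum>q\<in>p - S. measure lborel (snd q) *\<^sub>R G (fst q) - (f (Sup (snd q)) - f (Inf (snd q))))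
        \<le> (\<Sum>q\<in>p - S. e1 * (Sup (snd q) - Inf (snd q)))"
      proof (rule sum_norm_le)
        fix q assume q: "q \<in> p - S"
        obtain x K where [simp]: "q = (x,K)" by fastforce
        have xK: "(x,K) \<in> p" "x \<notin> N" using q by (auto simp: S_def)
        obtain u v where uv: "K = {u..v}" "u \<le> v" "x \<in> K" "K \<subseteq> {a..b}" "Inf K = u" "Sup K = v"
          using K[OF xK(1)] by blast
        have ball: "K \<subseteq> ball x (d x)" using fine1 xK(1) by blast
        have xab: "x \<in> {a..b} - N" using uv xK(2) by blast
        have D: "norm (f y - f x - (y-x) *\<^sub>R g x) \<le> e1 * norm (y-x)" if "y \<in> K" for y
        proof (rule d(2)[OF xab])
          show "norm (y - x) < d x"
            using ball that by (auto simp: dist_real_def abs_minus_commute)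
        qed (use that uv(4) in blast)
        have "norm ((v - u) *\<^sub>R g x - (f v - f u)) =
           norm ((f u - f x - (u - x) *\<^sub>R g x) - (f v - f x - (v - x) *\<^sub>R g x))"
          by (auto simp: algebra_simps)
        also have "\<dots> \<le> e1 * norm (u - x) + e1 * norm (v - x)"
          by (rule order_trans[OF norm_triangle_ineq4 add_mono[OF D D]]) (use uv in auto)
        also have "\<dots> = e1 * (v - u)"
          using uv by (auto simp: algebra_simps)
        finally show "norm (measure lborel (snd q) *\<^sub>R G (fst q) - (f (Sup (snd q)) - f (Inf (snd q))))
          \<le> e1 * (Sup (snd q) - Inf (snd q))"
          using uv xK by (simp add: G_def)
      qed
      also have "\<dots> \<le> (\<Sum>q\<in>p. e1 * (Sup (snd q) - Inf (snd q)))"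
      proof (rule sum_mono2[OF fin])
        fix q assume "q \<in> p - (p - S)"
        then show "0 \<le> e1 * (Sup (snd q) - Inf (snd q))"
          using K[of "fst q" "snd q"] \<open>e1 > 0\<close> by auto
      qed auto
      also have "\<dots> = e1 * (b - a)"
        by (simp add: ba sum_distrib_left case_prod_unfold)
      finally have B1: "norm (\<Sum>q\<in>p - S. measure lborel (snd q) *\<^sub>R G (fst q) - (f (Sup (snd q)) - f (Inf (snd q)))) < e / 2"
        using \<open>e1 * (b - a) < e / 2\<close> by linarith
      have "(\<Sum>q\<in>S. norm (f (Sup (snd q)) - f (Inf (snd q)))) < e / 2"
      proof (rule \<eta>[OF S(1)])
        fix q assume "q \<in> S"
        then show "a \<le> Inf (snd q) \<and> Inf (snd q) \<le> Sup (snd q) \<and> Sup (snd q) \<le> b"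
          using K[of "fst q" "snd q"] S(2) by auto
      next
        show "disjoint_family_on (\<lambda>i. {Inf (snd i)<..<Sup (snd i)}) S"
          unfolding disjoint_family_on_def
        proof (intro ballI impI)
          fix q r assume qr: "q \<in> S" "r \<in> S" "q \<noteq> r"
          have "interior (snd q) \<inter> interior (snd r) = {}"
            using tagged_division_ofD(5)[OF p, of "fst q" "snd q" "fst r" "snd r"] qr S(2)
            by (auto simp: prod_eq_iff)
          moreover have "interior (snd i) = {Inf (snd i)<..<Sup (snd i)}" if "i \<in> S" for i
          proof -
            have "(fst i, snd i) \<in> p" using that S(2) by auto
            then obtain u v where "snd i = {u..v}" "u \<le> v" using K by blast
            then show ?thesis by simp
          qed
          ultimately show "{Inf (snd q)<..<Sup (snd q)} \<inter> {Inf (snd r)<..<Sup (snd r)} = {}"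
            using qr by metis
        qed
      next
        have "(\<Sum>i\<in>S. Sup (snd i) - Inf (snd i)) = (\<Sum>i\<in>S. measure lborel (snd i) *\<^sub>R (indicator N (fst i) :: real))"
        proof (rule sum.cong[OF refl])
          fix q assume q: "q \<in> S"
          then obtain u v where "snd q = {u..v}" "u \<le> v" using K[of "fst q" "snd q"] S(2) by auto
          then show "Sup (snd q) - Inf (snd q) = measure lborel (snd q) *\<^sub>R (indicator N (fst q) :: real)"
            using q by (simp add: S_def)
        qed
        also have "\<dots> = (\<Sum>i\<in>p. measure lborel (snd i) *\<^sub>R (indicator N (fst i) :: real))"
          by (rule sum.mono_neutral_left) (auto simp: fin S_def)
        also have "\<dots> < \<eta>"
          using \<gamma>(2)[rule_format, OF conjI[OF p fine2]] by (simp add: case_prod_unfold abs_less_iff)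
        finally show "(\<Sum>i\<in>S. Sup (snd i) - Inf (snd i)) < \<eta>" .
      qed
      then have B2: "norm (\<Sum>q\<in>S. measure lborel (snd q) *\<^sub>R G (fst q) - (f (Sup (snd q)) - f (Inf (snd q)))) < e / 2"
        by (intro le_less_trans[OF norm_sum])
          (simp add: S_def G_def norm_minus_commute)
      have "(\<Sum>(x, k)\<in>p. measure lborel k *\<^sub>R G x) - (f b - f a) =
        (\<Sum>q\<in>p. measure lborel (snd q) *\<^sub>R G (fst q) - (f (Sup (snd q)) - f (Inf (snd q))))"
        by (simp add: fba sum_subtractf case_prod_unfold)
      also have "\<dots> = (\<Sum>q\<in>p - S. measure lborel (snd q) *\<^sub>R G (fst q) - (f (Sup (snd q)) - f (Inf (snd q)))) +
         (\<Sum>q\<in>S. measure lborel (snd q) *\<^sub>R G (fst q) - (f (Sup (snd q)) - f (Inf (snd q))))"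
        by (rule sum.subset_diff[OF S(2) fin])
      finally show "norm ((\<Sum>(x, k)\<in>p. measure lborel k *\<^sub>R G x) - (f b - f a)) < e"
        using norm_triangle_lt[OF add_strict_mono[OF B1 B2]] by simp
    qed
  qed
  then show ?thesis
    using has_integral_spike[OF assms(3), of "{a..b}" g G] by (simp add: G_def)
qed

text \<open>By the fundamental theorem \<open>f\<close> is a constant plus the integral of
  \<open>g\<close>, and continuity of \<open>g\<close> makes that integral differentiable at every
  point, including those of \<open>N\<close>. This turns a weak solution into a classical
  one.\<close>

lemma abs_continuous_has_vector_derivative:
  fixes f :: "real \<Rightarrow> 'a::banach"
  assumes "a \<le> b" "\<And>t. t \<in> {a..b} \<Longrightarrow> abs_continuous_on a t f" "negligible N"
    and vecd: "\<And>x. x \<in> {a..b} - N \<Longrightarrow> (f has_vector_derivative g x) (at x within {a..b})"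
    and g: "continuous_on {a..b} g" and t: "t \<in> {a..b}"
  shows "(f has_vector_derivative g t) (at t within {a..b})"
proof -
  have eq: "f a + integral {a..s} g = f s" if "s \<in> {a..b}" for s
  proof -
    have "(g has_integral (f s - f a)) {a..s}"
      using that assms(2) has_vector_derivative_within_subset[OF vecd]
      by (intro abs_continuous_fundamental_theorem[OF _ _ assms(3)]) auto
    then show ?thesis by (simp add: integral_unique)
  qed
  have "((\<lambda>s. f a + integral {a..s} g) has_vector_derivative g t) (at t within {a..b})"
    using integral_has_vector_derivative[OF g t] by (auto intro!: derivative_eq_intros)
  then show ?thesis
    by (rule has_vector_derivative_transform[OF t, rotated]) (simp add: eq)
qed

lemma lipschitz_on_abs_continuous_on:
  assumes "L-lipschitz_on {a..b} f"
  shows "abs_continuous_on a b f"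
  unfolding abs_continuous_on_def
proof (intro allI impI)
  fix e :: real assume "e > 0"
  have L: "L \<ge> 0" using assms by (rule lipschitz_on_nonneg)
  show "\<exists>\<eta>>0. \<forall>(m::nat) c d. (\<forall>i<m. a \<le> c i \<and> c i \<le> d i \<and> d i \<le> b) \<and>
     disjoint_family_on (\<lambda>i. {c i<..<d i}) {..<m} \<and> (\<Sum>i<m. d i - c i) < \<eta>
     \<longrightarrow> (\<Sum>i<m. norm (f (d i) - f (c i))) < e"
  proof (intro exI conjI allI impI)
    show "e / (L + 1) > 0" using L \<open>e > 0\<close> by simp
    fix m :: nat and c d :: "nat \<Rightarrow> real"
    assume *: "(\<forall>i<m. a \<le> c i \<and> c i \<le> d i \<and> d i \<le> b) \<and>
     disjoint_family_on (\<lambda>i. {c i<..<d i}) {..<m} \<and> (\<Sum>i<m. d i - c i) < e / (L + 1)"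
    have "(\<Sum>i<m. norm (f (d i) - f (c i))) \<le> (\<Sum>i<m. L * (d i - c i))"
      using * by (intro sum_mono) (auto intro!: order_trans[OF lipschitz_on_normD[OF assms]])
    also have "\<dots> = L * (\<Sum>i<m. d i - c i)" by (simp add: sum_distrib_left)
    also have "\<dots> \<le> (L + 1) * (\<Sum>i<m. d i - c i)"
      using * by (intro mult_right_mono sum_nonneg) auto
    also have "\<dots> < e" using * L by (simp add: field_simps)
    finally show "(\<Sum>i<m. norm (f (d i) - f (c i))) < e" .
  qed
qed

subsection \<open>Limits along trajectories\<close>

text \<open>On the compact part of \<open>K\<close> where \<open>norm (h x)\<close> is at least
  \<open>e\<close>, the function \<open>g\<close> has no zero, so \<open>norm (g x)\<close> attains
  a positive minimum there; this minimum is \<open>v\<close>.\<close>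

lemma small_of_zeros_subset:
  fixes g :: "'a::metric_space \<Rightarrow> 'b::real_normed_vector" and h :: "'a \<Rightarrow> 'c::real_normed_vector"
  assumes "compact K" "continuous_on K g" "continuous_on K h"
    and zero: "\<And>x. x \<in> K \<Longrightarrow> g x = 0 \<Longrightarrow> h x = 0" and "e > 0"
  shows "\<exists>v>0. \<forall>x\<in>K. norm (g x) < v \<longrightarrow> norm (h x) < e"
proof -
  define K' where "K' = K \<inter> (\<lambda>y. norm (h y)) -` {e..}"
  have "closed K'"
    unfolding K'_def
    by (intro continuous_closed_preimage compact_imp_closed assms continuous_intros closed_atLeast)
  then have K': "compact K'"
    using compact_Int_closed[OF assms(1) \<open>closed K'\<close>] by (simp add: K'_def Int_assoc[symmetric])
  show ?thesis
  proof (cases "K' = {}")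
    case True
    then have "norm (h y) < e" if "y \<in> K" for y
      using that by (force simp: K'_def)
    then show ?thesis by (intro exI[of _ 1]) simp
  next
    case False
    have "continuous_on K' (\<lambda>y. norm (g y))"
      using assms(2) by (intro continuous_on_norm) (auto simp: K'_def elim: continuous_on_subset)
    then obtain z where z: "z \<in> K'" "\<And>y. y \<in> K' \<Longrightarrow> norm (g z) \<le> norm (g y)"
      using continuous_attains_inf[OF K' False] by blast
    show ?thesis
    proof (intro exI[of _ "norm (g z)"] conjI ballI impI)
      show "norm (g z) > 0"
        using z(1) zero[of z] \<open>e > 0\<close> by (auto simp: K'_def)
      show "norm (h x) < e" if "x \<in> K" "norm (g x) < norm (g z)" for x
        using z(2)[of x] that by (force simp: K'_def)
    qed
  qed
qed

text \<open>The substitute for a limit-set argument: for a trajectory in a compact set, an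
  implication between zero sets becomes an implication between limits.\<close>

lemma tendsto_zero_of_zeros_subset:
  fixes g :: "'a::metric_space \<Rightarrow> 'b::real_normed_vector" and h :: "'a \<Rightarrow> 'c::real_normed_vector"
  assumes "compact K" "continuous_on K g" "continuous_on K h"
    and "\<And>x. x \<in> K \<Longrightarrow> g x = 0 \<Longrightarrow> h x = 0"
    and x: "eventually (\<lambda>t. x t \<in> K) F" and lim: "((\<lambda>t. g (x t)) \<longlongrightarrow> 0) F"
  shows "((\<lambda>t. h (x t)) \<longlongrightarrow> 0) F"
proof (rule tendstoI)
  fix e :: real assume "e > 0"
  obtain v where v: "v > 0" "\<forall>x\<in>K. norm (g x) < v \<longrightarrow> norm (h x) < e"
    using small_of_zeros_subset[OF assms(1-4) \<open>e > 0\<close>] by blast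
  have "eventually (\<lambda>t. norm (g (x t)) < v) F"
    using tendstoD[OF lim v(1)] by simp
  then show "eventually (\<lambda>t. dist (h (x t)) 0 < e) F" using x
    by eventually_elim (simp add: v(2))
qed

text \<open>Over a window of fixed length \<open>h\<close> the increment of \<open>f\<close> tends
  to 0, while uniform continuity keeps it within \<open>h * (e / 2)\<close> of
  \<open>h *\<^sub>R g t\<close>. Derivatives are taken within closed segments, the form in which
  the flow supplies them.\<close>

lemma barbalat:
  fixes f g :: "real \<Rightarrow> 'a::real_normed_vector"
  assumes der: "\<And>a b t. \<lbrakk>T \<le> a; t \<in> {a..b}\<rbrakk> \<Longrightarrow> (f has_vector_derivative g t) (at t within {a..b})"
    and lim: "(f \<longlongrightarrow> L) at_top" and uc: "uniformly_continuous_on {T..} g"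
  shows "(g \<longlongrightarrow> 0) at_top"
proof (rule tendstoI)
  fix e :: real assume "e > 0"
  then obtain d where d: "d > 0" "\<And>s t. s \<ge> T \<Longrightarrow> t \<ge> T \<Longrightarrow> dist s t < d \<Longrightarrow> dist (g s) (g t) < e / 2"
    using uniformly_continuous_onE[OF uc, of "e/2"] by (metis atLeast_iff half_gt_zero)
  define h where "h = d / 2"
  have "h > 0" "h < d" using d(1) by (auto simp: h_def)
  have "((\<lambda>t. f (t + h)) \<longlongrightarrow> L) at_top"
    using lim by (rule filterlim_compose) (rule filterlim_tendsto_add_at_top[OF tendsto_const filterlim_ident, of h, simplified add.commute])
  then have "((\<lambda>t. f (t + h) - f t) \<longlongrightarrow> L - L) at_top"
    using lim by (rule tendsto_diff)
  then have "eventually (\<lambda>t. norm (f (t + h) - f t) < h * (e / 2)) at_top"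
    using tendstoD[of "\<lambda>t. f (t + h) - f t" 0 at_top "h * (e/2)"] \<open>h > 0\<close> \<open>e > 0\<close> by simp
  then show "eventually (\<lambda>t. dist (g t) 0 < e) at_top"
    using eventually_ge_at_top[of T]
  proof eventually_elim
    case (elim t)
    have "norm (f (t + h) - f t - (t + h - t) *\<^sub>R g t) \<le> norm (t + h - t) * (e / 2)"
    proof (rule vector_differentiable_bound_linearization[where S = "{t..t+h}"])
      show "(f has_vector_derivative g s) (at s within {t..t + h})" if "s \<in> {t..t + h}" for s
        using der elim(2) that by blast
      show "closed_segment t (t + h) \<subseteq> {t..t + h}"
        using \<open>h > 0\<close> by (simp add: closed_segment_eq_real_ivl)
      show "norm (g s - g t) \<le> e / 2" if "s \<in> {t..t + h}" for s
        using d(2)[of s t] that elim(2) \<open>h < d\<close> by (auto simp: dist_norm)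
      show "t \<in> {t..t + h}" using \<open>h > 0\<close> by simp
    qed
    then have "norm (f (t + h) - f t - h *\<^sub>R g t) \<le> h * (e / 2)" using \<open>h > 0\<close> by simp
    moreover have "norm (h *\<^sub>R g t) \<le> norm (f (t + h) - f t) + norm (f (t + h) - f t - h *\<^sub>R g t)"
      by (metis norm_minus_commute norm_triangle_sub)
    moreover have "h * (e / 2) + h * (e / 2) = h * e" "norm (h *\<^sub>R g t) = h * norm (g t)"
      using \<open>h > 0\<close> by simp_all
    ultimately have "h * norm (g t) < h * e"
      using elim(1) by linarith
    then show ?case using \<open>h > 0\<close> by simp
  qed
qed

subsection \<open>Local existence for continuous vector fields\<close>

text \<open>The Picard operator of the delayed equation \<open>x'(t) = F (x (t - h))\<close>, as in
  Tonelli's approximation. For negative \<open>t\<close> the interval is empty and the value is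
  \<open>x0\<close>, which serves as the history.\<close>

definition delay_picard :: "'a::euclidean_space \<Rightarrow> ('a \<Rightarrow> 'a) \<Rightarrow> real \<Rightarrow> (real \<Rightarrow> 'a) \<Rightarrow> real \<Rightarrow> 'a" where
  "delay_picard x0 F h x t = x0 + integral {0..t} (\<lambda>s. F (x (s - h)))"

text \<open>The constant \<open>M\<close> depends neither on the delay nor on \<open>x\<close>; this
  yields the equicontinuity used when the delay tends to 0.\<close>

lemma delay_picard_lipschitz:
  fixes x0 :: "'a::euclidean_space"
  assumes F: "continuous_on UNIV F" "\<And>x. norm (F x) \<le> M" and x: "continuous_on UNIV x"
  shows "M-lipschitz_on UNIV (delay_picard x0 F h x)"
proof (rule lipschitz_on_leI)
  show "0 \<le> M" using F(2)[of 0] norm_ge_zero order_trans by blast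
  have cont: "continuous_on S (\<lambda>s. F (x (s - h)))" for S
    by (rule continuous_on_compose2[OF F(1)]) (auto intro!: continuous_on_compose2[OF x] continuous_intros)
  have main: "dist (delay_picard x0 F h x s) (delay_picard x0 F h x t) \<le> M * (t - s)"
    if "0 \<le> s" "s \<le> t" for s t
  proof -
    have "delay_picard x0 F h x t - delay_picard x0 F h x s = integral {s..t} (\<lambda>s. F (x (s - h)))"
      using Henstock_Kurzweil_Integration.integral_combine[OF that, of "\<lambda>s. F (x (s - h))"] cont
      by (simp add: delay_picard_def integrable_continuous_real algebra_simps)
    also have "norm \<dots> \<le> M * (t - s)"
      by (rule integral_bound[OF that(2) cont]) (rule F(2))
    finally show ?thesis by (simp add: dist_norm norm_minus_commute)
  qed
  fix s t :: real assume "s \<le> t"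
  have neg: "delay_picard x0 F h x r = delay_picard x0 F h x (max 0 r)" for r
    by (cases "r < 0") (auto simp: delay_picard_def)
  have "dist (delay_picard x0 F h x s) (delay_picard x0 F h x t) \<le> M * (max 0 t - max 0 s)"
    using main[of "max 0 s" "max 0 t"] neg[of s] neg[of t] \<open>s \<le> t\<close> by simp
  also have "\<dots> \<le> M * (t - s)"
    using \<open>0 \<le> M\<close> \<open>s \<le> t\<close> by (intro mult_left_mono) auto
  finally show "dist (delay_picard x0 F h x s) (delay_picard x0 F h x t) \<le> M * dist s t"
    using \<open>s \<le> t\<close> by (simp add: dist_real_def)
qed

text \<open>With delay \<open>h\<close> the Picard iteration becomes stationary on \<open>[0, m h]\<close> after \<open>m\<close> steps, so the
  delayed equation has a solution.\<close>

lemma delay_picard_fixpoint: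
  fixes x0 :: "'a::euclidean_space"
  assumes F: "continuous_on UNIV F" "\<And>x. norm (F x) \<le> M" and "h \<ge> 0"
  obtains z where "M-lipschitz_on UNIV z"
    "\<And>t. t \<le> real m * h \<Longrightarrow> z t = x0 + integral {0..t} (\<lambda>s. F (z (s - h)))"
proof -
  define X where "X m = (delay_picard x0 F h ^^ m) (\<lambda>_. x0)" for m
  have X_Suc: "X (Suc m) = delay_picard x0 F h (X m)" for m by (simp add: X_def)
  have M: "0 \<le> M" using F(2)[of 0] norm_ge_zero order_trans by blast
  have lip: "M-lipschitz_on UNIV (X m)" for m
  proof (induction m)
    case 0
    show ?case using lipschitz_on_le[OF lipschitz_on_constant M] by (simp add: X_def)
  next
    case (Suc m)
    then show ?case
      unfolding X_Suc by (intro delay_picard_lipschitz F lipschitz_on_continuous_on)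
  qed
  have "X (Suc m) t = X m t" if "t \<le> real m * h" for m t
    using that
  proof (induction m arbitrary: t)
    case 0
    then show ?case by (cases "t = 0") (auto simp: X_def delay_picard_def)
  next
    case (Suc m)
    have "integral {0..t} (\<lambda>s. F (X (Suc m) (s - h))) = integral {0..t} (\<lambda>s. F (X m (s - h)))"
    proof (rule integral_cong)
      fix s assume "s \<in> {0..t}"
      then have "s - h \<le> real m * h" using Suc.prems by (auto simp: algebra_simps)
      then show "F (X (Suc m) (s - h)) = F (X m (s - h))" using Suc.IH by simp
    qed
    then have "delay_picard x0 F h (X (Suc m)) t = delay_picard x0 F h (X m) t"
      by (simp only: delay_picard_def)
    then show ?case by (simp only: X_Suc)
  qed
  then have "X m t = x0 + integral {0..t} (\<lambda>s. F (X m (s - h)))" if "t \<le> real m * h" for t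
    using that by (metis X_Suc delay_picard_def)
  then show thesis using that[OF lip[of m]] by blast
qed

text \<open>The solutions with delay \<open>h n\<close> share the Lipschitz constant
  \<open>M\<close> and the initial value, so Arzela-Ascoli gives a uniformly convergent subsequence.
  A delayed argument changes the value by at most \<open>M * h n\<close>, and dominated convergence
  with bound \<open>M\<close> passes the integral equation to the limit.\<close>

lemma peano_global:
  fixes x0 :: "'a::euclidean_space"
  assumes F: "continuous_on UNIV F" "\<And>x. norm (F x) \<le> M" and "c > 0"
  obtains y where "y 0 = x0" "M-lipschitz_on {0..c} y"
    "\<And>t. t \<in> {0..c} \<Longrightarrow> (y has_vector_derivative F (y t)) (at t within {0..c})"
proof -
  have M: "0 \<le> M" using F(2)[of 0] norm_ge_zero order_trans by blast
  \<comment> \<open>Chosen so that \<open>Suc n\<close> steps of length \<open>h n\<close> cover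
    exactly \<open>{0..c}\<close>, the range on which the fixpoint equation is available.\<close>
  define h where "h n = c / real (Suc n)" for n
  have h: "h n > 0" "real (Suc n) * h n = c" for n using \<open>c > 0\<close> by (auto simp: h_def)
  have "\<exists>z. M-lipschitz_on UNIV z \<and> (\<forall>t\<le>c. z t = x0 + integral {0..t} (\<lambda>s. F (z (s - h n))))" for n
    using delay_picard_fixpoint[OF F, of "h n" "Suc n" x0] h(1)[of n] unfolding h(2)
    by (metis less_eq_real_def)
  then obtain Z where lip: "\<And>n. M-lipschitz_on UNIV (Z n)"
    and Z: "\<And>n t. t \<le> c \<Longrightarrow> Z n t = x0 + integral {0..t} (\<lambda>s. F (Z n (s - h n)))"
    by metis
  have Z0: "Z n 0 = x0" for n using Z[of 0 n] \<open>c > 0\<close> by simp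
  obtain g k where g: "continuous_on {0..c} g" "strict_mono (k :: nat \<Rightarrow> nat)"
    "\<And>e. 0 < e \<Longrightarrow> \<exists>N. \<forall>n x. n \<ge> N \<and> x \<in> {0..c} \<longrightarrow> norm(Z (k n) x - g x) < e"
  proof (rule Arzela_Ascoli[of "{0..c}" Z "norm x0 + M * c"])
    show "norm (Z n t) \<le> norm x0 + M * c" if "t \<in> {0..c}" for n t
    proof -
      have "norm (Z n t - Z n 0) \<le> M * norm (t - 0)"
        using lipschitz_on_normD[OF lip] by blast
      also have "\<dots> \<le> M * c" using that M by (intro mult_left_mono) auto
      finally show ?thesis using Z0[of n] norm_triangle_sub[of "Z n t" x0] by simp
    qed
    show "\<exists>d. 0 < d \<and> (\<forall>n y. y \<in> {0..c} \<and> norm (x - y) < d \<longrightarrow> norm (Z n x - Z n y) < e)"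
      if "x \<in> {0..c}" "0 < e" for x e
    proof (intro exI conjI allI impI)
      show "0 < e / (M + 1)" using M that by simp
      fix n y assume *: "y \<in> {0..c} \<and> norm (x - y) < e / (M + 1)"
      have "norm (Z n x - Z n y) \<le> M * norm (x - y)" using lipschitz_on_normD[OF lip] by blast
      also have "\<dots> \<le> (M + 1) * norm (x - y)" by (intro mult_right_mono) auto
      also have "\<dots> < e" using * M by (simp add: field_simps)
      finally show "norm (Z n x - Z n y) < e" .
    qed
  qed auto
  have lim: "(\<lambda>n. Z (k n) t) \<longlonglongrightarrow> g t" if "t \<in> {0..c}" for t
    using g(3) that unfolding LIMSEQ_iff by meson
  have "h \<longlonglongrightarrow> 0" unfolding h_def
    using LIMSEQ_Suc[OF lim_const_over_n[of c]] by simp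
  then have hk: "(\<lambda>n. h (k n)) \<longlonglongrightarrow> 0"
    using LIMSEQ_subseq_LIMSEQ[OF _ g(2)] by (auto simp: o_def)
  have cont: "continuous_on S (\<lambda>s. F (Z n (s - h n)))" for S n
    by (rule continuous_on_compose2[OF F(1)])
      (auto intro!: continuous_on_compose2[OF lipschitz_on_continuous_on[OF lip]] continuous_intros)
  have contg: "continuous_on {0..c} (\<lambda>s. F (g s))"
    by (rule continuous_on_compose2[OF F(1) g(1)]) auto
  have geq: "x0 + integral {0..t} (\<lambda>s. F (g s)) = g t" if t: "t \<in> {0..c}" for t
  proof -
    have "(\<lambda>n. integral {0..t} (\<lambda>s. F (Z (k n) (s - h (k n))))) \<longlonglongrightarrow> integral {0..t} (\<lambda>s. F (g s))"
    proof (rule dominated_convergence(2)[where h = "\<lambda>_. M"])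
      show "(\<lambda>s. F (Z (k n) (s - h (k n)))) integrable_on {0..t}" for n
        by (intro integrable_continuous_real cont)
      show "norm (F (Z (k n) (s - h (k n)))) \<le> M" for n s by (rule F(2))
      show "(\<lambda>n. F (Z (k n) (s - h (k n)))) \<longlonglongrightarrow> F (g s)" if "s \<in> {0..t}" for s
      proof -
        have "(\<lambda>n. Z (k n) (s - h (k n)) - Z (k n) s) \<longlonglongrightarrow> 0"
        proof (rule Lim_null_comparison)
          show "\<forall>\<^sub>F n in sequentially. norm (Z (k n) (s - h (k n)) - Z (k n) s) \<le> M * h (k n)"
            using lipschitz_on_normD[OF lip, of "s - h (k n)" s "k n" for n] h(1)
            by (intro always_eventually allI) (simp add: less_imp_le)
          show "(\<lambda>n. M * h (k n)) \<longlonglongrightarrow> 0"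
            using tendsto_mult_left[OF hk, of M] by simp
        qed
        then have "(\<lambda>n. (Z (k n) (s - h (k n)) - Z (k n) s) + Z (k n) s) \<longlonglongrightarrow> 0 + g s"
          using lim that t by (intro tendsto_add) auto
        then have "(\<lambda>n. Z (k n) (s - h (k n))) \<longlonglongrightarrow> g s" by simp
        then show ?thesis
          by (rule isCont_tendsto_compose[rotated]) (use F(1) in \<open>simp add: continuous_on_eq_continuous_at\<close>)
      qed
    qed (auto)
    then have "(\<lambda>n. x0 + integral {0..t} (\<lambda>s. F (Z (k n) (s - h (k n))))) \<longlonglongrightarrow> x0 + integral {0..t} (\<lambda>s. F (g s))"
      by (intro tendsto_add tendsto_const)
    then have "(\<lambda>n. Z (k n) t) \<longlonglongrightarrow> x0 + integral {0..t} (\<lambda>s. F (g s))"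
      using Z[of t] t by simp
    then show ?thesis using lim[OF t] LIMSEQ_unique by blast
  qed
  show thesis
  proof (rule that)
    show "g 0 = x0" using geq[of 0] \<open>c > 0\<close> by simp
    show "M-lipschitz_on {0..c} g"
    proof (rule lipschitz_onI[OF _ M])
      fix s t assume st: "s \<in> {0..c}" "t \<in> {0..c}"
      show "dist (g s) (g t) \<le> M * dist s t"
        by (rule LIMSEQ_le_const2[OF tendsto_dist[OF lim[OF st(1)] lim[OF st(2)]]])
          (use lipschitz_onD[OF lip] in blast)
    qed
    fix t assume t: "t \<in> {0..c}"
    have "((\<lambda>t. x0 + integral {0..t} (\<lambda>s. F (g s))) has_vector_derivative F (g t)) (at t within {0..c})"
      using integral_has_vector_derivative[OF contg t] by (auto intro!: derivative_eq_intros)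
    then show "(g has_vector_derivative F (g t)) (at t within {0..c})"
      by (rule has_vector_derivative_transform[OF t, rotated]) (simp add: geq)
  qed
qed

text \<open>Composing \<open>F\<close> with the projection to the ball gives a bounded continuous
  field on the whole space. At speed at most \<open>M\<close> its solution stays in the ball up to
  time \<open>r / M\<close>, and there both fields agree.\<close>

theorem peano:
  fixes x0 :: "'a::euclidean_space"
  assumes "r > 0" "continuous_on (cball x0 r) F"
  obtains c y where "c > 0" "y 0 = x0" "\<And>t. t \<in> {0..c} \<Longrightarrow> y t \<in> cball x0 r"
    "\<And>t. t \<in> {0..c} \<Longrightarrow> (y has_vector_derivative F (y t)) (at t within {0..c})"
proof -
  define G where "G x = F (closest_point (cball x0 r) x)" for x
  have ne: "cball x0 r \<noteq> {}" using \<open>r > 0\<close> by auto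
  have G: "continuous_on UNIV G"
    unfolding G_def
    by (rule continuous_on_compose2[OF assms(2)])
      (use ne in \<open>auto intro!: continuous_on_closest_point closest_point_in_set simp del: mem_cball\<close>)
  have "bounded (F ` cball x0 r)"
    by (intro compact_imp_bounded compact_continuous_image assms compact_cball)
  then obtain M where M: "M > 0" "\<And>x. x \<in> cball x0 r \<Longrightarrow> norm (F x) \<le> M"
    unfolding bounded_pos ball_simps by blast
  have GM: "norm (G x) \<le> M" for x
    unfolding G_def by (intro M closest_point_in_set ne closed_cball)
  have "r / M > 0" using \<open>r > 0\<close> M by simp
  from peano_global[OF G GM this, of x0] obtain y where y: "y 0 = x0" "M-lipschitz_on {0..r/M} y"
    "\<And>t. t \<in> {0..r/M} \<Longrightarrow> (y has_vector_derivative G (y t)) (at t within {0..r/M})" by blast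
  have ball: "y t \<in> cball x0 r" if "t \<in> {0..r/M}" for t
  proof -
    have "dist (y 0) (y t) \<le> M * dist 0 t"
      using \<open>r / M > 0\<close> that by (intro lipschitz_onD[OF y(2)]) auto
    also have "\<dots> \<le> r" using that M by (auto simp: dist_real_def field_simps)
    finally show ?thesis using y(1) by simp
  qed
  show thesis
  proof (rule that[of "r / M" y])
    show "r / M > 0" "y 0 = x0" by fact+
    show "y t \<in> cball x0 r" if "t \<in> {0..r/M}" for t using ball[OF that] .
    fix t assume t: "t \<in> {0..r/M}"
    then show "(y has_vector_derivative F (y t)) (at t within {0..r/M})"
      using y(3)[OF t] ball[OF t] by (simp add: G_def closest_point_self del: mem_cball)
  qed
qed

subsection \<open>Rotations\<close>

interpretation matrix_mult: bounded_bilinear "(**) :: real^3^3 \<Rightarrow> real^3^3 \<Rightarrow> real^3^3"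
  by (rule bounded_bilinear_matrix_mult)

lemmas transpose_linear = bounded_linear_transpose[THEN bounded_linear.linear, THEN linear_add]
  bounded_linear_transpose[THEN bounded_linear.linear, THEN linear_diff]
  bounded_linear_transpose[THEN bounded_linear.linear, THEN linear_scale]
  bounded_linear_transpose[THEN bounded_linear.linear, THEN linear_neg]
  bounded_linear_transpose[THEN bounded_linear.linear, THEN linear_0]

interpretation matrix_vector: bounded_bilinear "(*v) :: real^3^3 \<Rightarrow> real^3 \<Rightarrow> real^3"
  by (rule bilinear_conv_bounded_bilinear[THEN iffD1])
     (auto simp: bilinear_def linear_iff matrix_vector_mult_def vec_eq_iff sum.distrib
        algebra_simps sum_distrib_left)

lemma bounded_linear_trace: "bounded_linear (trace :: real^3^3 \<Rightarrow> real)"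
  by (rule linear_conv_bounded_linear[THEN iffD1])
     (auto simp: linear_iff trace_def sum.distrib sum_distrib_left)

lemmas trace_linear = bounded_linear_trace[THEN bounded_linear.linear, THEN linear_add]
  bounded_linear_trace[THEN bounded_linear.linear, THEN linear_diff]
  bounded_linear_trace[THEN bounded_linear.linear, THEN linear_scale]
  bounded_linear_trace[THEN bounded_linear.linear, THEN linear_neg]
  bounded_linear_trace[THEN bounded_linear.linear, THEN linear_0]

lemma skew_component: "skew x $ i $ j = cross3 x (axis j 1) $ i"
  by (simp add: skew_def matrix_def)

lemma skew_components:
  "skew x $ 1 $ 1 = 0" "skew x $ 1 $ 2 = - x $ 3" "skew x $ 1 $ 3 = x $ 2"
  "skew x $ 2 $ 1 = x $ 3" "skew x $ 2 $ 2 = 0" "skew x $ 2 $ 3 = - x $ 1"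
  "skew x $ 3 $ 1 = - x $ 2" "skew x $ 3 $ 2 = x $ 1" "skew x $ 3 $ 3 = 0"
  by (simp_all add: skew_component cross3_simps axis_def)

lemma bounded_linear_skew: "bounded_linear skew"
  by (rule linear_conv_bounded_linear[THEN iffD1])
     (auto simp: linear_iff vec_eq_iff forall_3 skew_components)

lemma skew_eq_0_iff: "skew x = 0 \<longleftrightarrow> x = 0"
  by (auto simp: vec_eq_iff forall_3 skew_components)

lemma skew_surj:
  assumes "transpose M = - M" obtains w where "M = skew w"
proof
  have "M $ j $ i = - (M $ i $ j)" for i j
    using arg_cong[OF assms, of "\<lambda>N. N $ i $ j"] by (simp add: transpose_def)
  from this[of 1 1] this[of 2 2] this[of 3 3] this[of 1 2] this[of 1 3] this[of 2 3]
  show "M = skew (vector [M$3$2, M$1$3, M$2$1])"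
    by (simp add: vec_eq_iff forall_3 skew_components)
qed

lemma vex_skew [simp]: "vex (skew x) = x"
proof -
  have "inj skew"
    by (auto simp: inj_def vec_eq_iff forall_3 skew_components)
  then show ?thesis by (simp add: vex_def)
qed

lemma psi_eq: "psi M = (1/2) *\<^sub>R vector [M$3$2 - M$2$3, M$1$3 - M$3$1, M$2$1 - M$1$2]"
proof -
  have "(1/2) *\<^sub>R (M - transpose M) = skew ((1/2) *\<^sub>R vector [M$3$2 - M$2$3, M$1$3 - M$3$1, M$2$1 - M$1$2])"
    by (simp add: vec_eq_iff forall_3 skew_components transpose_def field_simps)
  then show ?thesis by (simp add: psi_def)
qed

lemma bounded_linear_psi: "bounded_linear psi"
  by (rule linear_conv_bounded_linear[THEN iffD1])
     (auto simp: linear_iff vec_eq_iff forall_3 psi_eq algebra_simps)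

text \<open>Only the skew part of \<open>M\<close> pairs with \<open>skew w\<close>, and the trace
  of a product of two skew matrices is minus twice the inner product of their vectors. The factors 2
  in the derivatives below come from here.\<close>

lemma trace_mult_skew: "trace (M ** skew w) = - 2 * (psi M \<bullet> w)"
  by (simp add: trace_def matrix_matrix_mult_def sum_3 psi_eq skew_components inner_vec_def field_simps)

lemma SO3_D:
  assumes "R \<in> SO3"
  shows "transpose R ** R = mat 1" "R ** transpose R = mat 1" "det R = 1"
  using assms by (auto simp: SO3_def rotation_matrix_def orthogonal_matrix_def)

lemma SO3_I:
  assumes "transpose R ** R = mat 1" "det R = 1"
  shows "R \<in> SO3"
  using assms by (simp add: SO3_def rotation_matrix_def orthogonal_matrix)

lemma mat_1_SO3 [simp]: "mat 1 \<in> SO3"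
  by (rule SO3_I) (simp_all add: transpose_mat)

lemma SO3_mult: "R \<in> SO3 \<Longrightarrow> S \<in> SO3 \<Longrightarrow> R ** S \<in> SO3"
  by (simp add: SO3_def rotation_matrix_def orthogonal_matrix_mul det_mul)

lemma transpose_SO3: "R \<in> SO3 \<Longrightarrow> transpose R \<in> SO3"
  by (simp add: SO3_def rotation_matrix_def)

lemma norm_SO3_mult:
  assumes "R \<in> SO3" shows "norm (R *v x) = norm x"
proof -
  have "orthogonal_transformation ((*v) R)"
    using assms by (simp add: SO3_def rotation_matrix_def orthogonal_transformation_matrix)
  then show ?thesis by (rule orthogonal_transformation_norm)
qed

lemma inner_SO3_mult:
  assumes "R \<in> SO3" shows "(R *v x) \<bullet> (R *v y) = x \<bullet> y"
proof -
  have "orthogonal_transformation ((*v) R)"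
    using assms by (simp add: SO3_def rotation_matrix_def orthogonal_transformation_matrix)
  then show ?thesis by (simp add: orthogonal_transformation_def)
qed

lemma continuous_on_det3:
  fixes f :: "'a::topological_space \<Rightarrow> real^3^3"
  assumes "continuous_on S f" shows "continuous_on S (\<lambda>x. det (f x))"
  unfolding det_3 by (intro continuous_intros assms)

lemma SO3_trace: "R \<in> SO3 \<Longrightarrow> (norm R)\<^sup>2 = 3"
proof -
  assume R: "R \<in> SO3"
  have "(norm R)\<^sup>2 = trace (transpose R ** R)"
    by (simp add: power2_norm_eq_inner inner_vec_def trace_def matrix_matrix_mult_def transpose_def sum_3)
  then show ?thesis using SO3_D(1)[OF R] by (simp add: trace_def mat_def sum_3)
qed

lemma compact_SO3: "compact SO3"
proof -
  have eq: "SO3 = {R. transpose R ** R = mat 1} \<inter> {R. det R = 1}"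
    using SO3_D SO3_I by blast
  have c1: "closed {R :: real^3^3. transpose R ** R = mat 1}"
    by (intro closed_Collect_eq matrix_mult.continuous_on bounded_linear.continuous_on[OF bounded_linear_transpose] continuous_intros)
  have c2: "closed {R :: real^3^3. det R = 1}"
    by (intro closed_Collect_eq continuous_on_det3 continuous_intros)
  have "closed SO3" unfolding eq using c1 c2 by (rule closed_Int)
  moreover have "bounded SO3"
    unfolding bounded_iff
  proof (intro exI ballI)
    fix R assume "R \<in> SO3"
    then have "(norm R)\<^sup>2 \<le> 2\<^sup>2" using SO3_trace by simp
    then show "norm R \<le> 2" by (rule power2_le_imp_le) simp
  qed
  ultimately show ?thesis using compact_eq_bounded_closed by blast
qed

text \<open>Euler's theorem: the transpose of \<open>R\<close> times \<open>R - mat 1\<close> is the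
  transpose of \<open>mat 1 - R\<close>, and in odd dimension the determinant changes sign with its
  argument, so \<open>R - mat 1\<close> is singular.\<close>

lemma SO3_fixed_axis:
  assumes R: "R \<in> SO3" obtains v where "norm v = 1" "R *v v = v"
proof -
  have "transpose R ** (R - mat 1) = transpose (mat 1 - R)"
    using SO3_D(1)[OF R] by (simp add: matrix_mult.diff_right transpose_linear transpose_mat)
  then have "det R * det (R - mat 1) = det (mat 1 - R)"
    by (metis det_mul det_transpose)
  moreover have "det (mat 1 - R) = - det (R - mat 1)"
    by (simp add: det_3 algebra_simps)
  ultimately have "det (R - mat 1) = 0" using SO3_D(3)[OF R] by simp
  then have "\<not> invertible (R - mat 1)" by (simp add: invertible_det_nz)
  then obtain v where v: "v \<noteq> 0" "(R - mat 1) *v v = 0"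
    unfolding invertible_left_inverse matrix_left_invertible_ker by blast
  then have "R *v v = v" by (simp add: matrix_vector.diff_left)
  then have "R *v (v /\<^sub>R norm v) = v /\<^sub>R norm v" by (simp add: matrix_vector.scaleR_right)
  then show thesis using that[of "v /\<^sub>R norm v"] v by simp
qed

context
  fixes u :: "real^3" assumes u: "norm u = 1"
begin

lemma skew_cube: "skew u ** (skew u ** skew u) = - skew u"
proof -
  have "u \<bullet> u = 1" using u by (simp add: norm_eq_1)
  then have "(skew u ** (skew u ** skew u)) *v x = (- skew u) *v x" for x
    by (simp add: matrix_vector_mul_assoc[symmetric] matrix_vector.minus_left Lagrange dot_cross_self
        Cross3.right_diff_distrib cross_mult_right)
  then show ?thesis by (simp add: matrix_eq)
qed

text \<open>The powers of \<open>K = skew u\<close> run through \<open>K\<close>,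
  \<open>K ** K\<close>, \<open>- K\<close>, \<open>- (K ** K)\<close> with period 4, the sign
  pattern of the sine and cosine coefficients. At \<open>m = 0\<close> the cosine term would give
  \<open>- (K ** K)\<close>, whence the correction.\<close>

lemma skew_power_fact:
  "((**) (\<theta> *\<^sub>R skew u) ^^ m) (mat 1) =
     (fact m * \<theta> ^ m) *\<^sub>R (sin_coeff m *\<^sub>R skew u - cos_coeff m *\<^sub>R (skew u ** skew u) +
       (if m = 0 then mat 1 + skew u ** skew u else 0))"
proof (induction m)
  case 0
  then show ?case by simp
next
  case (Suc m)
  define K where "K = skew u"
  have K3: "K ** (K ** K) = - K" using skew_cube by (simp add: K_def)
  have c: "fact (Suc m) * sin_coeff (Suc m) = fact m * cos_coeff m"
    "fact (Suc m) * cos_coeff (Suc m) = - (fact m * sin_coeff m)"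
    by (simp_all add: sin_coeff_Suc cos_coeff_Suc field_simps del: of_nat_Suc)
  have "((**) (\<theta> *\<^sub>R K) ^^ Suc m) (mat 1) = (\<theta> *\<^sub>R K) ** ((**) (\<theta> *\<^sub>R K) ^^ m) (mat 1)" by simp
  also have "\<dots> = (fact m * \<theta> ^ Suc m) *\<^sub>R (sin_coeff m *\<^sub>R (K ** K) + cos_coeff m *\<^sub>R K)"
    unfolding Suc.IH[folded K_def]
    by (simp add: matrix_mult.scaleR_left matrix_mult.scaleR_right matrix_mult.add_right
        matrix_mult.diff_right matrix_mult.zero_right K3 scaleR_right_distrib mult_ac)
  also have "\<dots> = \<theta> ^ Suc m *\<^sub>R ((fact (Suc m) * sin_coeff (Suc m)) *\<^sub>R K - (fact (Suc m) * cos_coeff (Suc m)) *\<^sub>R (K ** K))"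
    unfolding c by (simp add: scaleR_right_distrib mult_ac)
  finally show ?case
    by (simp add: K_def scaleR_right_distrib scaleR_right_diff_distrib mult_ac)
qed

lemma axis_rotation_rodrigues:
  "axis_rotation \<theta> u = mat 1 + sin \<theta> *\<^sub>R skew u + (1 - cos \<theta>) *\<^sub>R (skew u ** skew u)"
proof -
  define K where "K = skew u"
  have "(\<lambda>m. (sin_coeff m *\<^sub>R \<theta> ^ m) *\<^sub>R K - (cos_coeff m *\<^sub>R \<theta> ^ m) *\<^sub>R (K ** K) +
       (if m = 0 then mat 1 + K ** K else 0)) sums
       (sin \<theta> *\<^sub>R K - cos \<theta> *\<^sub>R (K ** K) + (mat 1 + K ** K))"
    by (intro sums_add sums_diff sums_single bounded_linear.sums[OF bounded_linear_scaleR_left]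
        sin_converges cos_converges)
  moreover have "(\<lambda>m. (sin_coeff m *\<^sub>R \<theta> ^ m) *\<^sub>R K - (cos_coeff m *\<^sub>R \<theta> ^ m) *\<^sub>R (K ** K) +
       (if m = 0 then mat 1 + K ** K else 0)) =
       (\<lambda>m. (((**) (\<theta> *\<^sub>R K) ^^ m) (mat 1)) /\<^sub>R fact m)"
    unfolding skew_power_fact[folded K_def]
    by (rule ext) (simp add: scaleR_right_distrib scaleR_right_diff_distrib field_simps)
  ultimately have "axis_rotation \<theta> u = sin \<theta> *\<^sub>R K - cos \<theta> *\<^sub>R (K ** K) + (mat 1 + K ** K)"
    unfolding axis_rotation_def matrix_exp_def K_def[symmetric] by (simp add: sums_iff)
  then show ?thesis by (simp add: K_def algebra_simps)
qed

text \<open>Since the cube of \<open>skew u\<close> is its negative, the span of 1,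
  \<open>skew u\<close> and its square is closed under products; composition of rotations about
  \<open>u\<close> then reduces to the addition formulas.\<close>

lemma skew_polynomial_mult:
  "(mat 1 + p *\<^sub>R skew u + q *\<^sub>R (skew u ** skew u)) ** (mat 1 + r *\<^sub>R skew u + s *\<^sub>R (skew u ** skew u)) =
    mat 1 + (p + r - p * s - q * r) *\<^sub>R skew u + (q + s + p * r - q * s) *\<^sub>R (skew u ** skew u)"
proof -
  define K2 where "K2 = skew u ** skew u"
  have K: "skew u ** K2 = - skew u" "K2 ** skew u = - skew u" "K2 ** K2 = - K2"
    using skew_cube by (simp_all add: K2_def matrix_mul_assoc matrix_mult.minus_left)
  show ?thesis
    unfolding K2_def[symmetric]
    by (simp add: matrix_mult.add_left matrix_mult.add_right matrix_mult.scaleR_left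
        matrix_mult.scaleR_right K K2_def[symmetric] scaleR_left_distrib scaleR_left_diff_distrib
        scaleR_right_distrib scaleR_right_diff_distrib mult_ac)
qed

lemma axis_rotation_mult: "axis_rotation a u ** axis_rotation b u = axis_rotation (a + b) u"
proof -
  have "sin a + sin b - sin a * (1 - cos b) - (1 - cos a) * sin b = sin (a + b)"
    "(1 - cos a) + (1 - cos b) + sin a * sin b - (1 - cos a) * (1 - cos b) = 1 - cos (a + b)"
    by (simp_all add: sin_add cos_add algebra_simps)
  then show ?thesis
    unfolding axis_rotation_rodrigues skew_polynomial_mult by simp
qed

lemma axis_rotation_0: "axis_rotation 0 u = mat 1"
  by (simp add: axis_rotation_rodrigues)

lemma transpose_axis_rotation: "transpose (axis_rotation \<theta> u) = axis_rotation (- \<theta>) u"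
  by (simp add: axis_rotation_rodrigues transpose_linear transpose_mat
      transpose_skew matrix_transpose_mul matrix_mult.minus_left matrix_mult.minus_right)

lemma axis_rotation_SO3: "axis_rotation \<theta> u \<in> SO3"
proof (rule SO3_I)
  have orth: "transpose (axis_rotation a u) ** axis_rotation a u = mat 1" for a
    by (simp add: transpose_axis_rotation axis_rotation_mult axis_rotation_0)
  then show "transpose (axis_rotation \<theta> u) ** axis_rotation \<theta> u = mat 1" .
  \<comment> \<open>Orthogonality leaves the sign of the determinant open; as a square, the rotation
    has the determinant of the half-angle factor squared, hence 1.\<close>
  have "axis_rotation \<theta> u = axis_rotation (\<theta>/2) u ** axis_rotation (\<theta>/2) u"
    by (simp add: axis_rotation_mult)
  then have "det (axis_rotation \<theta> u) = det (transpose (axis_rotation (\<theta>/2) u) ** axis_rotation (\<theta>/2) u)"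
    by (simp add: det_mul)
  then show "det (axis_rotation \<theta> u) = 1" by (simp add: orth)
qed

lemma axis_rotation_has_vector_derivative:
  "((\<lambda>\<theta>. axis_rotation \<theta> u) has_vector_derivative axis_rotation \<theta> u ** skew u) (at \<theta> within S)"
proof -
  define K2 where "K2 = skew u ** skew u"
  have K: "K2 ** skew u = - skew u"
    using skew_cube by (simp add: K2_def matrix_mul_assoc)
  have "((\<lambda>\<theta>. mat 1 + sin \<theta> *\<^sub>R skew u + (1 - cos \<theta>) *\<^sub>R K2) has_vector_derivative
       cos \<theta> *\<^sub>R skew u + sin \<theta> *\<^sub>R K2) (at \<theta> within S)"
    by (auto intro!: derivative_eq_intros)
  also have "cos \<theta> *\<^sub>R skew u + sin \<theta> *\<^sub>R K2 = axis_rotation \<theta> u ** skew u"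
    by (simp add: axis_rotation_rodrigues K2_def[symmetric] matrix_mult.add_left matrix_mult.scaleR_left K
        matrix_mult.diff_left scaleR_left_diff_distrib)
  finally show ?thesis by (simp add: axis_rotation_rodrigues K2_def)
qed

lemma continuous_on_axis_rotation:
  fixes f :: "'a::t2_space \<Rightarrow> real"
  shows "continuous_on S f \<Longrightarrow> continuous_on S (\<lambda>x. axis_rotation (f x) u)"
  unfolding axis_rotation_rodrigues by (intro continuous_intros)

text \<open>Conjugation by a rotation moves an infinitesimal rotation to the right of the warp,
  where \<open>trace_mult_skew\<close> applies.\<close>

lemma skew_mult_axis_rotation:
  "skew w ** axis_rotation \<theta> u = axis_rotation \<theta> u ** skew (transpose (axis_rotation \<theta> u) *v w)"
proof -
  have "axis_rotation \<theta> u ** skew (transpose (axis_rotation \<theta> u) *v w) =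
     (axis_rotation \<theta> u ** transpose (axis_rotation \<theta> u)) ** skew w ** axis_rotation \<theta> u"
    using skew_rotate[OF transpose_SO3[OF axis_rotation_SO3], of \<theta> w]
    by (metis matrix_mul_assoc transpose_transpose)
  then show ?thesis by (simp add: SO3_D axis_rotation_SO3)
qed

end

subsection \<open>Warped trace potentials\<close>

lemma quadratic_form_zero:
  fixes N :: "real^'n^'n"
  assumes sym: "transpose N = N" and nonneg: "\<And>w. 0 \<le> w \<bullet> (N *v w)" and zero: "v \<bullet> (N *v v) = 0"
  shows "N *v v = 0"
proof -
  define w where "w = N *v v"
  have swap: "x \<bullet> (N *v y) = y \<bullet> (N *v x)" for x y
    using sym by (metis dot_lmul_matrix inner_commute transpose_matrix_vector)
  have "0 \<le> 2 * t * (w \<bullet> w) + t\<^sup>2 * (w \<bullet> (N *v w))" for t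
  proof -
    have "(v + t *\<^sub>R w) \<bullet> (N *v (v + t *\<^sub>R w)) = 2 * t * (w \<bullet> w) + t\<^sup>2 * (w \<bullet> (N *v w))"
      using zero swap[of v w]
      by (simp add: matrix_vector_right_distrib matrix_vector_mult_scaleR inner_add_left inner_add_right
          w_def[symmetric] power2_eq_square algebra_simps)
    then show ?thesis using nonneg[of "v + t *\<^sub>R w"] by simp
  qed
  note quad = this
  have "w \<bullet> w \<le> 0"
  proof (rule ccontr)
    assume "\<not> w \<bullet> w \<le> 0"
    define b where "b = w \<bullet> (N *v w)"
    define c where "c = w \<bullet> w"
    have "c > 0" "b \<ge> 0"
      using \<open>\<not> w \<bullet> w \<le> 0\<close> nonneg[of w] unfolding b_def c_def by linarith+
    \<comment> \<open>At \<open>t = - c / d\<close> the quadratic becomes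
      \<open>(c\<^sup>2 / d) * (b / d - 2)\<close>, negative because \<open>b < d\<close>; the
      summand 1 also covers \<open>b = 0\<close>.\<close>
    define d where "d = b + 1"
    have "d > 0" "b < d" using \<open>b \<ge> 0\<close> by (simp_all add: d_def)
    have "0 \<le> 2 * (- c / d) * c + (- c / d)\<^sup>2 * b"
      using quad[of "- c / d"] by (simp add: b_def c_def)
    also have "\<dots> = (c\<^sup>2 / d) * (b / d - 2)"
      using \<open>d > 0\<close> by (simp add: field_simps power2_eq_square)
    also have "\<dots> < 0"
      using \<open>b < d\<close> \<open>d > 0\<close> \<open>c > 0\<close> by (intro mult_pos_neg) (auto simp: field_simps)
    finally show False by simp
  qed
  then have "w \<bullet> w = 0" by (intro antisym) simp_all
  then show ?thesis by (simp add: w_def)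
qed

text \<open>Eigenvectors for distinct eigenvalues are orthogonal, hence independent. Finiteness
  gives the \<open>Min\<close> and \<open>Max\<close> in \<open>lambda_min\<close> and
  \<open>lambda_max\<close> their usual meaning.\<close>

lemma finite_eigenvalues:
  assumes "transpose M = M" shows "finite (eigenvalues M)"
proof -
  have "\<forall>l\<in>eigenvalues M. \<exists>v. v \<noteq> 0 \<and> M *v v = l *\<^sub>R v" by (simp add: eigenvalues_def)
  then obtain v where v: "\<And>l. l \<in> eigenvalues M \<Longrightarrow> v l \<noteq> 0 \<and> M *v v l = l *\<^sub>R v l"
    by (auto simp: bchoice_iff)
  have orth: "v a \<bullet> v b = 0" if "a \<in> eigenvalues M" "b \<in> eigenvalues M" "a \<noteq> b" for a b
  proof -
    have "v a \<bullet> (M *v v b) = (M *v v a) \<bullet> v b"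
      using assms by (metis dot_lmul_matrix transpose_matrix_vector)
    then have "(a - b) * (v a \<bullet> v b) = 0"
      using v that by (simp add: algebra_simps)
    then show ?thesis using that(3) by simp
  qed
  have inj: "inj_on v (eigenvalues M)"
  proof (rule inj_onI, rule ccontr)
    fix a b assume ab: "a \<in> eigenvalues M" "b \<in> eigenvalues M" "v a = v b" "a \<noteq> b"
    then have "v b \<bullet> v b = 0" using orth[OF ab(1,2,4)] by simp
    then show False using v[OF ab(2)] by simp
  qed
  have "pairwise orthogonal (v ` eigenvalues M)"
    unfolding pairwise_image pairwise_def orthogonal_def using orth by blast
  then have "independent (v ` eigenvalues M)"
    using v by (intro pairwise_orthogonal_independent) auto
  then have "finite (v ` eigenvalues M)" by (rule independent_imp_finite)
  then show ?thesis using inj finite_imageD by blast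
qed

text \<open>If \<open>z\<close> maximises the form on the unit sphere with value \<open>m\<close>,
  then \<open>m *\<^sub>R mat 1 - M\<close> is positive semidefinite and its form vanishes at
  \<open>z\<close>; so \<open>z\<close> lies in its kernel and is an eigenvector of
  \<open>M\<close>.\<close>

lemma rayleigh_lambda_max:
  assumes sym: "transpose M = M"
  shows "v \<bullet> (M *v v) \<le> lambda_max M * (v \<bullet> v)" and "eigenvalues M \<noteq> {}"
proof -
  have "sphere (0::real^3) 1 \<noteq> {}" by simp
  moreover have "continuous_on (sphere 0 1) (\<lambda>w. w \<bullet> (M *v w))"
    by (intro continuous_intros matrix_vector.continuous_on)
  ultimately obtain z where "z \<in> sphere 0 1" "\<forall>w\<in>sphere 0 1. w \<bullet> (M *v w) \<le> z \<bullet> (M *v z)"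
    using continuous_attains_sup[OF compact_sphere] by blast
  then have z: "norm z = 1" "\<And>w. norm w = 1 \<Longrightarrow> w \<bullet> (M *v w) \<le> z \<bullet> (M *v z)"
    by auto
  define m where "m = z \<bullet> (M *v z)"
  have le: "w \<bullet> (M *v w) \<le> m * (w \<bullet> w)" for w
  proof (cases "w = 0")
    case False
    have "(w /\<^sub>R norm w) \<bullet> (M *v (w /\<^sub>R norm w)) \<le> m"
      unfolding m_def using False by (intro z) simp
    then show ?thesis using False
      by (simp add: matrix_vector.scaleR_right field_simps power2_norm_eq_inner[symmetric] power2_eq_square)
  qed simp
  have "(m *\<^sub>R mat 1 - M) *v z = 0"
  proof (rule quadratic_form_zero)
    show "transpose (m *\<^sub>R mat 1 - M) = m *\<^sub>R mat 1 - M"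
      using sym by (simp add: transpose_linear transpose_mat)
    show "0 \<le> w \<bullet> ((m *\<^sub>R mat 1 - M) *v w)" for w
      using le[of w] by (simp add: matrix_vector.diff_left matrix_vector.scaleR_left inner_diff_right)
    show "z \<bullet> ((m *\<^sub>R mat 1 - M) *v z) = 0"
      using z(1) by (simp add: matrix_vector.diff_left matrix_vector.scaleR_left inner_diff_right m_def norm_eq_1)
  qed
  then have "M *v z = m *\<^sub>R z" by (simp add: matrix_vector.diff_left matrix_vector.scaleR_left)
  then have m: "m \<in> eigenvalues M" using z(1) by (auto simp: eigenvalues_def intro!: exI[of _ z])
  then show "eigenvalues M \<noteq> {}" by blast
  have "m \<le> lambda_max M"
    unfolding lambda_max_def by (intro Max_ge finite_eigenvalues sym m)
  then show "v \<bullet> (M *v v) \<le> lambda_max M * (v \<bullet> v)"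
    using le[of v] by (meson inner_ge_zero mult_right_mono order_trans)
qed

section \<open>Trace potentials of weighted directions\<close>

lemma outer_product_mult_vector: "outer_product x y *v z = (y \<bullet> z) *\<^sub>R x"
  by (simp add: vec_eq_iff outer_product_def matrix_vector_mult_def inner_vec_def sum_distrib_left sum_distrib_right mult_ac)

lemma trace_outer_product_mult: "trace (outer_product x y ** M) = y \<bullet> (M *v x)"
  by (simp add: trace_def outer_product_def matrix_matrix_mult_def inner_vec_def matrix_vector_mult_def sum_3 algebra_simps)

lemma transpose_outer_product: "transpose (outer_product x y) = outer_product y x"
  by (simp add: vec_eq_iff outer_product_def transpose_def)

text \<open>The spanning condition is what identifies a rotation fixing every \<open>r i\<close> as
  the identity. The data do not mention \<open>k\<close>, so one instance serves all modes of an
  index \<open>h\<close>.\<close>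

locale weighted_directions =
  fixes I :: "'i set" and \<rho> :: "'i \<Rightarrow> real" and r :: "'i \<Rightarrow> real^3" and A :: "real^3^3"
  assumes fin: "finite I" and pos: "\<And>i. i \<in> I \<Longrightarrow> \<rho> i > 0" and span: "span (r ` I) = UNIV"
    and A: "A = (\<Sum>i\<in>I. \<rho> i *\<^sub>R outer_product (r i) (r i))"
begin

lemma trace_A_mult: "trace (A ** M) = (\<Sum>i\<in>I. \<rho> i * (r i \<bullet> (M *v r i)))"
  unfolding A
  by (simp add: matrix_mult.sum_left linear_sum[OF bounded_linear.linear[OF bounded_linear_trace]]
      matrix_mult.scaleR_left trace_linear trace_outer_product_mult)

text \<open>Since a rotation preserves the norm of \<open>r i\<close>,
  \<open>r i \<bullet> (r i - R *v r i)\<close> is half a squared distance. Sign, zeros and upper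
  bound of the potential are all read off this sum of squares.\<close>

lemma trace_potential_SO3:
  assumes "R \<in> SO3"
  shows "trace_potential A R = (\<Sum>i\<in>I. \<rho> i * (norm (r i - R *v r i))\<^sup>2) / 2"
proof -
  have eq: "r i \<bullet> ((mat 1 - R) *v r i) = (norm (r i - R *v r i))\<^sup>2 / 2" for i
    using inner_SO3_mult[OF assms, of "r i" "r i"]
    by (simp add: matrix_vector.diff_left power2_norm_eq_inner inner_diff_left inner_diff_right
        inner_commute algebra_simps)
  then show ?thesis
    unfolding trace_potential_def trace_A_mult eq by (simp add: sum_divide_distrib)
qed

lemma trace_potential_nonneg: "R \<in> SO3 \<Longrightarrow> 0 \<le> trace_potential A R"
  unfolding trace_potential_SO3 by (intro divide_nonneg_pos sum_nonneg mult_nonneg_nonneg) (auto dest: pos)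

lemma trace_potential_eq_0_iff:
  assumes "R \<in> SO3" shows "trace_potential A R = 0 \<longleftrightarrow> R = mat 1"
proof
  assume "trace_potential A R = 0"
  then have "\<forall>i\<in>I. \<rho> i * (norm (r i - R *v r i))\<^sup>2 = 0"
    unfolding trace_potential_SO3[OF assms]
    by (subst sum_nonneg_eq_0_iff[OF fin, symmetric]) (auto dest: pos)
  then have "R *v x = mat 1 *v x" if "x \<in> r ` I" for x
    using that pos by fastforce
  then have "R *v x = mat 1 *v x" for x
    by (intro linear_eq_on_span[of "(*v) R" "(*v) (mat 1)" "r ` I" x]) (auto simp: span)
  then show "R = mat 1" by (simp add: matrix_eq)
qed (simp add: trace_potential_def matrix_mult.zero_right trace_linear)

text \<open>For \<open>v = w\<close> the bracket is the squared norm of the cross product of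
  \<open>r i\<close> and \<open>v\<close>: \<open>W_matrix A\<close> measures how far the directions
  are from the axis \<open>v\<close>.\<close>

lemma W_quadratic: "v \<bullet> (W_matrix A *v w) = (\<Sum>i\<in>I. \<rho> i * ((r i \<bullet> r i) * (v \<bullet> w) - (r i \<bullet> v) * (r i \<bullet> w)))"
proof -
  have "trace A = (\<Sum>i\<in>I. \<rho> i * (r i \<bullet> r i))" using trace_A_mult[of "mat 1"] by simp
  moreover have "v \<bullet> (A *v w) = (\<Sum>i\<in>I. \<rho> i * ((r i \<bullet> v) * (r i \<bullet> w)))"
    unfolding A by (simp add: matrix_vector.sum_left inner_sum_right matrix_vector.scaleR_left
        outer_product_mult_vector inner_commute mult_ac)
  ultimately show ?thesis
    by (simp add: W_matrix_def matrix_vector.diff_left matrix_vector.scaleR_left inner_diff_right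
        sum_subtractf sum_distrib_left algebra_simps)
qed

lemma W_symmetric: "transpose (W_matrix A) = W_matrix A"
proof -
  have "transpose A = A"
    unfolding A by (simp add: linear_sum[OF bounded_linear.linear[OF bounded_linear_transpose]]
        transpose_linear transpose_outer_product)
  then show ?thesis by (simp add: W_matrix_def transpose_linear transpose_mat)
qed

lemma W_nonneg: "0 \<le> v \<bullet> (W_matrix A *v v)"
  unfolding W_quadratic
proof (intro sum_nonneg mult_nonneg_nonneg)
  show "0 \<le> (r i \<bullet> r i) * (v \<bullet> v) - (r i \<bullet> v) * (r i \<bullet> v)" for i
    using Cauchy_Schwarz_ineq[of "r i" v] by (simp add: power2_eq_square)
qed (auto dest: pos)

text \<open>Let \<open>v\<close> span the axis of \<open>R\<close>. Only the component
  \<open>y\<close> of \<open>r i\<close> orthogonal to \<open>v\<close> is moved, by at most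
  \<open>2 * norm y\<close>, and the weighted sum of the squares of these components is the form of
  \<open>W_matrix A\<close> at \<open>v\<close>.\<close>

lemma trace_potential_le:
  assumes "R \<in> SO3" shows "trace_potential A R \<le> 2 * lambda_max (W_matrix A)"
proof -
  obtain v where v: "norm v = 1" "R *v v = v" using SO3_fixed_axis[OF assms] .
  have vv: "v \<bullet> v = 1" using v(1) by (simp add: norm_eq_1)
  have bound: "(norm (x - R *v x))\<^sup>2 \<le> 4 * ((x \<bullet> x) * (v \<bullet> v) - (x \<bullet> v) * (x \<bullet> v))" for x
  proof -
    define y where "y = x - (x \<bullet> v) *\<^sub>R v"
    have "x - R *v x = y - R *v y"
      by (simp add: y_def matrix_vector.diff_right matrix_vector.scaleR_right v)
    then have "norm (x - R *v x) \<le> norm y + norm y"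
      using norm_triangle_ineq4[of y "R *v y"] norm_SO3_mult[OF assms, of y] by simp
    then have "(norm (x - R *v x))\<^sup>2 \<le> (2 * norm y)\<^sup>2" by (intro power_mono) auto
    also have "(2 * norm y)\<^sup>2 = 4 * (y \<bullet> y)" by (simp add: power_mult_distrib power2_norm_eq_inner)
    also have "y \<bullet> y = (x \<bullet> x) * (v \<bullet> v) - (x \<bullet> v) * (x \<bullet> v)"
      by (simp add: y_def inner_diff_left inner_diff_right vv inner_commute)
    finally show ?thesis .
  qed
  have "trace_potential A R \<le> (\<Sum>i\<in>I. \<rho> i * (4 * ((r i \<bullet> r i) * (v \<bullet> v) - (r i \<bullet> v) * (r i \<bullet> v)))) / 2"
    unfolding trace_potential_SO3[OF assms]
    by (intro divide_right_mono sum_mono mult_left_mono bound) (auto dest: pos)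
  also have "\<dots> = 2 * (v \<bullet> (W_matrix A *v v))"
    unfolding W_quadratic mult.left_commute[of _ 4] sum_distrib_left[symmetric] by simp
  also have "\<dots> \<le> 2 * lambda_max (W_matrix A)"
    using rayleigh_lambda_max(1)[OF W_symmetric, of v] vv by simp
  finally show ?thesis .
qed

text \<open>In Rodrigues' formula the sine term drops out of the quadratic form, because a cross
  product is orthogonal to its factors.\<close>

lemma trace_potential_axis_rotation:
  assumes u: "norm u = 1"
  shows "trace_potential A (axis_rotation \<theta> u) = (1 - cos \<theta>) * (u \<bullet> (W_matrix A *v u))"
proof -
  have uu: "u \<bullet> u = 1" using u by (simp add: norm_eq_1)
  have "x \<bullet> ((mat 1 - axis_rotation \<theta> u) *v x) = (1 - cos \<theta>) * ((x \<bullet> x) * (u \<bullet> u) - (x \<bullet> u) * (x \<bullet> u))" for x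
    by (simp add: axis_rotation_rodrigues[OF u] matrix_vector.diff_left matrix_vector.add_left
        matrix_vector.scaleR_left matrix_vector_mul_assoc[symmetric] Lagrange uu
        inner_add_right inner_diff_right dot_cross_self inner_commute algebra_simps)
  then show ?thesis
    unfolding trace_potential_def trace_A_mult W_quadratic
    by (simp add: sum_distrib_left mult_ac)
qed

lemma xi_bounds: "0 \<le> lambda_max (W_matrix A)" "0 \<le> xi A" "xi A \<le> 1"
proof -
  let ?E = "eigenvalues (W_matrix A)"
  have fe: "finite ?E" "?E \<noteq> {}"
    using finite_eigenvalues[OF W_symmetric] rayleigh_lambda_max(2)[OF W_symmetric] .
  have nn: "0 \<le> l" if l: "l \<in> ?E" for l
  proof -
    obtain v where v: "v \<noteq> 0" "W_matrix A *v v = l *\<^sub>R v" using l by (auto simp: eigenvalues_def)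
    then have "0 \<le> l * (v \<bullet> v)" using W_nonneg[of v] by simp
    then show ?thesis using mult_neg_pos[of l "v \<bullet> v"] v(1) by (intro leI) auto
  qed
  have mn: "0 \<le> lambda_min (W_matrix A)" unfolding lambda_min_def using fe nn by simp
  have le: "lambda_min (W_matrix A) \<le> lambda_max (W_matrix A)"
    unfolding lambda_min_def lambda_max_def using fe by (simp add: Min_le_iff Max_ge_iff)
  \<comment> \<open>The quotient convention covers a vanishing \<open>lambda_max\<close>: then
    \<open>xi A\<close> is 0.\<close>
  show "0 \<le> lambda_max (W_matrix A)" "0 \<le> xi A" "xi A \<le> 1"
    unfolding xi_def using mn le by (auto simp: divide_le_eq_1)
qed

text \<open>From \<open>xi A\<close> at most 1 the maximum is at most 4, so the square root is at
  least 1 and dropping it only enlarges the right-hand side.\<close>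

lemma gain_bound:
  assumes "\<bar>k\<bar> < 1 / (2 * lambda_max (W_matrix A) * sqrt (6 - max 1 (4 * (xi A)\<^sup>2)))"
  shows "2 * \<bar>k\<bar> * lambda_max (W_matrix A) < 1"
proof (cases "lambda_max (W_matrix A) = 0")
  case False
  then have l: "lambda_max (W_matrix A) > 0" using xi_bounds(1) by simp
  have "(xi A)\<^sup>2 \<le> 1" using xi_bounds(2,3) by (simp add: power_le_one)
  then have "1 \<le> 6 - max 1 (4 * (xi A)\<^sup>2)" by simp
  then have s: "1 \<le> sqrt (6 - max 1 (4 * (xi A)\<^sup>2))" by simp
  have "\<bar>k\<bar> < 1 / (2 * lambda_max (W_matrix A) * sqrt (6 - max 1 (4 * (xi A)\<^sup>2)))" by fact
  also have "\<dots> \<le> 1 / (2 * lambda_max (W_matrix A) * 1)"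
    using l s by (intro divide_left_mono mult_left_mono mult_pos_pos) auto
  finally show ?thesis using l by (simp add: field_simps)
qed simp

end

section \<open>The warped potential of one index and one mode\<close>

locale warped_directions = weighted_directions I \<rho> r A
  for I :: "'i set" and \<rho> r A +
  fixes u :: "real^3" and k :: real
  assumes u: "norm u = 1" and k: "2 * \<bar>k\<bar> * lambda_max (W_matrix A) < 1"
begin

text \<open>The set of all matrices, not only rotations, for which the argument of the arcsine lies
  strictly between -1 and 1. It contains \<open>SO3\<close>, so derivatives can be taken in the
  ambient space.\<close>

abbreviation "regular_domain \<equiv> {R. \<bar>k * trace_potential A R\<bar> < 1}"

lemma SO3_regular:
  assumes "R \<in> SO3" shows "\<bar>k * trace_potential A R\<bar> < 1"
proof -
  have "\<bar>k * trace_potential A R\<bar> \<le> \<bar>k\<bar> * (2 * lambda_max (W_matrix A))"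
    unfolding abs_mult using trace_potential_nonneg[OF assms] trace_potential_le[OF assms]
    by (intro mult_left_mono) auto
  then show ?thesis using k by simp
qed

lemma warp_SO3: "R \<in> SO3 \<Longrightarrow> warp A u k R \<in> SO3"
  unfolding warp_def by (intro SO3_mult axis_rotation_SO3 u)

lemma warped_potential_nonneg: "R \<in> SO3 \<Longrightarrow> 0 \<le> warped_potential A u k R"
  unfolding warped_potential_def by (intro trace_potential_nonneg warp_SO3)

text \<open>If \<open>R\<close> is warped to the identity, then \<open>R\<close> is a rotation about \<open>u\<close> and its potential \<open>V\<close> satisfies
  \<open>V = 2 k\<^sup>2 V\<^sup>2 (u \<bullet> W u)\<close>; the bound on the gain leaves only the root \<open>V = 0\<close>.\<close>

lemma warped_potential_eq_0_iff:
  assumes R: "R \<in> SO3" shows "warped_potential A u k R = 0 \<longleftrightarrow> R = mat 1"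
proof
  assume "R = mat 1"
  then show "warped_potential A u k R = 0"
    using trace_potential_eq_0_iff[of "mat 1"]
    by (simp add: warped_potential_def warp_def warp_angle_def axis_rotation_0 u)
next
  assume "warped_potential A u k R = 0"
  then have "warp A u k R = mat 1"
    using trace_potential_eq_0_iff[OF warp_SO3[OF R]] by (simp add: warped_potential_def)
  define V where "V = trace_potential A R"
  define \<theta> where "\<theta> = warp_angle A k R"
  have V: "0 \<le> V" "V \<le> 2 * lambda_max (W_matrix A)" "\<bar>k * V\<bar> < 1"
    unfolding V_def using trace_potential_nonneg trace_potential_le SO3_regular R by auto
  have "R ** axis_rotation \<theta> u = mat 1" using \<open>warp A u k R = mat 1\<close> by (simp add: warp_def \<theta>_def)
  then have "R = axis_rotation (- \<theta>) u"
    using axis_rotation_mult[OF u, of \<theta> "- \<theta>"] axis_rotation_0[OF u]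
    by (metis add.right_inverse matrix_mul_assoc matrix_mul_lid matrix_mul_rid)
  then have "V = (1 - cos \<theta>) * (u \<bullet> (W_matrix A *v u))"
    using trace_potential_axis_rotation[OF u, of "- \<theta>"] by (simp add: V_def)
  \<comment> \<open>The doubled arcsine in the warp angle is made for the half-angle formula: the
    sine of half the angle is exactly \<open>k * V\<close>.\<close>
  also have "1 - cos \<theta> = 2 * (k * V)\<^sup>2"
  proof -
    have "sin (\<theta> / 2) = k * V"
      unfolding \<theta>_def warp_angle_def V_def[symmetric] using V(3) by simp
    moreover have "cos \<theta> = 1 - 2 * (sin (\<theta> / 2))\<^sup>2"
      using cos_double_sin[of "\<theta> / 2"] by simp
    ultimately show ?thesis by simp
  qed
  finally have eq: "V = V * (2 * k\<^sup>2 * V * (u \<bullet> (W_matrix A *v u)))"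
    by (simp add: power2_eq_square mult_ac)
  have "u \<bullet> (W_matrix A *v u) \<le> lambda_max (W_matrix A)"
    using rayleigh_lambda_max(1)[OF W_symmetric, of u] u by (simp add: norm_eq_1)
  \<comment> \<open>The bounds \<open>2 * lambda_max\<close> for \<open>V\<close> and
    \<open>lambda_max\<close> for the form at \<open>u\<close> combine to the square of
    \<open>2 * \<bar>k\<bar> * lambda_max\<close>, which is below 1; so the second factor in
    \<open>eq\<close> cannot be 1.\<close>
  then have "V * (u \<bullet> (W_matrix A *v u)) \<le> (2 * lambda_max (W_matrix A)) * lambda_max (W_matrix A)"
    using V W_nonneg xi_bounds(1) by (intro mult_mono) auto
  then have "2 * k\<^sup>2 * (V * (u \<bullet> (W_matrix A *v u))) \<le> 2 * k\<^sup>2 * ((2 * lambda_max (W_matrix A)) * lambda_max (W_matrix A))"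
    by (intro mult_left_mono) auto
  also have "\<dots> = (2 * \<bar>k\<bar> * lambda_max (W_matrix A))\<^sup>2"
    by (simp add: power_mult_distrib power2_eq_square)
  also have "\<dots> < 1" using k xi_bounds(1) by (simp add: power_less_one_iff)
  finally have "2 * k\<^sup>2 * V * (u \<bullet> (W_matrix A *v u)) \<noteq> 1" by (simp add: mult_ac)
  then have "V = 0" using eq by (metis mult_cancel_left1)
  then show "R = mat 1" using trace_potential_eq_0_iff[OF R] by (simp add: V_def)
qed

lemma continuous_on_trace_potential:
  assumes "continuous_on S f" shows "continuous_on S (\<lambda>x. trace_potential A (f x))"
  unfolding trace_potential_def
  by (intro bounded_linear.continuous_on[OF bounded_linear_trace] matrix_mult.continuous_on continuous_intros assms)

lemma continuous_on_warp_angle: "continuous_on regular_domain (warp_angle A k)"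
  unfolding warp_angle_def by (intro continuous_intros continuous_on_trace_potential) auto

lemma continuous_on_warp: "continuous_on regular_domain (warp A u k)"
  unfolding warp_def
  by (intro matrix_mult.continuous_on continuous_on_axis_rotation u continuous_on_warp_angle continuous_on_id)

lemma continuous_on_warped_potential: "continuous_on regular_domain (warped_potential A u k)"
  unfolding warped_potential_def by (intro continuous_on_trace_potential continuous_on_warp)

lemma regular_sqrt_pos:
  assumes "\<bar>k * trace_potential A R\<bar> < 1" shows "0 < sqrt (1 - k\<^sup>2 * (trace_potential A R)\<^sup>2)"
  using assms by (simp add: power_mult_distrib[symmetric] abs_square_less_1)

lemma innovation_eq:
  "innovation A u k R = axis_rotation (warp_angle A k R) u *v psi (A ** warp A u k R) +
    (4 * k / sqrt (1 - k\<^sup>2 * (trace_potential A R)\<^sup>2) * (u \<bullet> psi (A ** warp A u k R))) *\<^sub>R psi (A ** R)"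
  unfolding innovation_def warp_Theta_def
  by (simp only: transpose_linear transpose_outer_product transpose_transpose matrix_vector.add_left
      matrix_vector.scaleR_left outer_product_mult_vector scaleR_scaleR)

lemma continuous_on_innovation: "continuous_on regular_domain (innovation A u k)"
  unfolding innovation_eq
  by (intro continuous_intros matrix_vector.continuous_on matrix_mult.continuous_on
      bounded_linear.continuous_on[OF bounded_linear_psi] continuous_on_axis_rotation u
      continuous_on_warp_angle continuous_on_warp continuous_on_trace_potential)
    (use regular_sqrt_pos in force)

lemma inner_innovation:
  "innovation A u k R \<bullet> w = psi (A ** warp A u k R) \<bullet> (transpose (axis_rotation (warp_angle A k R) u) *v w)
    + (4 * k / sqrt (1 - k\<^sup>2 * (trace_potential A R)\<^sup>2)) * (psi (A ** R) \<bullet> w) * (psi (A ** warp A u k R) \<bullet> u)"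
proof -
  have eq: "(axis_rotation (warp_angle A k R) u *v x) \<bullet> w = x \<bullet> (transpose (axis_rotation (warp_angle A k R) u) *v w)" for x
    by (metis dot_lmul_matrix transpose_matrix_vector inner_commute)
  show ?thesis
    unfolding innovation_eq inner_add_left inner_scaleR_left eq
    by (simp add: inner_commute[of u] mult_ac)
qed

text \<open>A displacement \<open>R ** skew w\<close> acts twice: it rotates the warped matrix
  directly, and it changes the warp angle. The two effects are the two summands of
  \<open>warp_Theta\<close>, so the innovation represents half the derivative in body
  coordinates.\<close>

lemma warped_potential_has_derivative:
  assumes R: "\<bar>k * trace_potential A R\<bar> < 1"
  obtains f' where "(warped_potential A u k has_derivative f') (at R)"
    "\<And>w. f' (R ** skew w) = 2 * (innovation A u k R \<bullet> w)"
proof -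
  define V where "V = trace_potential A R"
  define T where "T = axis_rotation (warp_angle A k R) u"
  define s where "s = sqrt (1 - (k * V)\<^sup>2)"
  \<comment> \<open>The derivative of the warp angle: the potential has derivative
    \<open>- trace (A ** Z)\<close>, and the arcsine contributes the reciprocal of \<open>s\<close>.
    At \<open>R ** skew w\<close> the trace yields another factor 2, hence the 4 in
    \<open>warp_Theta\<close>.\<close>
  define dt where "dt Z = - (2 * k * trace (A ** Z)) / s" for Z
  define f' where "f' Z = - trace (A ** (Z ** T + R ** (dt Z *\<^sub>R (T ** skew u))))" for Z
  have "(trace_potential A has_derivative (\<lambda>Z. trace (A ** (0 - Z)))) (at R)"
    unfolding trace_potential_def
    by (intro bounded_linear.has_derivative[OF bounded_linear_trace]
        bounded_linear.has_derivative[OF matrix_mult.bounded_linear_right] derivative_intros)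
  then have dV: "(trace_potential A has_derivative (\<lambda>Z. - trace (A ** Z))) (at R)"
    by (simp add: matrix_mult.minus_right trace_linear)
  have kV: "- 1 < k * V" "k * V < 1" using R by (auto simp: V_def)
  have dang: "(warp_angle A k has_derivative dt) (at R)"
    unfolding warp_angle_def dt_def s_def using kV
    by (auto intro!: derivative_eq_intros dV simp: V_def field_simps)
  have "((\<lambda>\<theta>. axis_rotation \<theta> u) has_derivative (\<lambda>h. h *\<^sub>R (T ** skew u))) (at (warp_angle A k R))"
    using axis_rotation_has_vector_derivative[OF u, where S = UNIV] by (simp add: has_vector_derivative_def T_def)
  from has_derivative_compose[OF dang this]
  have dT: "((\<lambda>S. axis_rotation (warp_angle A k S) u) has_derivative (\<lambda>Z. dt Z *\<^sub>R (T ** skew u))) (at R)" .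
  have dW: "(warp A u k has_derivative (\<lambda>Z. R ** (dt Z *\<^sub>R (T ** skew u)) + Z ** T)) (at R)"
    unfolding warp_def using matrix_mult.FDERIV[OF has_derivative_ident dT] by (simp add: T_def)
  have "(warped_potential A u k has_derivative (\<lambda>Z. trace (A ** (0 - (R ** (dt Z *\<^sub>R (T ** skew u)) + Z ** T))))) (at R)"
    unfolding warped_potential_def trace_potential_def
    by (intro bounded_linear.has_derivative[OF bounded_linear_trace]
        bounded_linear.has_derivative[OF matrix_mult.bounded_linear_right] derivative_intros dW)
  then have "(warped_potential A u k has_derivative f') (at R)"
    by (simp add: f'_def[abs_def] matrix_mult.minus_right trace_linear add.commute matrix_mult.diff_right matrix_mult.add_right)
  moreover have "f' (R ** skew w) = 2 * (innovation A u k R \<bullet> w)" for w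
  proof -
    define G where "G = R ** T"
    have G: "warp A u k R = G" by (simp add: warp_def G_def T_def)
    \<comment> \<open>The direct effect is brought to the form \<open>G ** skew\<close> of a vector,
      with \<open>w\<close> seen from the warped frame.\<close>
    have e1: "R ** skew w ** T = G ** skew (transpose T *v w)"
      unfolding G_def T_def by (metis skew_mult_axis_rotation[OF u] matrix_mul_assoc)
    have e2: "R ** (dt (R ** skew w) *\<^sub>R (T ** skew u)) = dt (R ** skew w) *\<^sub>R (G ** skew u)"
      by (simp add: matrix_mult.scaleR_right G_def matrix_mul_assoc)
    have "f' (R ** skew w) = - (trace (A ** G ** skew (transpose T *v w)) + dt (R ** skew w) * trace (A ** G ** skew u))"
      unfolding f'_def e1 e2
      by (simp only: matrix_mult.add_right matrix_mult.scaleR_right trace_linear matrix_mul_assoc real_scaleR_def)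
    also have "\<dots> = 2 * (psi (A ** G) \<bullet> (transpose T *v w)) + 2 * dt (R ** skew w) * (psi (A ** G) \<bullet> u)"
      by (simp only: trace_mult_skew)
    also have "dt (R ** skew w) = 4 * k * (psi (A ** R) \<bullet> w) / s"
      by (simp add: dt_def matrix_mul_assoc trace_mult_skew)
    finally show ?thesis
      unfolding inner_innovation G T_def[symmetric] V_def[symmetric]
      by (simp add: s_def power_mult_distrib algebra_simps)
  qed
  ultimately show thesis using that by blast
qed

text \<open>Every tangent vector at \<open>R\<close> is some \<open>R ** skew w\<close>, on which
  the derivative is \<open>2 * (innovation A u k R \<bullet> w)\<close>. Thus the synergy hypothesis
  applies to zeros of the innovation.\<close>

lemma SO3_gradient_zero:
  assumes R: "R \<in> SO3" and "innovation A u k R = 0"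
  shows "has_SO3_gradient (warped_potential A u k) 0 R"
proof -
  obtain f' where f': "(warped_potential A u k has_derivative f') (at R)"
    "\<And>w. f' (R ** skew w) = 2 * (innovation A u k R \<bullet> w)"
    using warped_potential_has_derivative SO3_regular[OF R] by blast
  show ?thesis
    unfolding has_SO3_gradient_def
  proof (intro conjI exI[of _ f'] ballI)
    show "0 \<in> SO3_tangent R"
      unfolding SO3_tangent_def
      by (rule CollectI, rule exI[of _ 0]) (simp add: matrix_mult.zero_right transpose_linear)
    show "(warped_potential A u k has_derivative f') (at R within SO3)"
      using f'(1) by (rule has_derivative_at_withinI)
    fix Z assume "Z \<in> SO3_tangent R"
    then obtain w where "Z = R ** skew w"
      unfolding SO3_tangent_def using skew_surj by blast
    then show "f' Z = SO3_metric R 0 Z"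
      using f'(2) assms(2)
      by (simp add: SO3_metric_def matrix_mult.zero_right matrix_mult.zero_left transpose_linear trace_linear)
  qed
qed

end

subsection \<open>Hybrid time domains\<close>

text \<open>Condenses the four possible shapes of a domain into local facts: the piece with index
  \<open>j\<close> starts at \<open>\<tau> j\<close>, and a piece that has a successor reaches the
  starting time of the successor.\<close>

lemma hybrid_time_domainE:
  assumes "hybrid_time_domain E"
  obtains \<tau> :: "nat \<Rightarrow> real" where "\<tau> 0 = 0" "incseq \<tau>" "(0, 0) \<in> E"
    "\<And>t j. (t, j) \<in> E \<Longrightarrow> \<tau> j \<le> t \<and> {\<tau> j..t} \<times> {j} \<subseteq> E"
    "\<And>t j. (t, Suc j) \<in> E \<Longrightarrow> (\<tau> (Suc j), j) \<in> E"
proof -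
  obtain \<tau> :: "nat \<Rightarrow> real" where \<tau>: "\<tau> 0 = 0" "incseq \<tau>"
    and E: "E = (\<Union>j. {\<tau> j..\<tau> (Suc j)} \<times> {j}) \<or>
      (\<exists>N L. L \<noteq> {} \<and> (L = {\<tau> N..\<tau> (Suc N)} \<or> L = {\<tau> N..<\<tau> (Suc N)} \<or> L = {\<tau> N..}) \<and>
         E = (\<Union>j<N. {\<tau> j..\<tau> (Suc j)} \<times> {j}) \<union> L \<times> {N})"
    using assms[unfolded hybrid_time_domain_def] by (elim exE conjE)
  have le: "\<tau> j \<le> \<tau> (Suc j)" for j using \<tau>(2) by (simp add: incseq_SucD)
  show thesis
    using E
  proof (elim disjE exE conjE)
    assume E: "E = (\<Union>j. {\<tau> j..\<tau> (Suc j)} \<times> {j})"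
    show thesis
      by (rule that[OF \<tau>]) (use le[of 0] le \<tau>(1) in \<open>auto simp: E\<close>)
  next
    fix N L assume L: "L \<noteq> {}" "L = {\<tau> N..\<tau> (Suc N)}"
      and E: "E = (\<Union>j<N. {\<tau> j..\<tau> (Suc j)} \<times> {j}) \<union> L \<times> {N}"
    have E': "(t, j) \<in> E \<longleftrightarrow> (j < N \<and> t \<in> {\<tau> j..\<tau> (Suc j)} \<or> j = N \<and> t \<in> L)" for t j
      by (auto simp: E)
    show thesis
      by (rule that[OF \<tau>]) (use le[of 0] le \<tau>(1) L in \<open>auto simp: E' neq0_conv\<close>)
  next
    fix N L assume L: "L \<noteq> {}" "L = {\<tau> N..<\<tau> (Suc N)}"
      and E: "E = (\<Union>j<N. {\<tau> j..\<tau> (Suc j)} \<times> {j}) \<union> L \<times> {N}"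
    have E': "(t, j) \<in> E \<longleftrightarrow> (j < N \<and> t \<in> {\<tau> j..\<tau> (Suc j)} \<or> j = N \<and> t \<in> L)" for t j
      by (auto simp: E)
    show thesis
      by (rule that[OF \<tau>]) (use le[of 0] le \<tau>(1) L in \<open>auto simp: E' neq0_conv\<close>)
  next
    fix N L assume L: "L \<noteq> {}" "L = {\<tau> N..}"
      and E: "E = (\<Union>j<N. {\<tau> j..\<tau> (Suc j)} \<times> {j}) \<union> L \<times> {N}"
    have E': "(t, j) \<in> E \<longleftrightarrow> (j < N \<and> t \<in> {\<tau> j..\<tau> (Suc j)} \<or> j = N \<and> t \<in> L)" for t j
      by (auto simp: E)
    show thesis
      by (rule that[OF \<tau>]) (use le[of 0] le \<tau>(1) L in \<open>auto simp: E' neq0_conv\<close>)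
  qed
qed

text \<open>Every point is reached from \<open>(0, 0)\<close> by alternately moving along one piece
  from its left end and passing to the next index at a common time.\<close>

lemma hybrid_time_domain_induct:
  assumes E: "hybrid_time_domain E" and "(t, j) \<in> E" and base: "P 0 0"
    and flow: "\<And>s t j. s \<le> t \<Longrightarrow> {s..t} \<times> {j} \<subseteq> E \<Longrightarrow> P s j \<Longrightarrow> P t j"
    and jump: "\<And>t j. (t, j) \<in> E \<Longrightarrow> (t, Suc j) \<in> E \<Longrightarrow> P t j \<Longrightarrow> P t (Suc j)"
  shows "P t j"
proof -
  obtain \<tau> :: "nat \<Rightarrow> real" where \<tau>: "\<tau> 0 = 0"
    "\<And>t j. (t, j) \<in> E \<Longrightarrow> \<tau> j \<le> t \<and> {\<tau> j..t} \<times> {j} \<subseteq> E"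
    "\<And>t j. (t, Suc j) \<in> E \<Longrightarrow> (\<tau> (Suc j), j) \<in> E"
    by (rule hybrid_time_domainE[OF E]) blast
  have start: "(\<tau> j, j) \<in> E" if "(t, j) \<in> E" for t j
    using \<tau>(2)[OF that] by auto
  have reach: "P t j" if "(t, j) \<in> E" "P (\<tau> j) j" for t j
    using flow[of "\<tau> j" t j] \<tau>(2)[OF that(1)] that(2) by blast
  have "P (\<tau> j) j" if "(t, j) \<in> E" for t j
    using that
  proof (induction j arbitrary: t)
    case 0
    then show ?case using base \<tau>(1) by simp
  next
    case (Suc j)
    have *: "(\<tau> (Suc j), j) \<in> E" by (rule \<tau>(3)[OF Suc.prems])
    show ?case
      by (rule jump[OF * start[OF Suc.prems] reach[OF * Suc.IH[OF *]]])
  qed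
  then show ?thesis using reach assms(2) by blast
qed

section \<open>Auxiliary facts: projections of solutions, compact products, coercivity\<close>

lemma abs_continuous_on_le:
  fixes f :: "real \<Rightarrow> 'a::real_normed_vector" and g :: "real \<Rightarrow> 'b::real_normed_vector"
  assumes "abs_continuous_on a b f" and le: "\<And>s t. norm (g t - g s) \<le> norm (f t - f s)"
  shows "abs_continuous_on a b g"
  unfolding abs_continuous_on_def
proof (intro allI impI)
  fix e :: real assume "e > 0"
  then obtain \<eta> where "\<eta> > 0" and \<eta>: "\<forall>(m::nat) c d.
     (\<forall>i<m. a \<le> c i \<and> c i \<le> d i \<and> d i \<le> b) \<and>
     disjoint_family_on (\<lambda>i. {c i<..<d i}) {..<m} \<and> (\<Sum>i<m. d i - c i) < \<eta>
     \<longrightarrow> (\<Sum>i<m. norm (f (d i) - f (c i))) < e"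
    using assms(1)[unfolded abs_continuous_on_def, rule_format, OF \<open>e > 0\<close>] by (elim exE conjE)
  show "\<exists>\<eta>>0. \<forall>(m::nat) c d. (\<forall>i<m. a \<le> c i \<and> c i \<le> d i \<and> d i \<le> b) \<and>
     disjoint_family_on (\<lambda>i. {c i<..<d i}) {..<m} \<and> (\<Sum>i<m. d i - c i) < \<eta>
     \<longrightarrow> (\<Sum>i<m. norm (g (d i) - g (c i))) < e"
  proof (intro exI conjI allI impI)
    fix m :: nat and c d :: "nat \<Rightarrow> real"
    assume *: "(\<forall>i<m. a \<le> c i \<and> c i \<le> d i \<and> d i \<le> b) \<and>
     disjoint_family_on (\<lambda>i. {c i<..<d i}) {..<m} \<and> (\<Sum>i<m. d i - c i) < \<eta>"
    show "(\<Sum>i<m. norm (g (d i) - g (c i))) < e"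
      using sum_mono[of "{..<m}", OF le] \<eta>[rule_format, OF *] by (rule le_less_trans)
  qed (rule \<open>\<eta> > 0\<close>)
qed

lemma abs_continuous_on_imp_continuous_on:
  assumes "abs_continuous_on a b f" shows "continuous_on {a..b} f"
  unfolding continuous_on_iff
proof (intro ballI allI impI)
  fix x e :: real assume x: "x \<in> {a..b}" and "e > 0"
  obtain \<eta> where \<eta>: "\<eta> > 0" "\<And>(S::nat set) c d. \<lbrakk>finite S; \<And>i. i \<in> S \<Longrightarrow> a \<le> c i \<and> c i \<le> d i \<and> d i \<le> b;
       disjoint_family_on (\<lambda>i. {c i<..<d i}) S; (\<Sum>i\<in>S. d i - c i) < \<eta>\<rbrakk>
     \<Longrightarrow> (\<Sum>i\<in>S. norm (f (d i) - f (c i))) < e"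
    by (rule abs_continuous_on_sum_lt[OF assms \<open>e > 0\<close>]) blast
  have close: "norm (f d - f c) < e" if "a \<le> c" "c \<le> d" "d \<le> b" "d - c < \<eta>" for c d
    using \<eta>(2)[of "{0}" "\<lambda>_. c" "\<lambda>_. d"] that by (simp add: disjoint_family_on_def)
  show "\<exists>d>0. \<forall>x'\<in>{a..b}. dist x' x < d \<longrightarrow> dist (f x') (f x) < e"
  proof (intro exI conjI ballI impI)
    fix y assume y: "y \<in> {a..b}" "dist y x < \<eta>"
    show "dist (f y) (f x) < e"
      using close[of x y] close[of y x] x y
      by (cases "x \<le> y") (auto simp: dist_norm norm_minus_commute)
  qed (rule \<eta>(1))
qed

lemma compact_vec_set:
  fixes B :: "2 \<Rightarrow> (real^3^3) set"
  assumes "\<And>h. compact (B h)" shows "compact {X. \<forall>h. X $ h \<in> B h}"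
proof -
  have "{X. \<forall>h. X $ h \<in> B h} = (\<lambda>(R, S). \<chi> h. if h = 1 then R else S) ` (B 1 \<times> B 2)"
  proof (intro equalityI subsetI)
    fix X assume "X \<in> {X. \<forall>h. X $ h \<in> B h}"
    then show "X \<in> (\<lambda>(R, S). \<chi> h. if h = 1 then R else S) ` (B 1 \<times> B 2)"
      by (intro image_eqI[of _ _ "(X $ 1, X $ 2)"]) (auto simp: vec_eq_iff forall_2)
  qed (auto simp: forall_2)
  moreover have "compact ((\<lambda>(R, S). (\<chi> h. if h = 1 then R else S) :: (real^3^3)^2) ` (B 1 \<times> B 2))"
  proof (intro compact_continuous_image compact_Times assms)
    have "continuous_on T (\<lambda>x. if h = 1 then fst x else snd x)" for T :: "((real^3^3) \<times> (real^3^3)) set" and h :: 2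
      by (cases "h = 1") (auto intro: continuous_intros)
    then show "continuous_on (B 1 \<times> B 2) (\<lambda>(R, S). (\<chi> h. if h = 1 then R else S) :: (real^3^3)^2)"
      unfolding case_prod_unfold by (intro continuous_on_vec_lambda)
  qed
  ultimately show ?thesis by simp
qed

lemma pos_def_coercive:
  assumes "pos_def J" obtains c where "c > 0" "\<And>w. c * (norm w)\<^sup>2 \<le> w \<bullet> (J *v w)"
proof -
  have "sphere (0::real^3) 1 \<noteq> {}" by simp
  moreover have "continuous_on (sphere 0 1) (\<lambda>w. w \<bullet> (J *v w))"
    by (intro continuous_intros matrix_vector.continuous_on)
  ultimately obtain z where z: "z \<in> sphere 0 1" "\<forall>w\<in>sphere 0 1. z \<bullet> (J *v z) \<le> w \<bullet> (J *v w)"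
    using continuous_attains_inf[OF compact_sphere] by blast
  show thesis
  proof (rule that[of "z \<bullet> (J *v z)"])
    have "z \<noteq> 0" using z(1) by auto
    then show "0 < z \<bullet> (J *v z)" using assms by (simp add: pos_def_def)
    show "z \<bullet> (J *v z) * (norm w)\<^sup>2 \<le> w \<bullet> (J *v w)" for w
    proof (cases "w = 0")
      case False
      have "z \<bullet> (J *v z) \<le> (w /\<^sub>R norm w) \<bullet> (J *v (w /\<^sub>R norm w))"
        by (rule z(2)[rule_format]) (use False in simp)
      then show ?thesis using False
        by (simp add: matrix_vector.scaleR_right field_simps power2_eq_square)
    qed simp
  qed
qed

subsection \<open>The Lyapunov function\<close>

text \<open>The flow map gives the acceleration only implicitly, through \<open>J\<close>;
  invertibility makes it a function of the state.\<close>

lemma pos_def_solve: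
  assumes "pos_def J" shows "J *v w = y \<longleftrightarrow> w = matrix_inv J *v y"
proof -
  have "\<forall>x. J *v x = 0 \<longrightarrow> x = 0" using assms by (auto simp: pos_def_def)
  then have inv: "invertible J"
    unfolding invertible_left_inverse matrix_left_invertible_ker .
  have "J ** matrix_inv J = mat 1" "matrix_inv J ** J = mat 1"
    using inv unfolding invertible_def matrix_inv_def by (metis (mono_tags, lifting) someI_ex)+
  then show ?thesis by (metis matrix_vector_mul_assoc matrix_vector_mul_lid)
qed

text \<open>Central synergy is kept only in the form that the flow uses: within the gap allowed
  while flowing, a vanishing innovation forces the identity.\<close>

locale synergistic_loop =
  fixes J Rd :: "real^3^3" and I :: "'i set" and r :: "'i \<Rightarrow> real^3"
    and \<rho> :: "2 \<Rightarrow> 'i \<Rightarrow> real" and A :: "2 \<Rightarrow> real^3^3"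
    and u :: "2 \<Rightarrow> real^3" and Q :: "real set" and k :: "2 \<Rightarrow> real \<Rightarrow> real" and \<delta> :: "2 \<Rightarrow> real"
  assumes J: "pos_def J" and Rd: "Rd \<in> SO3" and finQ: "finite Q" and \<delta>: "\<And>h. \<delta> h > 0"
    and warped: "\<And>h p. p \<in> Q \<Longrightarrow> warped_directions I (\<rho> h) r (A h) (u h) (k h p)"
    and synergistic: "\<And>h R p. \<lbrakk>R \<in> SO3; p \<in> Q; innovation (A h) (u h) (k h p) R = 0;
       synergy_gap A u k Q h R p \<le> \<delta> h\<rbrakk> \<Longrightarrow> R = mat 1"
begin

abbreviation "U \<equiv> potential A u k"
abbreviation "gap \<equiv> synergy_gap A u k Q"
abbreviation "H \<equiv> closed_loop A u k Q \<delta> J Rd"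

definition states :: "state set" where
  "states = {(X, \<omega>, q). (\<forall>h. X $ h \<in> SO3) \<and> (\<forall>h. q $ h \<in> Q)}"

lemma flow_jump_states: "flow_set H \<union> jump_set H = states"
  by (auto simp: closed_loop_def states_def not_le intro: less_imp_le)

definition lyap :: "state \<Rightarrow> real" where
  "lyap = (\<lambda>(X, \<omega>, q). (\<Sum>h\<in>UNIV. U h (X $ h) (q $ h)) + (1/2) * (\<omega> \<bullet> (J *v \<omega>)))"

text \<open>The angular velocity of \<open>X\<^sub>h\<close> in its own body frame.\<close>

definition frame_rate :: "real^2 \<Rightarrow> (real^3^3)^2 \<Rightarrow> real^3 \<Rightarrow> 2 \<Rightarrow> real^3" where
  "frame_rate q X \<omega> h = ref_attitude Rd X $ h *v \<omega> - (if h = 1 then innov A u k X q 1 else 0)"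

definition field :: "real^2 \<Rightarrow> ((real^3^3)^2) \<times> (real^3) \<Rightarrow> ((real^3^3)^2) \<times> (real^3)" where
  "field q = (\<lambda>(X, \<omega>). ((\<chi> h. X $ h ** skew (frame_rate q X \<omega> h)),
     matrix_inv J *v (skew (J *v \<omega>) *v \<omega> + torque A u k Rd X q)))"

text \<open>The set-valued flow map has exactly one value, so with frozen modes the flow is the
  autonomous equation of \<open>field q\<close>.\<close>

lemma flow_map_iff:
  "v \<in> flow_map H (X, \<omega>, q) \<longleftrightarrow> v = (fst (field q (X, \<omega>)), snd (field q (X, \<omega>)), 0)"
  by (cases v) (auto simp: closed_loop_def field_def vec_eq_iff[where 'b=2] forall_2 frame_rate_def pos_def_solve[OF J])

lemma potential_mode:
  assumes "p \<in> Q"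
  shows "R \<in> SO3 \<Longrightarrow> 0 \<le> U h R p" and "R \<in> SO3 \<Longrightarrow> U h R p = 0 \<longleftrightarrow> R = mat 1"
    and "continuous_on SO3 (\<lambda>R. U h R p)"
proof -
  interpret warped_directions I "\<rho> h" r "A h" "u h" "k h p" by (rule warped[OF assms])
  show "R \<in> SO3 \<Longrightarrow> 0 \<le> U h R p" "R \<in> SO3 \<Longrightarrow> U h R p = 0 \<longleftrightarrow> R = mat 1"
    unfolding potential_def by (rule warped_potential_nonneg warped_potential_eq_0_iff; assumption)+
  show "continuous_on SO3 (\<lambda>R. U h R p)"
    unfolding potential_def
    by (rule continuous_on_subset[OF continuous_on_warped_potential]) (use SO3_regular in blast)
qed

lemma gap_nonneg: "p \<in> Q \<Longrightarrow> 0 \<le> gap h R p"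
  using finQ by (simp add: synergy_gap_def)

text \<open>Replaces the minimum over modes by finitely many inequalities between continuous
  functions, from which closedness and persistence follow mode by mode.\<close>

lemma gap_le_iff:
  assumes "p \<in> Q" shows "gap h R p \<le> d \<longleftrightarrow> (\<forall>s\<in>Q. U h R p - d \<le> U h R s)"
proof -
  have "gap h R p \<le> d \<longleftrightarrow> U h R p - d \<le> (MIN s\<in>Q. U h R s)"
    unfolding synergy_gap_def by linarith
  also have "\<dots> \<longleftrightarrow> (\<forall>s\<in>Q. U h R p - d \<le> U h R s)"
    using finQ assms by (subst Min_ge_iff) auto
  finally show ?thesis .
qed

lemma gap_less_iff:
  assumes "p \<in> Q" shows "gap h R p < d \<longleftrightarrow> (\<forall>s\<in>Q. U h R p - d < U h R s)"
proof -
  have "gap h R p < d \<longleftrightarrow> U h R p - d < (MIN s\<in>Q. U h R s)"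
    unfolding synergy_gap_def by linarith
  also have "\<dots> \<longleftrightarrow> (\<forall>s\<in>Q. U h R p - d < U h R s)"
    using finQ assms by (subst Min_gr_iff) auto
  finally show ?thesis .
qed

definition flow_region :: "2 \<Rightarrow> real \<Rightarrow> (real^3^3) set" where
  "flow_region h p = {R \<in> SO3. gap h R p \<le> \<delta> h}"

lemma compact_flow_region:
  assumes "p \<in> Q" shows "compact (flow_region h p)"
proof -
  have "flow_region h p = SO3 \<inter> (\<Inter>s\<in>Q. SO3 \<inter> (\<lambda>R. U h R p - \<delta> h - U h R s) -` {..0})"
    using assms gap_le_iff[OF assms] by (auto simp: flow_region_def)
  moreover have "closed (\<Inter>s\<in>Q. SO3 \<inter> (\<lambda>R. U h R p - \<delta> h - U h R s) -` {..0})"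
    using assms by (intro closed_INT ballI continuous_closed_preimage continuous_intros
        potential_mode compact_imp_closed compact_SO3 closed_atMost)
  ultimately show ?thesis using compact_SO3 by (simp add: compact_Int_closed)
qed

text \<open>States for which every warp angle is regular, with no rotation constraint. This set is
  open, so Peano's theorem finds a full ball around a state.\<close>

definition regular :: "real^2 \<Rightarrow> (((real^3^3)^2) \<times> (real^3)) set" where
  "regular q = {(X, \<omega>). \<forall>h. \<bar>k h (q $ h) * trace_potential (A h) (X $ h)\<bar> < 1}"

lemma continuous_on_innov:
  assumes "\<And>h. q $ h \<in> Q" shows "continuous_on (regular q) (\<lambda>x. innov A u k (fst x) q h)"
proof -
  interpret warped_directions I "\<rho> h" r "A h" "u h" "k h (q $ h)" by (rule warped[OF assms])
  show ?thesis
    unfolding innov_def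
    by (rule continuous_on_compose2[OF continuous_on_innovation])
      (auto intro!: continuous_intros simp: regular_def)
qed

lemma continuous_on_ref_attitude: "continuous_on S (\<lambda>x. ref_attitude Rd (fst x) $ h)"
  for S :: "(((real^3^3)^2) \<times> 'b::topological_space) set"
  unfolding ref_attitude_def
  by (cases "h = 1") (auto intro!: continuous_intros matrix_mult.continuous_on
      bounded_linear.continuous_on[OF bounded_linear_transpose])

lemma continuous_on_torque:
  assumes "\<And>h. q $ h \<in> Q" shows "continuous_on (regular q) (\<lambda>x. torque A u k Rd (fst x) q)"
  unfolding torque_def
  by (intro continuous_intros matrix_vector.continuous_on continuous_on_ref_attitude
      bounded_linear.continuous_on[OF bounded_linear_transpose] continuous_on_innov assms)

lemma continuous_on_frame_rate:
  assumes "\<And>h. q $ h \<in> Q" shows "continuous_on (regular q) (\<lambda>x. frame_rate q (fst x) (snd x) h)"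
  unfolding frame_rate_def
  by (cases "h = 1") (auto intro!: continuous_intros matrix_vector.continuous_on continuous_on_ref_attitude
      continuous_on_innov assms)

lemma continuous_on_field:
  assumes "\<And>h. q $ h \<in> Q" shows "continuous_on (regular q) (field q)"
  unfolding field_def case_prod_unfold
  by (intro continuous_intros matrix_vector.continuous_on matrix_mult.continuous_on
      bounded_linear.continuous_on[OF bounded_linear_skew] continuous_on_frame_rate continuous_on_torque assms)

lemma open_regular:
  assumes "\<And>h. q $ h \<in> Q" shows "open (regular q)"
proof -
  have "open {x :: ((real^3^3)^2) \<times> (real^3). \<bar>k h (q $ h) * trace_potential (A h) (fst x $ h)\<bar> < 1}" for h
  proof -
    interpret warped_directions I "\<rho> h" r "A h" "u h" "k h (q $ h)" by (rule warped[OF assms])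
    show ?thesis by (intro open_Collect_less continuous_intros continuous_on_trace_potential)
  qed
  then have "open (\<Inter>h. {x :: ((real^3^3)^2) \<times> (real^3). \<bar>k h (q $ h) * trace_potential (A h) (fst x $ h)\<bar> < 1})"
    by (intro open_INT) auto
  moreover have "regular q = (\<Inter>h. {x. \<bar>k h (q $ h) * trace_potential (A h) (fst x $ h)\<bar> < 1})"
    by (auto simp: regular_def)
  ultimately show ?thesis by simp
qed

lemma SO3_regular_state:
  assumes "\<And>h. q $ h \<in> Q" "\<And>h. X $ h \<in> SO3" shows "(X, \<omega>) \<in> regular q"
proof -
  have "\<bar>k h (q $ h) * trace_potential (A h) (X $ h)\<bar> < 1" for h
  proof -
    interpret warped_directions I "\<rho> h" r "A h" "u h" "k h (q $ h)" by (rule warped[OF assms(1)])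
    show ?thesis by (rule SO3_regular[OF assms(2)])
  qed
  then show ?thesis by (simp add: regular_def)
qed

text \<open>Along the flow, the potentials contribute \<open>2 \<Sum>h. innov\<^sub>h \<bullet> frame_rate\<^sub>h\<close> and the kinetic energy
  \<open>\<omega> \<bullet> torque\<close>; only the observer damping survives.\<close>

lemma lyap_derivative:
  assumes q: "\<And>h. q $ h \<in> Q" and X: "\<And>h. X t $ h \<in> SO3"
    and der: "((\<lambda>t. (X t, \<omega> t)) has_vector_derivative field q (X t, \<omega> t)) (at t within S)"
  shows "((\<lambda>t. lyap (X t, \<omega> t, q)) has_vector_derivative - 2 * (norm (innov A u k (X t) q 1))\<^sup>2) (at t within S)"
proof -
  define w where "w = frame_rate q (X t) (\<omega> t)"
  define z where "z = innov A u k (X t) q"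
  define Y where "Y h = ref_attitude Rd (X t) $ h" for h
  define a where "a = snd (field q (X t, \<omega> t))"
  have dX: "((\<lambda>t. X t $ h) has_vector_derivative X t $ h ** skew (w h)) (at t within S)" for h
  proof -
    have "bounded_linear (\<lambda>x :: ((real^3^3)^2) \<times> (real^3). fst x $ h)"
      by (rule bounded_linear_compose[OF bounded_linear_vec_nth bounded_linear_fst])
    from bounded_linear.has_vector_derivative[OF this der]
    show ?thesis by (simp add: field_def w_def)
  qed
  have d\<omega>: "(\<omega> has_vector_derivative a) (at t within S)"
    using bounded_linear.has_vector_derivative[OF bounded_linear_snd der] by (simp add: a_def)
  have dU: "((\<lambda>t. U h (X t $ h) (q $ h)) has_vector_derivative 2 * (z h \<bullet> w h)) (at t within S)" for h
  proof -
    interpret warped_directions I "\<rho> h" r "A h" "u h" "k h (q $ h)" by (rule warped[OF q])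
    obtain f' where f': "(warped_potential (A h) (u h) (k h (q $ h)) has_derivative f') (at (X t $ h))"
      "\<And>w. f' (X t $ h ** skew w) = 2 * (innovation (A h) (u h) (k h (q $ h)) (X t $ h) \<bullet> w)"
      using warped_potential_has_derivative[OF SO3_regular[OF X[of h]]] by blast
    show ?thesis
      using vector_derivative_diff_chain_within[OF dX[of h] has_derivative_at_withinI[OF f'(1)]]
      by (simp add: o_def f'(2) potential_def z_def innov_def)
  qed
  have dJ: "((\<lambda>t. J *v \<omega> t) has_vector_derivative J *v a) (at t within S)"
    by (rule bounded_linear.has_vector_derivative[OF matrix_vector.bounded_linear_right d\<omega>])
  have sym: "x \<bullet> (J *v y) = y \<bullet> (J *v x)" for x y
    using J unfolding pos_def_def by (metis dot_lmul_matrix inner_commute transpose_matrix_vector)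
  have dK: "((\<lambda>t. \<omega> t \<bullet> (J *v \<omega> t)) has_vector_derivative 2 * (\<omega> t \<bullet> (J *v a))) (at t within S)"
    using bounded_bilinear.has_vector_derivative[OF bounded_bilinear_inner d\<omega> dJ] sym[of a] by simp
  have "J *v a = skew (J *v \<omega> t) *v \<omega> t + torque A u k Rd (X t) q"
    unfolding pos_def_solve[OF J] by (simp add: a_def field_def)
  \<comment> \<open>The gyroscopic term does no work: the cross product is orthogonal to
    \<open>\<omega> t\<close>.\<close>
  then have "\<omega> t \<bullet> (J *v a) = \<omega> t \<bullet> torque A u k Rd (X t) q"
    by (simp add: inner_add_right dot_cross_self)
  also have "\<dots> = - 2 * (\<Sum>h\<in>UNIV. z h \<bullet> (Y h *v \<omega> t))"
  proof -
    have "\<omega> t \<bullet> (transpose M *v x) = x \<bullet> (M *v \<omega> t)" for M :: "real^3^3" and x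
      by (simp add: dot_lmul_matrix inner_commute[of "\<omega> t"])
    then show ?thesis
      unfolding torque_def inner_scaleR_right inner_sum_right z_def Y_def by simp
  qed
  finally have kin: "\<omega> t \<bullet> (J *v a) = - 2 * (\<Sum>h\<in>UNIV. z h \<bullet> (Y h *v \<omega> t))" .
  have "((\<lambda>t. lyap (X t, \<omega> t, q)) has_vector_derivative
    (\<Sum>h\<in>UNIV. 2 * (z h \<bullet> w h)) + (1/2) * (2 * (\<omega> t \<bullet> (J *v a)))) (at t within S)"
    unfolding lyap_def by (auto intro!: derivative_eq_intros dU dK has_vector_derivative_mult_right)
  \<comment> \<open>\<open>w h\<close> is \<open>Y h *v \<omega> t\<close>, minus \<open>z 1\<close>
    if \<open>h = 1\<close>. The terms with \<open>Y h\<close> cancel against the work of the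
    torque, leaving \<open>- 2\<close> times the square of \<open>z 1\<close>.\<close>
  moreover have "(\<Sum>h\<in>UNIV. 2 * (z h \<bullet> w h)) + (1/2) * (2 * (\<omega> t \<bullet> (J *v a))) = - 2 * (norm (z 1))\<^sup>2"
    unfolding kin by (simp add: sum_2 w_def frame_rate_def z_def[symmetric] Y_def[symmetric] inner_diff_right
      power2_norm_eq_inner algebra_simps)
  ultimately show ?thesis by (simp add: z_def)
qed

end

text \<open>Applied to the finitely many pairs of an index and a mode, to obtain radii and times
  that serve all of them.\<close>

lemma finite_uniform_bound:
  fixes P :: "'s \<Rightarrow> real \<Rightarrow> bool"
  assumes "finite S" "\<And>s. s \<in> S \<Longrightarrow> \<exists>v>0. P s v"
    and mono: "\<And>s v v'. P s v \<Longrightarrow> 0 < v' \<Longrightarrow> v' \<le> v \<Longrightarrow> P s v'"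
  obtains v where "v > 0" "\<And>s. s \<in> S \<Longrightarrow> P s v"
proof -
  have "\<exists>v>0. \<forall>s\<in>S. P s v"
    using assms(1,2)
  proof (induction S)
    case (insert s S)
    then obtain v1 v2 where "v1 > 0" "\<forall>s\<in>S. P s v1" "v2 > 0" "P s v2" by force
    then show ?case
      by (intro exI[of _ "min v1 v2"]) (auto intro: mono[of _ v1] mono[of _ v2])
  qed (auto intro: exI[of _ 1])
  then show thesis using that by blast
qed

lemma norm_pair_le: "norm X \<le> norm (X $ 1) + norm (X $ 2)"
  for X :: "(real^3^3)^2"
proof -
  have "norm X \<le> (\<Sum>h\<in>UNIV. norm (X $ h))"
    unfolding norm_vec_def[of X] by (rule L2_set_le_sum) simp
  then show ?thesis by (simp add: sum_2)
qed

section \<open>Regularity of trajectories and decrease of the energy\<close>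

context synergistic_loop
begin

text \<open>The bridge from hybrid arcs to classical solutions. A derivative that vanishes almost
  everywhere freezes the mode; membership in the flow set, known only in the interior, passes to the
  end points; then \<open>field\<close> is continuous along the arc and the derivative exists
  everywhere.\<close>

lemma solution_segment:
  assumes sol: "hybrid_solution H E \<phi>" and "a < b" and sub: "{a..b} \<times> {j} \<subseteq> E"
  obtains X \<omega> q where "\<And>t. t \<in> {a..b} \<Longrightarrow> \<phi> (t, j) = (X t, \<omega> t, q)" "\<And>h. q $ h \<in> Q"
    "\<And>t h. t \<in> {a..b} \<Longrightarrow> X t $ h \<in> flow_region h (q $ h)"
    "\<And>t. t \<in> {a..b} \<Longrightarrow> ((\<lambda>t. (X t, \<omega> t)) has_vector_derivative field q (X t, \<omega> t)) (at t within {a..b})"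
proof -
  define D where "D = {t. (t, j) \<in> E}"
  define f where "f t = \<phi> (t, j)" for t
  define X where "X t = fst (f t)" for t
  define \<omega> where "\<omega> t = fst (snd (f t))" for t
  define q where "q t = snd (snd (f t))" for t
  have D: "{a..b} \<subseteq> D" using sub by (auto simp: D_def)
  have "{a<..<b} \<subseteq> D" using D by force
  then have int: "{a<..<b} \<subseteq> interior D" by (simp add: interior_maximal)
  have solj: "locally_abs_continuous_on D f" "\<forall>t \<in> interior D. f t \<in> flow_set H"
    "AE t in lebesgue. t \<in> D \<longrightarrow> (\<exists>v \<in> flow_map H (f t). (f has_vector_derivative v) (at t within D))"
    using sol unfolding hybrid_solution_def Let_def D_def f_def by auto
  have f_eq: "f t = (X t, \<omega> t, q t)" for t by (simp add: X_def \<omega>_def q_def)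
  have ac: "abs_continuous_on a t f" if "t \<in> {a..b}" for t
  proof -
    have "a \<le> t" "{a..t} \<subseteq> D" using that D by auto
    then show ?thesis using solj(1) unfolding locally_abs_continuous_on_def by blast
  qed
  obtain N where N: "negligible N"
    "\<And>t. t \<in> D - N \<Longrightarrow> \<exists>v \<in> flow_map H (f t). (f has_vector_derivative v) (at t within D)"
    using solj(3) unfolding eventually_ae_filter_negligible by blast
  have der: "(f has_vector_derivative (fst (field (q t) (X t, \<omega> t)), snd (field (q t) (X t, \<omega> t)), 0)) (at t within {a..b})"
    if "t \<in> {a..b} - N" for t
  proof -
    have "t \<in> D - N" using that D by blast
    from N(2)[OF this] obtain v where v: "v \<in> flow_map H (f t)" "(f has_vector_derivative v) (at t within D)"
      by blast
    then show ?thesis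
      using has_vector_derivative_within_subset[OF v(2) D] unfolding f_eq[of t] flow_map_iff by simp
  qed
  \<comment> \<open>Absolute continuity is essential: a continuous function with derivative 0 almost
    everywhere need not be constant.\<close>
  have q_const: "q t = q a" if t: "t \<in> {a..b}" for t
  proof -
    have "((\<lambda>_. 0) has_integral (q t - q a)) {a..t}"
    proof (rule abs_continuous_fundamental_theorem[OF _ _ N(1)])
      show "a \<le> t" using t by simp
      show "abs_continuous_on a t q"
      proof (rule abs_continuous_on_le[OF ac[OF t]])
        show "norm (q t - q s) \<le> norm (f t - f s)" for s t
          using order_trans[OF norm_snd_le[of "q t - q s" "\<omega> t - \<omega> s"]
              norm_snd_le[of "(\<omega> t - \<omega> s, q t - q s)" "X t - X s"]]
          by (simp add: f_eq)
      qed
      show "(q has_vector_derivative 0) (at s within {a..t})" if "s \<in> {a..t} - N" for s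
      proof -
        have "s \<in> {a..b} - N" using that t by auto
        have "((\<lambda>s. snd (snd (f s))) has_vector_derivative 0) (at s within {a..b})"
          using bounded_linear.has_vector_derivative[OF bounded_linear_snd
            bounded_linear.has_vector_derivative[OF bounded_linear_snd der[OF \<open>s \<in> {a..b} - N\<close>]]] by simp
        then have "(q has_vector_derivative 0) (at s within {a..b})" by (simp add: q_def[abs_def])
        then show ?thesis by (rule has_vector_derivative_within_subset) (use t in auto)
      qed
    qed
    moreover have "((\<lambda>_. 0) has_integral 0) {a..t}" by simp
    ultimately have "q t - q a = 0" by (rule has_integral_unique)
    then show ?thesis by simp
  qed
  have open_seg: "(\<forall>h. q a $ h \<in> Q) \<and> (\<forall>h. X t $ h \<in> flow_region h (q a $ h))" if "t \<in> {a<..<b}" for t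
  proof -
    have "f t \<in> flow_set H" using int solj(2) that by blast
    then show ?thesis
      using q_const[of t] that unfolding f_eq[of t] by (auto simp: closed_loop_def flow_region_def)
  qed
  have "(a + b) / 2 \<in> {a<..<b}" using \<open>a < b\<close> by simp
  then have qQ: "q a $ h \<in> Q" for h using open_seg by blast
  have cont: "continuous_on {a..b} f"
    using abs_continuous_on_imp_continuous_on[OF ac[of b]] \<open>a < b\<close> by simp
  have region: "X t $ h \<in> flow_region h (q a $ h)" if t: "t \<in> {a..b}" for t h
  proof -
    \<comment> \<open>The region is closed and the arc continuous, so the end points inherit
      membership from the open segment.\<close>
    have "(\<lambda>t. X t $ h) ` closure {a<..<b} \<subseteq> flow_region h (q a $ h)"
    proof (rule image_closure_subset)
      show "continuous_on (closure {a<..<b}) (\<lambda>t. X t $ h)"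
        using \<open>a < b\<close> cont unfolding X_def by (auto intro!: continuous_intros)
      show "closed (flow_region h (q a $ h))" by (intro compact_imp_closed compact_flow_region qQ)
    qed (use open_seg in auto)
    then show ?thesis using t \<open>a < b\<close> by auto
  qed
  show thesis
  proof (rule that[of X \<omega> "q a"])
    show "\<phi> (t, j) = (X t, \<omega> t, q a)" if "t \<in> {a..b}" for t
      using f_eq[of t] q_const[OF that] by (simp add: f_def)
    show "q a $ h \<in> Q" "t \<in> {a..b} \<Longrightarrow> X t $ h \<in> flow_region h (q a $ h)" for t h by (fact qQ, fact region)
    fix t assume t: "t \<in> {a..b}"
    show "((\<lambda>t. (X t, \<omega> t)) has_vector_derivative field (q a) (X t, \<omega> t)) (at t within {a..b})"
    proof (rule abs_continuous_has_vector_derivative[OF _ _ N(1) _ _ t])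
      show "a \<le> b" using \<open>a < b\<close> by simp
      show "abs_continuous_on a s (\<lambda>t. (X t, \<omega> t))" if "s \<in> {a..b}" for s
      proof (rule abs_continuous_on_le[OF ac[OF that]])
        fix s t
        have "norm (X t - X s, \<omega> t - \<omega> s) \<le> norm (X t - X s, \<omega> t - \<omega> s, q t - q s)"
          unfolding norm_Pair by simp
        then show "norm ((X t, \<omega> t) - (X s, \<omega> s)) \<le> norm (f t - f s)" by (simp add: f_eq)
      qed
      show "((\<lambda>t. (X t, \<omega> t)) has_vector_derivative field (q a) (X s, \<omega> s)) (at s within {a..b})"
        if "s \<in> {a..b} - N" for s
      proof -
        have "((\<lambda>s. (fst (f s), fst (snd (f s)))) has_vector_derivative
           (fst (field (q s) (X s, \<omega> s)), snd (field (q s) (X s, \<omega> s)))) (at s within {a..b})"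
          using bounded_linear.has_vector_derivative[OF bounded_linear_fst der[OF that]]
            bounded_linear.has_vector_derivative[OF bounded_linear_fst
            bounded_linear.has_vector_derivative[OF bounded_linear_snd der[OF that]]]
          by (intro has_vector_derivative_Pair) simp_all
        then show ?thesis using q_const[of s] that by (simp add: X_def[abs_def] \<omega>_def[abs_def])
      qed
      show "continuous_on {a..b} (\<lambda>t. field (q a) (X t, \<omega> t))"
      proof (rule continuous_on_compose2[OF continuous_on_field[OF qQ]])
        show "continuous_on {a..b} (\<lambda>t. (X t, \<omega> t))"
          using cont unfolding X_def \<omega>_def by (intro continuous_intros)
        show "(\<lambda>t. (X t, \<omega> t)) ` {a..b} \<subseteq> regular (q a)"
          using region SO3_regular_state[OF qQ] by (auto simp: flow_region_def)
      qed
    qed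
  qed
qed

lemma lyap_flow_le:
  assumes sol: "hybrid_solution H E \<phi>" and "a \<le> b" and sub: "{a..b} \<times> {j} \<subseteq> E"
  shows "lyap (\<phi> (b, j)) \<le> lyap (\<phi> (a, j))"
proof (cases "a = b")
  case False
  then have "a < b" using \<open>a \<le> b\<close> by simp
  obtain X \<omega> q where S: "\<And>t. t \<in> {a..b} \<Longrightarrow> \<phi> (t, j) = (X t, \<omega> t, q)" "\<And>h. q $ h \<in> Q"
    "\<And>t h. t \<in> {a..b} \<Longrightarrow> X t $ h \<in> flow_region h (q $ h)"
    "\<And>t. t \<in> {a..b} \<Longrightarrow> ((\<lambda>t. (X t, \<omega> t)) has_vector_derivative field q (X t, \<omega> t)) (at t within {a..b})"
    by (rule solution_segment[OF sol \<open>a < b\<close> sub]) blast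
  have "((\<lambda>t. - 2 * (norm (innov A u k (X t) q 1))\<^sup>2) has_integral
     (lyap (X b, \<omega> b, q) - lyap (X a, \<omega> a, q))) {a..b}"
    using S by (intro fundamental_theorem_of_calculus \<open>a \<le> b\<close> lyap_derivative) (auto simp: flow_region_def)
  then have "lyap (X b, \<omega> b, q) - lyap (X a, \<omega> a, q) \<le> 0"
    by (rule has_integral_le[OF _ has_integral_0]) simp
  then show ?thesis using S(1) \<open>a \<le> b\<close> by simp
qed simp

definition jump_drop :: real where "jump_drop = min (\<delta> 1) (\<delta> 2)"

lemma jump_drop_pos: "jump_drop > 0" using \<delta> by (simp add: jump_drop_def)

text \<open>Each potential falls by exactly its gap, as the new modes minimise. One index may
  trigger the jump alone; the other gap is only nonnegative, hence the minimum in
  \<open>jump_drop\<close>.\<close>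

lemma lyap_jump:
  assumes x: "x \<in> jump_set H" and y: "y \<in> jump_map H x"
  shows "y \<in> states" "lyap y \<le> lyap x - jump_drop"
proof -
  obtain X \<omega> q where x_eq: "x = (X, \<omega>, q)" by (cases x) auto
  have X: "\<And>h. X $ h \<in> SO3" "\<And>h. q $ h \<in> Q" and "\<exists>h. gap h (X $ h) (q $ h) \<ge> \<delta> h"
    using x by (auto simp: closed_loop_def x_eq)
  obtain q' where y_eq: "y = (X, \<omega>, q')"
    and q': "\<And>h. is_arg_min (U h (X $ h)) (\<lambda>p. p \<in> Q) (q' $ h)"
    using y by (cases y) (auto simp: closed_loop_def x_eq)
  have q'Q: "q' $ h \<in> Q" for h using q'[of h] by (simp add: is_arg_min_def)
  have "(MIN s\<in>Q. U h (X $ h) s) = U h (X $ h) (q' $ h)" for h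
    using q'[of h] finQ by (intro Min_eqI) (auto simp: is_arg_min_def not_less)
  then have drop: "U h (X $ h) (q' $ h) = U h (X $ h) (q $ h) - gap h (X $ h) (q $ h)" for h
    by (simp add: synergy_gap_def)
  show "y \<in> states" using X q'Q by (simp add: states_def y_eq)
  obtain h where "gap h (X $ h) (q $ h) \<ge> \<delta> h" using \<open>\<exists>h. _\<close> by blast
  then have "jump_drop \<le> gap 1 (X $ 1) (q $ 1) + gap 2 (X $ 2) (q $ 2)"
    using gap_nonneg[OF X(2), of 1 "X $ 1" 1] gap_nonneg[OF X(2), of 2 "X $ 2" 2] exhaust_2[of h]
    unfolding jump_drop_def by auto
  then show "lyap y \<le> lyap x - jump_drop"
    by (simp add: x_eq y_eq lyap_def sum_2 drop)
qed

text \<open>The summand \<open>real j * jump_drop\<close> accounts for the jumps made so far; as the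
  energy is nonnegative, it bounds their number.\<close>

lemma solution_invariant:
  assumes sol: "hybrid_solution H E \<phi>" and "(t, j) \<in> E"
  shows "\<phi> (t, j) \<in> states \<and> lyap (\<phi> (t, j)) + real j * jump_drop \<le> lyap (\<phi> (0, 0))"
proof -
  have dom: "hybrid_time_domain E" and init: "\<phi> (0, 0) \<in> states"
    and jump: "\<And>t j. (t, j) \<in> E \<Longrightarrow> (t, Suc j) \<in> E \<Longrightarrow>
        \<phi> (t, j) \<in> jump_set H \<and> \<phi> (t, Suc j) \<in> jump_map H (\<phi> (t, j))"
    using sol unfolding hybrid_solution_def flow_jump_states by auto
  show ?thesis
  proof (rule hybrid_time_domain_induct[OF dom assms(2)])
    show "\<phi> (0, 0) \<in> states \<and> lyap (\<phi> (0, 0)) + real 0 * jump_drop \<le> lyap (\<phi> (0, 0))"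
      using init by simp
  next
    fix s t j
    assume st: "s \<le> t" "{s..t} \<times> {j} \<subseteq> E"
      and IH: "\<phi> (s, j) \<in> states \<and> lyap (\<phi> (s, j)) + real j * jump_drop \<le> lyap (\<phi> (0, 0))"
    have "\<phi> (t, j) \<in> states"
    proof (cases "s = t")
      case False
      then have "s < t" using st(1) by simp
      show ?thesis
        by (rule solution_segment[OF sol \<open>s < t\<close> st(2)])
          (use st(1) in \<open>auto simp: states_def flow_region_def\<close>)
    qed (use IH in simp)
    then show "\<phi> (t, j) \<in> states \<and> lyap (\<phi> (t, j)) + real j * jump_drop \<le> lyap (\<phi> (0, 0))"
      using IH lyap_flow_le[OF sol st] by linarith
  next
    fix t j
    assume tj: "(t, j) \<in> E" "(t, Suc j) \<in> E"
      and IH: "\<phi> (t, j) \<in> states \<and> lyap (\<phi> (t, j)) + real j * jump_drop \<le> lyap (\<phi> (0, 0))"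
    show "\<phi> (t, Suc j) \<in> states \<and> lyap (\<phi> (t, Suc j)) + real (Suc j) * jump_drop \<le> lyap (\<phi> (0, 0))"
      using lyap_jump[of "\<phi> (t, j)" "\<phi> (t, Suc j)"] jump[OF tj] IH by (simp add: algebra_simps)
  qed
qed

section \<open>Comparison of energy with distance to the target; stability\<close>

lemma lyap_le:
  assumes "(X, \<omega>, q) \<in> states"
  shows "U h (X $ h) (q $ h) \<le> lyap (X, \<omega>, q)" "\<omega> \<bullet> (J *v \<omega>) \<le> 2 * lyap (X, \<omega>, q)" "0 \<le> lyap (X, \<omega>, q)"
proof -
  have "0 \<le> U 1 (X $ 1) (q $ 1)" "0 \<le> U 2 (X $ 2) (q $ 2)"
    using assms potential_mode(1) by (auto simp: states_def)
  moreover have "0 \<le> \<omega> \<bullet> (J *v \<omega>)"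
    using J by (cases "\<omega> = 0") (auto simp: pos_def_def less_imp_le)
  ultimately show "U h (X $ h) (q $ h) \<le> lyap (X, \<omega>, q)" "\<omega> \<bullet> (J *v \<omega>) \<le> 2 * lyap (X, \<omega>, q)" "0 \<le> lyap (X, \<omega>, q)"
    using exhaust_2[of h] by (auto simp: lyap_def sum_2)
qed

lemma infdist_target_le:
  assumes "(X, \<omega>, q) \<in> states"
  shows "infdist (X, \<omega>, q) (target_set Q) \<le> norm (X $ 1 - mat 1) + norm (X $ 2 - mat 1) + norm \<omega>"
proof -
  have "((\<chi> h. mat 1), 0, q) \<in> target_set Q"
    using assms by (simp add: target_set_def states_def)
  then have "infdist (X, \<omega>, q) (target_set Q) \<le> dist (X, \<omega>, q) ((\<chi> h. mat 1), 0, q)"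
    by (rule infdist_le)
  also have "\<dots> \<le> norm (X - (\<chi> h. mat 1)) + norm \<omega>"
    unfolding dist_norm using norm_Pair_le[of "X - (\<chi> h. mat 1)" "(\<omega>, 0::real^2)"] by (simp add: norm_Pair)
  also have "norm (X - (\<chi> h. mat 1)) \<le> norm (X $ 1 - mat 1) + norm (X $ 2 - mat 1)"
    using norm_pair_le[of "X - (\<chi> h. mat 1)"] by simp
  finally show ?thesis by simp
qed

text \<open>On the compact group a small potential forces closeness to the identity, its only zero,
  and coercivity of \<open>J\<close> bounds the velocity. The error \<open>e\<close> is shared
  equally by the two attitudes and the velocity.\<close>

lemma infdist_target_small:
  assumes "e > 0"
  obtains v where "v > 0" "\<And>x. x \<in> states \<Longrightarrow> lyap x \<le> v \<Longrightarrow> infdist x (target_set Q) \<le> e"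
proof -
  have "e / 3 > 0" using assms by simp
  obtain v1 where v1: "v1 > 0"
    "\<And>s. s \<in> UNIV \<times> Q \<Longrightarrow> \<forall>R\<in>SO3. U (fst s) R (snd s) < v1 \<longrightarrow> norm (R - mat 1) < e / 3"
  proof (rule finite_uniform_bound[of "UNIV \<times> Q :: (2 \<times> real) set"
        "\<lambda>s v. \<forall>R\<in>SO3. U (fst s) R (snd s) < v \<longrightarrow> norm (R - mat 1) < e / 3"])
    fix s :: "2 \<times> real" assume s: "s \<in> UNIV \<times> Q"
    then have p: "snd s \<in> Q" by auto
    have "continuous_on SO3 (\<lambda>R :: real^3^3. R - mat 1)" by (intro continuous_intros)
    from small_of_zeros_subset[OF compact_SO3 potential_mode(3)[OF p] this _ \<open>e / 3 > 0\<close>, of "fst s"]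
    obtain v where "v > 0" "\<forall>R\<in>SO3. norm (U (fst s) R (snd s)) < v \<longrightarrow> norm (R - mat 1) < e / 3"
      using potential_mode(2)[OF p] by auto
    then show "\<exists>v>0. \<forall>R\<in>SO3. U (fst s) R (snd s) < v \<longrightarrow> norm (R - mat 1) < e / 3"
      using potential_mode(1)[OF p] by (intro exI[of _ v]) auto
  qed (use finQ in auto)
  obtain c where c: "c > 0" "\<And>w. c * (norm w)\<^sup>2 \<le> w \<bullet> (J *v w)" by (rule pos_def_coercive[OF J]) blast
  \<comment> \<open>Halving \<open>v1\<close> gives the strict inequality required above; the second
    entry allows for kinetic energy being half the form of \<open>J\<close>.\<close>
  define v where "v = min (v1 / 2) (c * (e / 3)\<^sup>2 / 2)"
  show thesis
  proof (rule that)
    show "v > 0" using v1(1) c(1) assms by (simp add: v_def)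
    fix x assume x: "x \<in> states" "lyap x \<le> v"
    obtain X \<omega> q where x_eq: "x = (X, \<omega>, q)" by (cases x) auto
    note st = x(1)[unfolded x_eq]
    have "U h (X $ h) (q $ h) < v1" for h
      using lyap_le(1)[OF st, of h] x(2) v1(1) by (auto simp: v_def x_eq)
    then have X: "norm (X $ h - mat 1) < e / 3" for h
      using v1(2)[of "(h, q $ h)"] st by (auto simp: states_def)
    have "c * (norm \<omega>)\<^sup>2 \<le> c * (e / 3)\<^sup>2"
      using c(2)[of \<omega>] lyap_le(2)[OF st] x(2) by (auto simp: v_def x_eq)
    then have "norm \<omega> \<le> e / 3" using c(1) assms by (auto intro: power2_le_imp_le)
    then show "infdist x (target_set Q) \<le> e"
      using infdist_target_le[OF st] X[of 1] X[of 2] by (simp add: x_eq)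
  qed
qed

text \<open>Continuity of each potential at the identity and of the kinetic energy at 0. The budget
  is \<open>v / 4\<close> for each potential and \<open>v / 2\<close> for the kinetic
  energy.\<close>

lemma lyap_small:
  assumes "v > 0"
  obtains e where "e > 0" "\<And>x. x \<in> states \<Longrightarrow> infdist x (target_set Q) \<le> e \<Longrightarrow> lyap x \<le> v"
proof -
  obtain e1 where e1: "e1 > 0"
    "\<And>s. s \<in> UNIV \<times> Q \<Longrightarrow> \<forall>R\<in>SO3. norm (R - mat 1) < e1 \<longrightarrow> U (fst s) R (snd s) < v / 4"
  proof (rule finite_uniform_bound[of "UNIV \<times> Q :: (2 \<times> real) set"
        "\<lambda>s e. \<forall>R\<in>SO3. norm (R - mat 1) < e \<longrightarrow> U (fst s) R (snd s) < v / 4"])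
    fix s :: "2 \<times> real" assume s: "s \<in> UNIV \<times> Q"
    then have p: "snd s \<in> Q" by auto
    have "\<exists>d>0. \<forall>R\<in>SO3. dist R (mat 1) < d \<longrightarrow> dist (U (fst s) R (snd s)) (U (fst s) (mat 1) (snd s)) < v / 4"
      using potential_mode(3)[OF p, of "fst s"] assms unfolding continuous_on_iff
      by (metis mat_1_SO3 zero_less_divide_iff zero_less_numeral)
    then show "\<exists>d>0. \<forall>R\<in>SO3. norm (R - mat 1) < d \<longrightarrow> U (fst s) R (snd s) < v / 4"
      using potential_mode(2)[OF p mat_1_SO3] potential_mode(1)[OF p] by (auto simp: dist_norm)
  qed (use finQ in auto)
  have "isCont (\<lambda>w. w \<bullet> (J *v w)) 0"
    by (intro continuous_intros matrix_vector.isCont)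
  then obtain e2 where e2: "e2 > 0" "\<And>w. norm w < e2 \<Longrightarrow> \<bar>w \<bullet> (J *v w)\<bar> < v"
    using assms unfolding continuous_at_eps_delta by (auto simp: dist_norm)
  show thesis
  proof (rule that[of "min e1 e2 / 2"])
    show "min e1 e2 / 2 > 0" using e1 e2 by simp
    fix x assume x: "x \<in> states" "infdist x (target_set Q) \<le> min e1 e2 / 2"
    obtain X \<omega> q where x_eq: "x = (X, \<omega>, q)" by (cases x) auto
    note st = x(1)[unfolded x_eq]
    have "((\<chi> h. mat 1), 0, q) \<in> target_set Q"
      using st by (simp add: target_set_def states_def)
    then have ne: "target_set Q \<noteq> {}" by blast
    \<comment> \<open>The halved radius makes this strict, so a target point at distance below
      \<open>min e1 e2\<close> exists without the infimum being attained. Its mode may differ from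
      \<open>q\<close>; only the components \<open>X\<close> and \<open>\<omega>\<close> are
      compared.\<close>
    have "infdist x (target_set Q) < min e1 e2" using x(2) e1(1) e2(1) by linarith
    then have "Inf (dist x ` target_set Q) < min e1 e2" by (simp only: infdist_notempty[OF ne])
    then obtain y where y: "y \<in> target_set Q" "dist x y < min e1 e2"
      using cInf_lessD[of "dist x ` target_set Q"] ne by blast
    obtain q' where y_eq: "y = ((\<chi> h. mat 1), 0, q')"
      using y(1) by (cases y) (auto simp: target_set_def vec_eq_iff[where 'b=2])
    have d: "norm (X - (\<chi> h. mat 1)) \<le> dist x y" "norm \<omega> \<le> dist x y"
      using norm_fst_le[of "X - (\<chi> h. mat 1)" "(\<omega>, q - q')"]
        order_trans[OF norm_fst_le[of \<omega> "q - q'"] norm_snd_le[of "(\<omega>, q - q')" "X - (\<chi> h. mat 1)"]]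
      by (simp_all add: x_eq y_eq dist_norm)
    have "norm (X $ h - mat 1) < e1" for h
      using Finite_Cartesian_Product.norm_nth_le[of "X - (\<chi> h. mat 1)" h] d(1) y(2) by simp
    then have "U h (X $ h) (q $ h) < v / 4" for h
      using e1(2)[of "(h, q $ h)"] st by (auto simp: states_def)
    from this[of 1] this[of 2] show "lyap x \<le> v"
      using e2(2)[of \<omega>] d(2) y(2) by (auto simp: x_eq lyap_def sum_2)
  qed
qed

theorem stable: "stable_set H (target_set Q)"
  unfolding stable_set_def
proof (intro allI impI)
  fix e :: real assume "e > 0"
  obtain v where v: "v > 0" "\<And>x. x \<in> states \<Longrightarrow> lyap x \<le> v \<Longrightarrow> infdist x (target_set Q) \<le> e"
    by (rule infdist_target_small[OF \<open>e > 0\<close>]) blast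
  obtain d where d: "d > 0" "\<And>x. x \<in> states \<Longrightarrow> infdist x (target_set Q) \<le> d \<Longrightarrow> lyap x \<le> v"
    by (rule lyap_small[OF v(1)]) blast
  show "\<exists>\<eta>>0. \<forall>E \<phi>. hybrid_solution H E \<phi> \<and> infdist (\<phi> (0, 0)) (target_set Q) \<le> \<eta>
     \<longrightarrow> (\<forall>p\<in>E. infdist (\<phi> p) (target_set Q) \<le> e)"
  proof (intro exI[of _ d] conjI allI impI ballI; (elim conjE)?)
    fix E \<phi> p
    assume sol: "hybrid_solution H E \<phi>" and init: "infdist (\<phi> (0, 0)) (target_set Q) \<le> d" and p: "p \<in> E"
    obtain t j where [simp]: "p = (t, j)" by fastforce
    have "\<phi> (0, 0) \<in> states"
      using sol unfolding hybrid_solution_def flow_jump_states by blast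
    then have "lyap (\<phi> (0, 0)) \<le> v" using d(2) init by blast
    moreover have "0 \<le> real j * jump_drop" using jump_drop_pos by simp
    ultimately show "infdist (\<phi> p) (target_set Q) \<le> e"
      using solution_invariant[OF sol, of t j] p v(2)[of "\<phi> p"] by simp
  qed (rule d(1))
qed

end

subsection \<open>Completeness of maximal solutions\<close>

text \<open>The requirements of \<open>hybrid_solution\<close> on one interval, isolated so that a
  prolongation has to verify only the interval that it changes.\<close>

definition flows_on :: "'a::euclidean_space hybrid_system \<Rightarrow> real set \<Rightarrow> (real \<Rightarrow> 'a) \<Rightarrow> bool" where
  "flows_on H D f \<longleftrightarrow> locally_abs_continuous_on D f \<and> (\<forall>t \<in> interior D. f t \<in> flow_set H) \<and>
     (AE t in lebesgue. t \<in> D \<longrightarrow> (\<exists>v \<in> flow_map H (f t). (f has_vector_derivative v) (at t within D)))"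

lemma hybrid_solution_iff_flows_on:
  "hybrid_solution H E \<phi> \<longleftrightarrow> hybrid_time_domain E \<and> \<phi> (0, 0) \<in> flow_set H \<union> jump_set H \<and>
     (\<forall>j. flows_on H {t. (t, j) \<in> E} (\<lambda>t. \<phi> (t, j))) \<and>
     (\<forall>t j. (t, j) \<in> E \<and> (t, Suc j) \<in> E \<longrightarrow> \<phi> (t, j) \<in> jump_set H \<and> \<phi> (t, Suc j) \<in> jump_map H (\<phi> (t, j)))"
  by (simp add: hybrid_solution_def flows_on_def Let_def)

text \<open>The finite set \<open>Z\<close> admits a corner where two flows are glued; together with
  the end points it is a null set.\<close>

lemma flows_onI:
  assumes lip: "L-lipschitz_on {a..b} f" and "finite Z"
    and flow: "\<And>t. t \<in> {a<..<b} \<Longrightarrow> f t \<in> flow_set H"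
    and der: "\<And>t. t \<in> {a<..<b} - Z \<Longrightarrow> \<exists>v\<in>flow_map H (f t). (f has_vector_derivative v) (at t)"
  shows "flows_on H {a..b} f"
  unfolding flows_on_def
proof (intro conjI)
  show "locally_abs_continuous_on {a..b} f"
    unfolding locally_abs_continuous_on_def
    by (intro allI impI lipschitz_on_abs_continuous_on[OF lipschitz_on_subset[OF lip]]) auto
  show "\<forall>t\<in>interior {a..b}. f t \<in> flow_set H" using flow by simp
  have "t \<in> Z \<union> {a, b}"
    if "\<not> (t \<in> {a..b} \<longrightarrow> (\<exists>v\<in>flow_map H (f t). (f has_vector_derivative v) (at t within {a..b})))" for t
  proof (rule ccontr)
    assume "t \<notin> Z \<union> {a, b}"
    then have "t \<in> {a<..<b} - Z" using that by auto
    from der[OF this] show False using that has_vector_derivative_at_within by blast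
  qed
  moreover have "negligible (Z \<union> {a, b})" using \<open>finite Z\<close> by (simp add: negligible_finite)
  ultimately show "AE t in lebesgue. t \<in> {a..b} \<longrightarrow>
    (\<exists>v\<in>flow_map H (f t). (f has_vector_derivative v) (at t within {a..b}))"
    unfolding eventually_ae_filter_negligible by blast
qed

lemma flows_on_singleton: "flows_on H {a..a} f"
  by (rule flows_onI[where L = 0 and Z = "{}"]) (auto simp: lipschitz_on_def)

text \<open>Only the piece with index \<open>N\<close> grows; all earlier pieces and jumps are
  inherited, contradicting maximality.\<close>

lemma extend_last_interval:
  fixes \<tau> :: "nat \<Rightarrow> real"
  assumes sol: "hybrid_solution H E \<phi>" and \<tau>: "\<tau> 0 = 0" "incseq \<tau>"
    and E: "E = (\<Union>j<N. {\<tau> j..\<tau> (Suc j)} \<times> {j}) \<union> L \<times> {N}"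
    and L: "\<tau> N \<in> L" "L \<subset> {\<tau> N..b}"
    and g: "\<And>t. t \<in> L \<Longrightarrow> g t = \<phi> (t, N)" "flows_on H {\<tau> N..b} g"
  shows "\<not> maximal_solution H E \<phi>"
proof -
  define E' where "E' = (\<Union>j<N. {\<tau> j..\<tau> (Suc j)} \<times> {j}) \<union> {\<tau> N..b} \<times> {N}"
  define \<phi>' where "\<phi>' = (\<lambda>(t, j). if j = N then g t else \<phi> (t, j))"
  \<comment> \<open>Constant \<open>b\<close> beyond \<open>N\<close>, so that the last piece
    becomes a closed interval of the new time sequence.\<close>
  define \<tau>' where "\<tau>' j = (if j \<le> N then \<tau> j else b)" for j
  have memE: "(t, j) \<in> E \<longleftrightarrow> (j < N \<and> t \<in> {\<tau> j..\<tau> (Suc j)} \<or> j = N \<and> t \<in> L)" for t j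
    by (auto simp: E)
  have memE': "(t, j) \<in> E' \<longleftrightarrow> (j < N \<and> t \<in> {\<tau> j..\<tau> (Suc j)} \<or> j = N \<and> t \<in> {\<tau> N..b})" for t j
    by (auto simp: E'_def)
  have "\<tau> N \<le> b" using L by auto
  have sub: "E \<subset> E'"
    using L unfolding E E'_def by blast
  have agree: "\<forall>p\<in>E. \<phi>' p = \<phi> p"
    using g(1) by (auto simp: \<phi>'_def memE)
  have "hybrid_time_domain E'"
    unfolding hybrid_time_domain_def
  proof (rule exI[of _ \<tau>'], intro conjI;
      (rule disjI2, rule exI[of _ N], rule exI[of _ "{\<tau> N..b}"], intro conjI)?)
    show "\<tau>' 0 = 0" using \<tau>(1) by (simp add: \<tau>'_def)
    have "\<tau>' j \<le> \<tau>' (Suc j)" for j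
    proof (cases "Suc j \<le> N")
      case False
      then show ?thesis using \<open>\<tau> N \<le> b\<close> by (cases "j = N") (auto simp: \<tau>'_def)
    qed (use \<tau>(2) in \<open>auto simp: \<tau>'_def incseq_SucD\<close>)
    then show "incseq \<tau>'" by (rule incseq_SucI)
    show "{\<tau> N..b} \<noteq> {}" using \<open>\<tau> N \<le> b\<close> by simp
    show "{\<tau> N..b} = {\<tau>' N..\<tau>' (Suc N)} \<or> {\<tau> N..b} = {\<tau>' N..<\<tau>' (Suc N)} \<or> {\<tau> N..b} = {\<tau>' N..}"
      by (simp add: \<tau>'_def)
    show "E' = (\<Union>j<N. {\<tau>' j..\<tau>' (Suc j)} \<times> {j}) \<union> {\<tau> N..b} \<times> {N}"
      unfolding E'_def by (intro arg_cong2[where f = "(\<union>)"] SUP_cong refl) (auto simp: \<tau>'_def)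
  qed
  moreover have "\<phi>' (0, 0) \<in> flow_set H \<union> jump_set H"
  proof -
    have "(0, 0) \<in> E"
      using sol hybrid_time_domainE[of E] unfolding hybrid_solution_def by blast
    then show ?thesis using agree sol unfolding hybrid_solution_def by simp
  qed
  moreover have "flows_on H {t. (t, j) \<in> E'} (\<lambda>t. \<phi>' (t, j))" for j
  proof (cases "j = N")
    case True
    have "{t. (t, N) \<in> E'} = {\<tau> N..b}" by (auto simp: memE')
    then show ?thesis using g(2) True by (simp add: \<phi>'_def)
  next
    case False
    then have "{t. (t, j) \<in> E'} = {t. (t, j) \<in> E}" by (simp add: memE memE')
    then show ?thesis using False sol unfolding hybrid_solution_iff_flows_on by (simp add: \<phi>'_def)
  qed
  moreover have "\<phi>' (t, j) \<in> jump_set H \<and> \<phi>' (t, Suc j) \<in> jump_map H (\<phi>' (t, j))"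
    if "(t, j) \<in> E' \<and> (t, Suc j) \<in> E'" for t j
  proof -
    \<comment> \<open>A jump of the new domain into index \<open>N\<close> happens at
      \<open>\<tau> N\<close>, which already lies in \<open>L\<close>; no jump leaves index
      \<open>N\<close>.\<close>
    have "(t, j) \<in> E" "(t, Suc j) \<in> E"
      using that L(1) unfolding memE memE' by auto
    then show ?thesis
      using agree sol unfolding hybrid_solution_def by simp
  qed
  ultimately have "hybrid_solution H E' \<phi>'" unfolding hybrid_solution_iff_flows_on by blast
  then show ?thesis using sub agree unfolding maximal_solution_def by blast
qed

text \<open>A single instant is an admissible last piece, so appending one value of the jump map
  already enlarges the domain.\<close>

lemma extend_by_jump:
  fixes \<tau> :: "nat \<Rightarrow> real"
  assumes sol: "hybrid_solution H E \<phi>" and \<tau>: "\<tau> 0 = 0" "incseq \<tau>"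
    and E: "E = (\<Union>j<N. {\<tau> j..\<tau> (Suc j)} \<times> {j}) \<union> {\<tau> N..\<tau> (Suc N)} \<times> {N}"
    and jump: "\<phi> (\<tau> (Suc N), N) \<in> jump_set H" "y \<in> jump_map H (\<phi> (\<tau> (Suc N), N))"
  shows "\<not> maximal_solution H E \<phi>"
proof -
  define E' where "E' = (\<Union>j<Suc N. {\<tau> j..\<tau> (Suc j)} \<times> {j}) \<union> {\<tau> (Suc N)..\<tau> (Suc N)} \<times> {Suc N}"
  define \<phi>' where "\<phi>' = (\<lambda>(t, j). if j = Suc N then y else \<phi> (t, j))"
  define \<tau>' where "\<tau>' j = (if j \<le> Suc N then \<tau> j else \<tau> (Suc N))" for j
  have memE: "(t, j) \<in> E \<longleftrightarrow> (j \<le> N \<and> t \<in> {\<tau> j..\<tau> (Suc j)})" for t j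
    by (cases "j = N") (auto simp: E)
  have memE': "(t, j) \<in> E' \<longleftrightarrow> (j \<le> N \<and> t \<in> {\<tau> j..\<tau> (Suc j)} \<or> j = Suc N \<and> t = \<tau> (Suc N))" for t j
    by (auto simp: E'_def)
  have le: "\<tau> j \<le> \<tau> (Suc j)" for j using \<tau>(2) by (simp add: incseq_SucD)
  have "(\<tau> (Suc N), Suc N) \<in> E' - E" by (simp add: memE memE')
  moreover have "E \<subseteq> E'" by (auto simp: memE memE')
  ultimately have sub: "E \<subset> E'" by blast
  have agree: "\<forall>p\<in>E. \<phi>' p = \<phi> p"
    by (auto simp: \<phi>'_def memE)
  have "hybrid_time_domain E'"
    unfolding hybrid_time_domain_def
  proof (rule exI[of _ \<tau>'], intro conjI;
      (rule disjI2, rule exI[of _ "Suc N"], rule exI[of _ "{\<tau> (Suc N)..\<tau> (Suc N)}"], intro conjI)?)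
    show "\<tau>' 0 = 0" using \<tau>(1) by (simp add: \<tau>'_def)
    have "\<tau>' j \<le> \<tau>' (Suc j)" for j
      using le[of j] by (cases "j \<le> N") (auto simp: \<tau>'_def not_le le_Suc_eq)
    then show "incseq \<tau>'" by (rule incseq_SucI)
    show "{\<tau> (Suc N)..\<tau> (Suc N)} = {\<tau>' (Suc N)..\<tau>' (Suc (Suc N))} \<or>
      {\<tau> (Suc N)..\<tau> (Suc N)} = {\<tau>' (Suc N)..<\<tau>' (Suc (Suc N))} \<or> {\<tau> (Suc N)..\<tau> (Suc N)} = {\<tau>' (Suc N)..}"
      by (simp add: \<tau>'_def)
    show "E' = (\<Union>j<Suc N. {\<tau>' j..\<tau>' (Suc j)} \<times> {j}) \<union> {\<tau> (Suc N)..\<tau> (Suc N)} \<times> {Suc N}"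
      unfolding E'_def by (intro arg_cong2[where f = "(\<union>)"] SUP_cong refl) (auto simp: \<tau>'_def)
  qed simp
  moreover have "\<phi>' (0, 0) \<in> flow_set H \<union> jump_set H"
    using sol unfolding hybrid_solution_def by (simp add: \<phi>'_def)
  moreover have "flows_on H {t. (t, j) \<in> E'} (\<lambda>t. \<phi>' (t, j))" for j
  proof (cases "j = Suc N")
    case True
    then show ?thesis using flows_on_singleton[of H "\<tau> (Suc N)"] by (simp add: memE' \<phi>'_def)
  next
    case False
    then have "{t. (t, j) \<in> E'} = {t. (t, j) \<in> E}" by (simp add: memE memE')
    then show ?thesis using False sol unfolding hybrid_solution_iff_flows_on by (simp add: \<phi>'_def)
  qed
  moreover have "\<phi>' (t, j) \<in> jump_set H \<and> \<phi>' (t, Suc j) \<in> jump_map H (\<phi>' (t, j))"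
    if tj: "(t, j) \<in> E' \<and> (t, Suc j) \<in> E'" for t j
  proof (cases "j = N")
    case True
    then show ?thesis using tj jump by (simp add: memE' \<phi>'_def)
  next
    case False
    then have "(t, j) \<in> E" "(t, Suc j) \<in> E"
      using tj unfolding memE memE' by auto
    then show ?thesis
      using agree sol unfolding hybrid_solution_def by simp
  qed
  ultimately have "hybrid_solution H E' \<phi>'" unfolding hybrid_solution_iff_flows_on by blast
  then show ?thesis using sub agree unfolding maximal_solution_def by blast
qed

text \<open>With the skew factor on the right, the derivative of
  \<open>R s ** transpose (R s)\<close> cancels identically, so orthogonality persists. The
  determinant cannot pass from 1 to -1 without a zero, which orthogonality forbids.\<close>

lemma SO3_flow_invariant:
  fixes R :: "real \<Rightarrow> real^3^3"
  assumes der: "\<And>t. t \<in> {0..c} \<Longrightarrow> (R has_vector_derivative R t ** skew (w t)) (at t within {0..c})"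
    and "R 0 \<in> SO3" and t: "t \<in> {0..c}"
  shows "R t \<in> SO3"
proof -
  have orth: "R s ** transpose (R s) = mat 1" if "s \<in> {0..c}" for s
  proof -
    obtain C where C: "\<And>s. s \<in> {0..c} \<Longrightarrow> R s ** transpose (R s) = C"
    proof (rule has_vector_derivative_zero_constant[of "{0..c}" "\<lambda>s. R s ** transpose (R s)"])
      fix s assume s: "s \<in> {0..c}"
      have "R s ** transpose (R s ** skew (w s)) + R s ** skew (w s) ** transpose (R s) = 0"
        by (simp add: matrix_transpose_mul transpose_skew matrix_mult.minus_left matrix_mult.minus_right
            matrix_mul_assoc)
      then show "((\<lambda>s. R s ** transpose (R s)) has_vector_derivative 0) (at s within {0..c})"
        using matrix_mult.has_vector_derivative[OF der[OF s]
            bounded_linear.has_vector_derivative[OF bounded_linear_transpose der[OF s]]] by simp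
    qed auto
    have "0 \<in> {0..c}" using t by auto
    then show ?thesis using C[OF that] C[of 0] SO3_D(2)[OF \<open>R 0 \<in> SO3\<close>] by simp
  qed
  have cont: "continuous_on {0..t} R"
  proof (rule continuous_on_subset)
    show "continuous_on {0..c} R"
      using der has_vector_derivative_continuous continuous_on_eq_continuous_within by blast
  qed (use t in auto)
  have "orthogonal_matrix (R t)"
    using orth[OF t] by (simp add: orthogonal_matrix_def matrix_left_right_inverse)
  moreover have "det (R t) \<noteq> - 1"
  proof
    assume "det (R t) = - 1"
    then have "\<exists>s\<ge>0. s \<le> t \<and> det (R s) = 0"
      using t SO3_D(3)[OF \<open>R 0 \<in> SO3\<close>] by (intro IVT2' continuous_on_det3 cont) auto
    then obtain s where "0 \<le> s" "s \<le> t" "det (R s) = 0" by blast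
    then have s: "s \<in> {0..c}" "det (R s) = 0" using t by simp_all
    have "det (R s) * det (transpose (R s)) = 1"
      unfolding det_mul[symmetric] orth[OF s(1)] by simp
    then show False using s(2) by simp
  qed
  ultimately show ?thesis
    using det_orthogonal_matrix[of "R t"] by (auto simp: SO3_def rotation_matrix_def)
qed

section \<open>Speed bounds and local prolongation of the flow\<close>

context synergistic_loop
begin

lemma solution_derivative:
  assumes sol: "hybrid_solution H E \<phi>" and sub: "{a..b} \<times> {j} \<subseteq> E" and t: "t \<in> {a<..<b}"
  shows "\<phi> (t, j) \<in> flow_set H"
    "\<exists>v\<in>flow_map H (\<phi> (t, j)). ((\<lambda>t. \<phi> (t, j)) has_vector_derivative v) (at t)"
proof -
  have "a < b" using t by auto
  obtain X \<omega> q where S: "\<And>t. t \<in> {a..b} \<Longrightarrow> \<phi> (t, j) = (X t, \<omega> t, q)" "\<And>h. q $ h \<in> Q"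
    "\<And>t h. t \<in> {a..b} \<Longrightarrow> X t $ h \<in> flow_region h (q $ h)"
    "\<And>t. t \<in> {a..b} \<Longrightarrow> ((\<lambda>t. (X t, \<omega> t)) has_vector_derivative field q (X t, \<omega> t)) (at t within {a..b})"
    by (rule solution_segment[OF sol \<open>a < b\<close> sub]) blast
  have tab: "t \<in> {a..b}" using t by auto
  show "\<phi> (t, j) \<in> flow_set H"
    using S(2) S(3)[OF tab] unfolding S(1)[OF tab] by (simp add: closed_loop_def flow_region_def)
  have "((\<lambda>t. (X t, \<omega> t)) has_vector_derivative field q (X t, \<omega> t)) (at t)"
    using S(4)[OF tab] t by (simp add: at_within_Icc_at)
  from bounded_linear.has_vector_derivative[OF bounded_linear_fst this]
    bounded_linear.has_vector_derivative[OF bounded_linear_snd this]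
  have "((\<lambda>t. (X t, \<omega> t, q)) has_vector_derivative (fst (field q (X t, \<omega> t)), snd (field q (X t, \<omega> t)), 0)) (at t)"
    by (intro has_vector_derivative_Pair has_vector_derivative_const) simp_all
  then have "((\<lambda>t. \<phi> (t, j)) has_vector_derivative (fst (field q (X t, \<omega> t)), snd (field q (X t, \<omega> t)), 0)) (at t)"
    by (rule has_vector_derivative_transform_within_open[where S = "{a<..<b}"]) (use t S(1) in auto)
  then show "\<exists>v\<in>flow_map H (\<phi> (t, j)). ((\<lambda>t. \<phi> (t, j)) has_vector_derivative v) (at t)"
    unfolding S(1)[OF tab] by (intro bexI) (auto simp: flow_map_iff)
qed

lemma velocity_bound: "\<exists>B. \<forall>X \<omega> q. (X, \<omega>, q) \<in> states \<longrightarrow> lyap (X, \<omega>, q) \<le> v \<longrightarrow> norm \<omega> \<le> B"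
proof -
  obtain c where c: "c > 0" "\<And>w. c * (norm w)\<^sup>2 \<le> w \<bullet> (J *v w)" by (rule pos_def_coercive[OF J]) blast
  show ?thesis
  proof (intro exI[of _ "sqrt (2 * v / c)"] allI impI)
    fix X \<omega> q assume "(X, \<omega>, q) \<in> states" "lyap (X, \<omega>, q) \<le> v"
    then have "c * (norm \<omega>)\<^sup>2 \<le> 2 * v"
      using c(2)[of \<omega>] lyap_le(2)[of X \<omega> q] by linarith
    then have "(norm \<omega>)\<^sup>2 \<le> 2 * v / c" using c(1) by (simp add: field_simps)
    then show "norm \<omega> \<le> sqrt (2 * v / c)" by (rule real_le_rsqrt)
  qed
qed

lemma field_bound:
  "\<exists>M. \<forall>X \<omega> q. (X, \<omega>, q) \<in> states \<longrightarrow> norm \<omega> \<le> B \<longrightarrow> norm (field q (X, \<omega>)) \<le> M"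
proof -
  define F where "F = {q :: real^2. \<forall>h. q $ h \<in> Q}"
  define K where "K = {X :: (real^3^3)^2. \<forall>h. X $ h \<in> SO3} \<times> cball (0 :: real^3) B"
  have "F \<subseteq> (\<lambda>(a, b). vector [a, b]) ` (Q \<times> Q)"
  proof
    fix q assume "q \<in> F"
    then show "q \<in> (\<lambda>(a, b). vector [a, b]) ` (Q \<times> Q)"
      by (intro image_eqI[of _ _ "(q $ 1, q $ 2)"]) (auto simp: F_def vec_eq_iff forall_2)
  qed
  then have "finite F" by (rule finite_subset) (simp add: finQ)
  moreover have "bounded (field q ` K)" if "q \<in> F" for q
  proof (intro compact_imp_bounded compact_continuous_image)
    show "compact K" unfolding K_def by (intro compact_Times compact_vec_set compact_SO3 compact_cball)
    have q: "\<And>h. q $ h \<in> Q" using that by (simp add: F_def)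
    show "continuous_on K (field q)"
      by (rule continuous_on_subset[OF continuous_on_field[OF q]])
        (use SO3_regular_state[OF q] in \<open>auto simp: K_def\<close>)
  qed
  ultimately have "bounded (\<Union>q\<in>F. field q ` K)" by (rule bounded_UN[rule_format]) blast
  then obtain M where "\<forall>x \<in> (\<Union>q\<in>F. field q ` K). norm x \<le> M" unfolding bounded_iff by blast
  then show ?thesis
    by (intro exI[of _ M]) (auto simp: F_def K_def states_def)
qed

text \<open>The energy never exceeds its initial value, which bounds the velocity; the attitudes are
  compact and the modes finite, so the speed is bounded uniformly. This excludes finite escape and
  later makes the tail uniformly continuous.\<close>

lemma solution_lipschitz:
  assumes sol: "hybrid_solution H E \<phi>"
  shows "\<exists>M\<ge>0. \<forall>a b j. a \<le> b \<longrightarrow> {a..b} \<times> {j} \<subseteq> E \<longrightarrow> norm (\<phi> (b, j) - \<phi> (a, j)) \<le> M * (b - a)"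
proof -
  obtain B where B: "\<And>X \<omega> q. (X, \<omega>, q) \<in> states \<Longrightarrow> lyap (X, \<omega>, q) \<le> lyap (\<phi> (0, 0)) \<Longrightarrow> norm \<omega> \<le> B"
    using velocity_bound[of "lyap (\<phi> (0, 0))"] by blast
  obtain M where M: "\<And>X \<omega> q. (X, \<omega>, q) \<in> states \<Longrightarrow> norm \<omega> \<le> B \<Longrightarrow> norm (field q (X, \<omega>)) \<le> M"
    using field_bound[of B] by blast
  have "norm (\<phi> (b, j) - \<phi> (a, j)) \<le> max 0 M * (b - a)" if ab: "a \<le> b" "{a..b} \<times> {j} \<subseteq> E" for a b j
  proof (cases "a = b")
    case False
    then have "a < b" using ab(1) by simp
    obtain X \<omega> q where S: "\<And>t. t \<in> {a..b} \<Longrightarrow> \<phi> (t, j) = (X t, \<omega> t, q)" "\<And>h. q $ h \<in> Q"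
      "\<And>t h. t \<in> {a..b} \<Longrightarrow> X t $ h \<in> flow_region h (q $ h)"
      "\<And>t. t \<in> {a..b} \<Longrightarrow> ((\<lambda>t. (X t, \<omega> t)) has_vector_derivative field q (X t, \<omega> t)) (at t within {a..b})"
      by (rule solution_segment[OF sol \<open>a < b\<close> ab(2)]) blast
    have "norm (field q (X t, \<omega> t)) \<le> max 0 M" if t: "t \<in> {a..b}" for t
    proof -
      have "(t, j) \<in> E" using ab t by auto
      note inv = solution_invariant[OF sol this]
      have "0 \<le> real j * jump_drop" using jump_drop_pos by simp
      then have "\<phi> (t, j) \<in> states" "lyap (\<phi> (t, j)) \<le> lyap (\<phi> (0, 0))"
        using conjunct1[OF inv] conjunct2[OF inv] by linarith+
      then have "norm (field q (X t, \<omega> t)) \<le> M" unfolding S(1)[OF t] using B M by blast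
      then show ?thesis by simp
    qed
    moreover have "((\<lambda>t. field q (X t, \<omega> t)) has_integral (X b, \<omega> b) - (X a, \<omega> a)) {a..b}"
      by (intro fundamental_theorem_of_calculus ab(1) S(4))
    ultimately have "norm ((X b, \<omega> b) - (X a, \<omega> a)) \<le> max 0 M * measure lborel {a..b}"
      by (intro has_integral_bound_real[where S = "{}"]) auto
    then have "norm (X b - X a, \<omega> b - \<omega> a) \<le> max 0 M * (b - a)" using ab(1) by simp
    then show ?thesis using ab(1) by (simp add: S(1) norm_Pair)
  qed simp
  then show ?thesis by (intro exI[of _ "max 0 M"]) auto
qed

text \<open>Outside the jump set all gaps lie strictly below their thresholds. Peano gives a curve
  of matrices, \<open>SO3_flow_invariant\<close> makes them rotations, and continuity keeps the gaps
  below the thresholds for a short time.\<close>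

lemma local_flow_exists:
  assumes st: "(X0, \<omega>0, q) \<in> states" and "(X0, \<omega>0, q) \<notin> jump_set H"
  obtains c y where "c > 0" "y 0 = (X0, \<omega>0)"
    "\<And>t. t \<in> {0..c} \<Longrightarrow> (fst (y t), snd (y t), q) \<in> flow_set H"
    "\<And>t. t \<in> {0..c} \<Longrightarrow> (y has_vector_derivative field q (y t)) (at t within {0..c})"
proof -
  have q: "\<And>h. q $ h \<in> Q" and X0: "\<And>h. X0 $ h \<in> SO3" using st by (auto simp: states_def)
  have gap0: "gap h (X0 $ h) (q $ h) < \<delta> h" for h
    using assms by (auto simp: states_def closed_loop_def not_le)
  obtain r where r: "r > 0" "cball (X0, \<omega>0) r \<subseteq> regular q"
    using open_regular[of q, OF q] SO3_regular_state[OF q X0] open_contains_cball by blast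
  obtain c y where y: "c > 0" "y 0 = (X0, \<omega>0)" "\<And>t. t \<in> {0..c} \<Longrightarrow> y t \<in> cball (X0, \<omega>0) r"
    "\<And>t. t \<in> {0..c} \<Longrightarrow> (y has_vector_derivative field q (y t)) (at t within {0..c})"
    by (rule peano[OF r(1) continuous_on_subset[OF continuous_on_field[of q, OF q] r(2)]]) blast
  have SO3: "fst (y t) $ h \<in> SO3" if "t \<in> {0..c}" for t h
  proof (rule SO3_flow_invariant[OF _ _ that])
    fix s assume s: "s \<in> {0..c}"
    have "bounded_linear (\<lambda>x :: ((real^3^3)^2) \<times> (real^3). fst x $ h)"
      by (rule bounded_linear_compose[OF bounded_linear_vec_nth bounded_linear_fst])
    from bounded_linear.has_vector_derivative[OF this y(4)[OF s]]
    show "((\<lambda>s. fst (y s) $ h) has_vector_derivative fst (y s) $ h ** skew (frame_rate q (fst (y s)) (snd (y s)) h))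
      (at s within {0..c})"
      by (simp add: field_def case_prod_unfold)
  qed (simp add: y X0)
  have cont: "continuous_on {0..c} y"
    using y(4) has_vector_derivative_continuous continuous_on_eq_continuous_within by blast
  obtain d where d: "d > 0" "\<And>s. s \<in> UNIV \<times> Q \<Longrightarrow>
     \<forall>t\<in>{0..c}. t < d \<longrightarrow> U (fst s) (fst (y t) $ fst s) (q $ fst s) - \<delta> (fst s) < U (fst s) (fst (y t) $ fst s) (snd s)"
  proof (rule finite_uniform_bound[of "UNIV \<times> Q :: (2 \<times> real) set" "\<lambda>s d. \<forall>t\<in>{0..c}. t < d \<longrightarrow>
      U (fst s) (fst (y t) $ fst s) (q $ fst s) - \<delta> (fst s) < U (fst s) (fst (y t) $ fst s) (snd s)"])
    fix s :: "2 \<times> real" assume "s \<in> UNIV \<times> Q"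
    then obtain h p where s: "s = (h, p)" and p: "p \<in> Q" by auto
    define f where "f t = U h (fst (y t) $ h) p - (U h (fst (y t) $ h) (q $ h) - \<delta> h)" for t
    have U_cont: "continuous_on {0..c} (\<lambda>t. U h (fst (y t) $ h) p')" if "p' \<in> Q" for p'
      by (rule continuous_on_compose2[OF potential_mode(3)[OF that]])
        (use SO3 in \<open>auto intro!: continuous_intros cont\<close>)
    have "continuous_on {0..c} f" unfolding f_def by (intro continuous_intros U_cont p q)
    moreover have "f 0 > 0"
      using gap0[of h] p unfolding gap_less_iff[OF q] by (simp add: f_def y)
    ultimately obtain d where "d > 0" "\<forall>t\<in>{0..c}. dist t 0 < d \<longrightarrow> dist (f t) (f 0) < f 0"
      using y(1) unfolding continuous_on_iff by (metis atLeastAtMost_iff less_imp_le order_refl)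
    then have "d > 0" "\<forall>t\<in>{0..c}. t < d \<longrightarrow> f t > 0" by (auto simp: dist_real_def)
    then show "\<exists>d>0. \<forall>t\<in>{0..c}. t < d \<longrightarrow>
      U (fst s) (fst (y t) $ fst s) (q $ fst s) - \<delta> (fst s) < U (fst s) (fst (y t) $ fst s) (snd s)"
      by (intro exI[of _ d]) (auto simp: s f_def)
  qed (use finQ in auto)
  \<comment> \<open>Half of \<open>d\<close>, because the inequalities hold only for times strictly
    below \<open>d\<close>.\<close>
  define c' where "c' = min c (d / 2)"
  have c': "c' > 0" "{0..c'} \<subseteq> {0..c}" "\<And>t. t \<in> {0..c'} \<Longrightarrow> t < d"
    using y(1) d(1) by (auto simp: c'_def)
  show thesis
  proof (rule that[of c' y])
    show "c' > 0" "y 0 = (X0, \<omega>0)" by fact+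
    fix t assume t: "t \<in> {0..c'}"
    then have tc: "t \<in> {0..c}" using c'(2) by blast
    have "gap h (fst (y t) $ h) (q $ h) < \<delta> h" for h
      unfolding gap_less_iff[OF q] using d(2)[of "(h, _)"] tc c'(3)[OF t] by auto
    then show "(fst (y t), snd (y t), q) \<in> flow_set H"
      using SO3[OF tc] q by (auto simp: closed_loop_def less_imp_le)
    show "(y has_vector_derivative field q (y t)) (at t within {0..c'})"
      by (rule has_vector_derivative_within_subset[OF y(4)[OF tc] c'(2)])
  qed
qed

end

subsection \<open>Attractivity\<close>

lemma antimono_bounded_tendsto_at_top:
  fixes f :: "real \<Rightarrow> real"
  assumes mono: "\<And>s t. a \<le> s \<Longrightarrow> s \<le> t \<Longrightarrow> f t \<le> f s" and bound: "\<And>t. a \<le> t \<Longrightarrow> m \<le> f t"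
  obtains L where "(f \<longlongrightarrow> L) at_top"
proof
  define L where "L = Inf (f ` {a..})"
  have bdd: "bdd_below (f ` {a..})" using bound by (intro bdd_belowI[of _ m]) auto
  show "(f \<longlongrightarrow> L) at_top"
  proof (rule tendstoI)
    fix e :: real assume "e > 0"
    then have "Inf (f ` {a..}) < L + e" by (simp add: L_def)
    then obtain t0 where t0: "a \<le> t0" "f t0 < L + e"
      using cInf_lessD[of "f ` {a..}" "L + e"] by auto
    show "\<forall>\<^sub>F t in at_top. dist (f t) L < e"
      using eventually_ge_at_top[of t0]
    proof eventually_elim
      case (elim t)
      have "L \<le> f t" unfolding L_def using bdd elim t0(1) by (intro cInf_lower) auto
      then show ?case using mono[OF t0(1) elim] t0(2) by (simp add: dist_real_def)
    qed
  qed
qed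

lemma has_vector_derivative_bounded_lipschitz:
  fixes f :: "real \<Rightarrow> 'a::real_normed_vector"
  assumes "convex S" and "\<And>t. t \<in> S \<Longrightarrow> (f has_vector_derivative g t) (at t within S)"
    and M: "\<And>t. t \<in> S \<Longrightarrow> norm (g t) \<le> M" "0 \<le> M"
  shows "M-lipschitz_on S f"
proof (rule bounded_derivative_imp_lipschitz)
  show "(f has_derivative (\<lambda>h. h *\<^sub>R g t)) (at t within S)" if "t \<in> S" for t
    using assms(2)[OF that] by (simp add: has_vector_derivative_def)
  show "onorm (\<lambda>h. h *\<^sub>R g t) \<le> M" if "t \<in> S" for t
    using M(1)[OF that] by (intro onorm_bound M(2)) (simp add: mult.commute[of _ "norm (g t)"] mult_right_mono)
qed (use assms in auto)

context synergistic_loop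
begin

lemma jump_map_nonempty:
  assumes "x \<in> states" obtains y where "y \<in> jump_map H x"
proof -
  obtain X \<omega> q where x: "x = (X, \<omega>, q)" by (cases x) auto
  have "Q \<noteq> {}" using assms by (auto simp: x states_def)
  then have "\<exists>p. is_arg_min (U h (X $ h)) (\<lambda>p. p \<in> Q) p" for h
    using ex_is_arg_min_if_finite[OF finQ] by blast
  then obtain p where "\<And>h. is_arg_min (U h (X $ h)) (\<lambda>p. p \<in> Q) (p h)" by metis
  then have "(X, \<omega>, \<chi> h. p h) \<in> jump_map H x" by (simp add: x closed_loop_def)
  then show thesis by (rule that)
qed

text \<open>The Lipschitz bound provides a limit at the missing end point. Flow-set membership is
  demanded only in the interior, so adding the limit gives a longer solution.\<close>

lemma not_maximal_half_open:
  fixes \<tau> :: "nat \<Rightarrow> real"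
  assumes sol: "hybrid_solution H E \<phi>" and \<tau>: "\<tau> 0 = 0" "incseq \<tau>"
    and E: "E = (\<Union>j<N. {\<tau> j..\<tau> (Suc j)} \<times> {j}) \<union> {\<tau> N..<b} \<times> {N}" and b: "\<tau> N < b"
  shows "\<not> maximal_solution H E \<phi>"
proof -
  obtain M where M: "M \<ge> 0"
    "\<And>a b j. a \<le> b \<Longrightarrow> {a..b} \<times> {j} \<subseteq> E \<Longrightarrow> norm (\<phi> (b, j) - \<phi> (a, j)) \<le> M * (b - a)"
    using solution_lipschitz[OF sol] by blast
  have sub: "{s..t} \<times> {N} \<subseteq> E" if "\<tau> N \<le> s" "t < b" for s t
    using that by (auto simp: E)
  have "M-lipschitz_on {\<tau> N..<b} (\<lambda>t. \<phi> (t, N))"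
  proof (rule lipschitz_on_leI[OF _ M(1)])
    fix s t assume "s \<in> {\<tau> N..<b}" "t \<in> {\<tau> N..<b}" "s \<le> t"
    then show "dist (\<phi> (s, N)) (\<phi> (t, N)) \<le> M * dist s t"
      using M(2)[OF _ sub, of s t] by (simp add: dist_norm norm_minus_commute)
  qed
  from lipschitz_extend_closure[OF this] obtain g where g: "M-lipschitz_on {\<tau> N..b} g"
    "\<And>t. t \<in> {\<tau> N..<b} \<Longrightarrow> g t = \<phi> (t, N)" using b by auto
  have "flows_on H {\<tau> N..b} g"
  proof (rule flows_onI[OF g(1) finite.emptyI])
    have eq: "g t = \<phi> (t, N)" if "t \<in> {\<tau> N<..<b}" for t using g(2) that by auto
    have seg: "\<exists>b'. t \<in> {\<tau> N<..<b'} \<and> {\<tau> N..b'} \<times> {N} \<subseteq> E" if "t \<in> {\<tau> N<..<b}" for t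
      using that sub[of "\<tau> N" "(t + b) / 2"] by (intro exI[of _ "(t + b) / 2"]) auto
    fix t
    show "g t \<in> flow_set H" if t: "t \<in> {\<tau> N<..<b}"
      using seg[OF t] solution_derivative(1)[OF sol] unfolding eq[OF t] by blast
    assume "t \<in> {\<tau> N<..<b} - {}"
    then have t: "t \<in> {\<tau> N<..<b}" by simp
    obtain v where v: "v \<in> flow_map H (g t)" "((\<lambda>t. \<phi> (t, N)) has_vector_derivative v) (at t)"
      using seg[OF t] solution_derivative(2)[OF sol] unfolding eq[OF t] by blast
    have "(g has_vector_derivative v) (at t)"
      by (rule has_vector_derivative_transform_within_open[OF v(2), where S = "{\<tau> N<..<b}"])
        (use t eq in auto)
    then show "\<exists>v\<in>flow_map H (g t). (g has_vector_derivative v) (at t)" using v(1) by blast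
  qed
  then show ?thesis
    by (rule extend_last_interval[OF sol \<tau> E, rotated 3]) (use b g(2) in auto)
qed

text \<open>A final state in the jump set has a successor, since a finite nonempty \<open>Q\<close>
  has minimising modes; any other final state can flow on.\<close>

lemma not_maximal_closed:
  fixes \<tau> :: "nat \<Rightarrow> real"
  assumes sol: "hybrid_solution H E \<phi>" and \<tau>: "\<tau> 0 = 0" "incseq \<tau>"
    and E: "E = (\<Union>j<N. {\<tau> j..\<tau> (Suc j)} \<times> {j}) \<union> {\<tau> N..\<tau> (Suc N)} \<times> {N}"
  shows "\<not> maximal_solution H E \<phi>"
proof (cases "\<phi> (\<tau> (Suc N), N) \<in> jump_set H")
  case True
  then have "\<phi> (\<tau> (Suc N), N) \<in> states" using flow_jump_states by blast
  then obtain y where "y \<in> jump_map H (\<phi> (\<tau> (Suc N), N))" by (rule jump_map_nonempty)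
  then show ?thesis by (rule extend_by_jump[OF sol \<tau> E True])
next
  case False
  define b where "b = \<tau> (Suc N)"
  have Nb: "\<tau> N \<le> b" using \<tau>(2) by (simp add: b_def incseq_SucD)
  have "(b, N) \<in> E" using Nb by (auto simp: E b_def)
  then have st: "\<phi> (b, N) \<in> states" using solution_invariant[OF sol] by blast
  obtain X0 \<omega>0 q where x0: "\<phi> (b, N) = (X0, \<omega>0, q)" by (cases "\<phi> (b, N)") auto
  obtain c y where y: "c > 0" "y 0 = (X0, \<omega>0)"
    "\<And>t. t \<in> {0..c} \<Longrightarrow> (fst (y t), snd (y t), q) \<in> flow_set H"
    "\<And>t. t \<in> {0..c} \<Longrightarrow> (y has_vector_derivative field q (y t)) (at t within {0..c})"
    by (rule local_flow_exists[of X0 \<omega>0 q]) (use st False in \<open>auto simp: x0[symmetric] b_def\<close>)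
  define z where "z t = (fst (y t), snd (y t), q)" for t
  define z' where "z' t = (fst (field q (y t)), snd (field q (y t)), 0 :: real^2)" for t
  have dz: "(z has_vector_derivative z' t) (at t within {0..c})" if "t \<in> {0..c}" for t
    unfolding z_def[abs_def] z'_def
    by (intro has_vector_derivative_Pair has_vector_derivative_const
        bounded_linear.has_vector_derivative[OF bounded_linear_fst]
        bounded_linear.has_vector_derivative[OF bounded_linear_snd] y(4) that)
  obtain M2 where M2: "M2-lipschitz_on {0..c} z"
  proof -
    have q: "\<And>h. q $ h \<in> Q" using st by (auto simp: x0 states_def)
    have cont: "continuous_on {0..c} y"
      using y(4) has_vector_derivative_continuous continuous_on_eq_continuous_within by blast
    have "y t \<in> regular q" if "t \<in> {0..c}" for t
      using SO3_regular_state[OF q, of "fst (y t)" "snd (y t)"] y(3)[OF that] by (auto simp: closed_loop_def)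
    then have "continuous_on {0..c} (\<lambda>t. field q (y t))"
      by (intro continuous_on_compose2[OF continuous_on_field[OF q] cont]) auto
    then have "continuous_on {0..c} z'" unfolding z'_def[abs_def] by (intro continuous_intros)
    then have "bounded (z' ` {0..c})" by (intro compact_imp_bounded compact_continuous_image) auto
    then obtain M where "M > 0" "\<forall>x\<in>z' ` {0..c}. norm x \<le> M" unfolding bounded_pos by blast
    then show thesis
      by (intro that[of M] has_vector_derivative_bounded_lipschitz[OF _ dz]) auto
  qed
  obtain M where M: "M \<ge> 0"
    "\<And>a b j. a \<le> b \<Longrightarrow> {a..b} \<times> {j} \<subseteq> E \<Longrightarrow> norm (\<phi> (b, j) - \<phi> (a, j)) \<le> M * (b - a)"
    using solution_lipschitz[OF sol] by blast
  have sub: "{s..t} \<times> {N} \<subseteq> E" if "\<tau> N \<le> s" "t \<le> b" for s t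
    using that by (auto simp: E b_def)
  have lip1: "M-lipschitz_on {\<tau> N..b} (\<lambda>t. \<phi> (t, N))"
  proof (rule lipschitz_on_leI[OF _ M(1)])
    fix s t assume "s \<in> {\<tau> N..b}" "t \<in> {\<tau> N..b}" "s \<le> t"
    then show "dist (\<phi> (s, N)) (\<phi> (t, N)) \<le> M * dist s t"
      using M(2)[OF _ sub, of s t] by (simp add: dist_norm norm_minus_commute)
  qed
  have lip2: "M2-lipschitz_on {b..b + c} (\<lambda>t. z (t - b))"
  proof (rule lipschitz_onI)
    fix s t assume "s \<in> {b..b + c}" "t \<in> {b..b + c}"
    then show "dist (z (s - b)) (z (t - b)) \<le> M2 * dist s t"
      using lipschitz_onD[OF M2, of "s - b" "t - b"] by (simp add: dist_norm)
  qed (rule lipschitz_on_nonneg[OF M2])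
  define g where "g t = (if t \<le> b then \<phi> (t, N) else z (t - b))" for t
  have lip: "(max M M2)-lipschitz_on {\<tau> N..b + c} g"
    unfolding g_def
    by (rule lipschitz_on_concat_max[OF lip1 lip2]) (simp add: z_def y x0)
  \<comment> \<open>The derivative is not examined at the gluing point \<open>b\<close>, which is
    the exceptional set passed to \<open>flows_onI\<close>.\<close>
  have "flows_on H {\<tau> N..b + c} g"
  proof (rule flows_onI[OF lip, of "{b}"])
    fix t assume t: "t \<in> {\<tau> N<..<b + c}"
    show "g t \<in> flow_set H"
    proof (cases "t < b")
      case True
      then show ?thesis using solution_derivative(1)[OF sol sub[of "\<tau> N" b], of t] t by (simp add: g_def)
    next
      case False
      then show ?thesis using y(2) y(3)[of "t - b"] t by (cases "t = b") (auto simp: g_def z_def x0)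
    qed
  next
    fix t assume t: "t \<in> {\<tau> N<..<b + c} - {b}"
    show "\<exists>v\<in>flow_map H (g t). (g has_vector_derivative v) (at t)"
    proof (cases "t < b")
      case True
      then have tb: "t \<in> {\<tau> N<..<b}" using t by simp
      have eq: "g t = \<phi> (t, N)" using True by (simp add: g_def)
      obtain v where v: "v \<in> flow_map H (g t)" "((\<lambda>t. \<phi> (t, N)) has_vector_derivative v) (at t)"
        using solution_derivative(2)[OF sol sub tb] unfolding eq by blast
      have "(g has_vector_derivative v) (at t)"
        by (rule has_vector_derivative_transform_within_open[OF v(2), where S = "{\<tau> N<..<b}"])
          (use tb in \<open>auto simp: g_def\<close>)
      then show ?thesis using v(1) by blast
    next
      case False
      then have tb: "t \<in> {b<..<b + c}" using t by simp
      then have "(z has_vector_derivative z' (t - b)) (at (t - b))"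
        using dz[of "t - b"] by (simp add: at_within_Icc_at)
      moreover have "((\<lambda>t. t - b) has_vector_derivative 1) (at t)"
        by (auto intro!: derivative_eq_intros)
      ultimately have "((\<lambda>t. z (t - b)) has_vector_derivative z' (t - b)) (at t)"
        using vector_diff_chain_at[of "\<lambda>t. t - b" 1 t z "z' (t - b)"] by (simp add: o_def)
      then have "(g has_vector_derivative z' (t - b)) (at t)"
        by (rule has_vector_derivative_transform_within_open[where S = "{b<..<b + c}"])
          (use tb in \<open>auto simp: g_def\<close>)
      moreover have "z' (t - b) \<in> flow_map H (g t)"
        using tb by (simp add: g_def z_def z'_def flow_map_iff)
      ultimately show ?thesis by blast
    qed
  qed simp
  then show ?thesis
    by (rule extend_last_interval[OF sol \<tau> E, rotated 3])
      (use Nb y(1) in \<open>auto simp: g_def b_def[symmetric]\<close>)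
qed

text \<open>Of the four shapes of a domain, infinitely many jumps contradict the energy budget, and
  the two bounded last intervals can be prolonged; only an unbounded last interval remains.\<close>

lemma maximal_solution_domain:
  assumes max: "maximal_solution H E \<phi>"
  obtains a N where "{a..} \<times> {N} \<subseteq> E" "\<And>t j. (t, j) \<in> E \<Longrightarrow> j < N \<Longrightarrow> t \<le> a"
    "\<And>t j. (t, j) \<in> E \<Longrightarrow> j \<le> N"
proof -
  have sol: "hybrid_solution H E \<phi>" using max by (simp add: maximal_solution_def)
  obtain \<tau> :: "nat \<Rightarrow> real" where \<tau>: "\<tau> 0 = 0" "incseq \<tau>"
    and E: "E = (\<Union>j. {\<tau> j..\<tau> (Suc j)} \<times> {j}) \<or>
      (\<exists>N L. L \<noteq> {} \<and> (L = {\<tau> N..\<tau> (Suc N)} \<or> L = {\<tau> N..<\<tau> (Suc N)} \<or> L = {\<tau> N..}) \<and>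
         E = (\<Union>j<N. {\<tau> j..\<tau> (Suc j)} \<times> {j}) \<union> L \<times> {N})"
    using sol[unfolded hybrid_solution_def hybrid_time_domain_def] by (elim exE conjE)
  show thesis
    using E
  proof (elim disjE exE conjE)
    assume E: "E = (\<Union>j. {\<tau> j..\<tau> (Suc j)} \<times> {j})"
    define V where "V = lyap (\<phi> (0, 0))"
    \<comment> \<open>More jumps than the initial energy can pay for, at a cost of
      \<open>jump_drop\<close> each.\<close>
    obtain j :: nat where j: "V / jump_drop < real j" using reals_Archimedean2 by blast
    have "(\<tau> j, j) \<in> E" using \<tau>(2) by (auto simp: E incseq_SucD)
    from solution_invariant[OF sol this] have "\<phi> (\<tau> j, j) \<in> states" "lyap (\<phi> (\<tau> j, j)) + real j * jump_drop \<le> V"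
      by (auto simp: V_def)
    moreover from this(1) have "0 \<le> lyap (\<phi> (\<tau> j, j))" by (cases "\<phi> (\<tau> j, j)") (auto intro: lyap_le)
    ultimately have "real j * jump_drop \<le> V" by linarith
    then show thesis using j jump_drop_pos by (simp add: field_simps)
  next
    fix N L assume "L = {\<tau> N..\<tau> (Suc N)}" "E = (\<Union>j<N. {\<tau> j..\<tau> (Suc j)} \<times> {j}) \<union> L \<times> {N}"
    then show thesis using not_maximal_closed[OF sol \<tau>] max by blast
  next
    fix N L assume "L \<noteq> {}" "L = {\<tau> N..<\<tau> (Suc N)}" "E = (\<Union>j<N. {\<tau> j..\<tau> (Suc j)} \<times> {j}) \<union> L \<times> {N}"
    then show thesis using not_maximal_half_open[OF sol \<tau>, of N "\<tau> (Suc N)"] max by auto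
  next
    fix N L assume L: "L = {\<tau> N..}" and E: "E = (\<Union>j<N. {\<tau> j..\<tau> (Suc j)} \<times> {j}) \<union> L \<times> {N}"
    have "\<tau> (Suc j) \<le> \<tau> N" if "j < N" for j
      by (rule incseqD[OF \<tau>(2)]) (use that in simp)
    then show thesis
      by (intro that[of "\<tau> N" N]) (use L in \<open>auto simp: E intro: order_trans\<close>)
  qed
qed

lemma ref_attitude_SO3: "(\<And>h. X $ h \<in> SO3) \<Longrightarrow> ref_attitude Rd X $ h \<in> SO3"
  by (auto simp: ref_attitude_def intro!: SO3_mult transpose_SO3 Rd)

text \<open>\<open>X\<close>, \<open>\<omega>\<close> and \<open>q\<close> are read off
  \<open>\<phi>\<close> itself, so the decompositions obtained on different bounded segments agree
  and form one on the whole half-line.\<close>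

lemma solution_tail:
  assumes sol: "hybrid_solution H E \<phi>" and sub: "{a..} \<times> {N} \<subseteq> E"
  obtains X \<omega> q where "\<And>t. a \<le> t \<Longrightarrow> \<phi> (t, N) = (X t, \<omega> t, q)" "\<And>h. q $ h \<in> Q"
    "\<And>t h. a \<le> t \<Longrightarrow> X t $ h \<in> flow_region h (q $ h)"
    "\<And>s b t. a \<le> s \<Longrightarrow> t \<in> {s..b} \<Longrightarrow>
      ((\<lambda>t. (X t, \<omega> t)) has_vector_derivative field q (X t, \<omega> t)) (at t within {s..b})"
proof -
  define X where "X t = fst (\<phi> (t, N))" for t
  define \<omega> where "\<omega> t = fst (snd (\<phi> (t, N)))" for t
  define q where "q = snd (snd (\<phi> (a, N)))"
  have seg: "(\<forall>t\<in>{a..b}. \<phi> (t, N) = (X t, \<omega> t, q)) \<and> (\<forall>h. q $ h \<in> Q) \<and>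
    (\<forall>t\<in>{a..b}. \<forall>h. X t $ h \<in> flow_region h (q $ h)) \<and>
    (\<forall>t\<in>{a..b}. ((\<lambda>t. (X t, \<omega> t)) has_vector_derivative field q (X t, \<omega> t)) (at t within {a..b}))"
    if "a < b" for b
  proof -
    have "{a..b} \<times> {N} \<subseteq> E" using sub by auto
    from solution_segment[OF sol \<open>a < b\<close> this] obtain X' \<omega>' q' where
      S: "\<And>t. t \<in> {a..b} \<Longrightarrow> \<phi> (t, N) = (X' t, \<omega>' t, q')" "\<And>h. q' $ h \<in> Q"
      "\<And>t h. t \<in> {a..b} \<Longrightarrow> X' t $ h \<in> flow_region h (q' $ h)"
      "\<And>t. t \<in> {a..b} \<Longrightarrow> ((\<lambda>t. (X' t, \<omega>' t)) has_vector_derivative field q' (X' t, \<omega>' t)) (at t within {a..b})"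
      by blast
    have q: "q = q'" using S(1)[of a] \<open>a < b\<close> by (simp add: q_def)
    have eq: "X t = X' t" "\<omega> t = \<omega>' t" if "t \<in> {a..b}" for t
      using S(1)[OF that] by (simp_all add: X_def \<omega>_def)
    have "((\<lambda>t. (X t, \<omega> t)) has_vector_derivative field q (X t, \<omega> t)) (at t within {a..b})"
      if t: "t \<in> {a..b}" for t
      unfolding eq[OF t] q
      by (rule has_vector_derivative_transform[OF t _ S(4)[OF t]]) (simp add: eq)
    then show ?thesis using S(1-3) eq q by auto
  qed
  show thesis
  proof (rule that[of X \<omega> q])
    fix t assume "a \<le> t"
    then show "\<phi> (t, N) = (X t, \<omega> t, q)" "X t $ h \<in> flow_region h (q $ h)" for h
      using seg[of "t + 1"] by auto
  next
    fix h show "q $ h \<in> Q" using seg[of "a + 1"] by auto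
  next
    fix s b t assume st: "a \<le> s" "t \<in> {s..b}"
    \<comment> \<open>Enlarging to \<open>b + 1\<close> keeps the segment nondegenerate even if
      \<open>a = b\<close>.\<close>
    have "((\<lambda>t. (X t, \<omega> t)) has_vector_derivative field q (X t, \<omega> t)) (at t within {a..b + 1})"
      using seg[of "b + 1"] st by auto
    then show "((\<lambda>t. (X t, \<omega> t)) has_vector_derivative field q (X t, \<omega> t)) (at t within {s..b})"
      by (rule has_vector_derivative_within_subset) (use st in auto)
  qed
qed

text \<open>A chain of three applications of Barbalat's lemma: \<open>lyap\<close> converges, so \<open>innov\<^sub>1 \<longrightarrow> 0\<close> and, by
  synergy, \<open>X\<^sub>1 \<longrightarrow> I\<close>; hence the rate of \<open>X\<^sub>1\<close> vanishes and \<open>\<omega> \<longrightarrow> 0\<close>; hence the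
  torque vanishes, so \<open>innov\<^sub>2 \<longrightarrow> 0\<close> and \<open>X\<^sub>2 \<longrightarrow> I\<close>.\<close>

lemma tail_converges:
  assumes sol: "hybrid_solution H E \<phi>" and sub: "{a..} \<times> {N} \<subseteq> E"
  shows "((\<lambda>t. infdist (\<phi> (t, N)) (target_set Q)) \<longlongrightarrow> 0) at_top"
proof -
  obtain X \<omega> q where \<phi>: "\<And>t. a \<le> t \<Longrightarrow> \<phi> (t, N) = (X t, \<omega> t, q)" and q: "\<And>h. q $ h \<in> Q"
    and reg: "\<And>t h. a \<le> t \<Longrightarrow> X t $ h \<in> flow_region h (q $ h)"
    and der: "\<And>s b t. a \<le> s \<Longrightarrow> t \<in> {s..b} \<Longrightarrow>
      ((\<lambda>t. (X t, \<omega> t)) has_vector_derivative field q (X t, \<omega> t)) (at t within {s..b})"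
    by (rule solution_tail[OF sol sub]) blast
  have XSO3: "X t $ h \<in> SO3" if "a \<le> t" for t h using reg[OF that] by (simp add: flow_region_def)
  define z where "z t = (X t, \<omega> t)" for t
  have inv: "\<phi> (t, N) \<in> states" "lyap (\<phi> (t, N)) \<le> lyap (\<phi> (0, 0))" if "a \<le> t" for t
  proof -
    have "(t, N) \<in> E" using sub that by auto
    note inv = solution_invariant[OF sol this]
    have "0 \<le> real N * jump_drop" using jump_drop_pos by simp
    then show "\<phi> (t, N) \<in> states" "lyap (\<phi> (t, N)) \<le> lyap (\<phi> (0, 0))"
      using conjunct1[OF inv] conjunct2[OF inv] by linarith+
  qed
  obtain B where B: "\<And>X \<omega> q. (X, \<omega>, q) \<in> states \<Longrightarrow> lyap (X, \<omega>, q) \<le> lyap (\<phi> (0, 0)) \<Longrightarrow> norm \<omega> \<le> B"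
    using velocity_bound[of "lyap (\<phi> (0, 0))"] by blast
  \<comment> \<open>A compact set that contains the tail and lies inside \<open>regular q\<close>:
    it serves both the zero-set arguments and uniform continuity.\<close>
  define K where "K = {X :: (real^3^3)^2. \<forall>h. X $ h \<in> flow_region h (q $ h)} \<times> cball (0 :: real^3) B"
  have K: "compact K" unfolding K_def by (intro compact_Times compact_vec_set compact_flow_region q compact_cball)
  have zK: "z t \<in> K" if "a \<le> t" for t
    using reg[OF that] inv[OF that] B[of "X t" "\<omega> t" q] by (simp add: K_def z_def \<phi>[OF that])
  have evK: "\<forall>\<^sub>F t in at_top. z t \<in> K"
    using eventually_ge_at_top[of a] by eventually_elim (rule zK)
  have K_regular: "K \<subseteq> regular q"
    using SO3_regular_state[OF q] by (auto simp: K_def flow_region_def)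
  obtain M where M: "M \<ge> 0"
    "\<And>a b j. a \<le> b \<Longrightarrow> {a..b} \<times> {j} \<subseteq> E \<Longrightarrow> norm (\<phi> (b, j) - \<phi> (a, j)) \<le> M * (b - a)"
    using solution_lipschitz[OF sol] by blast
  have lip: "M-lipschitz_on {a..} z"
  proof (rule lipschitz_on_leI[OF _ M(1)])
    fix s t assume st: "s \<in> {a..}" "t \<in> {a..}" "s \<le> t"
    then have "{s..t} \<times> {N} \<subseteq> E" using sub by auto
    then have "norm (\<phi> (t, N) - \<phi> (s, N)) \<le> M * (t - s)" using M(2) st(3) by blast
    then show "dist (z s) (z t) \<le> M * dist s t"
      using st by (simp add: \<phi> z_def dist_norm norm_Pair norm_minus_commute)
  qed
  \<comment> \<open>Continuous on a compact set after a Lipschitz curve: this meets the last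
    hypothesis of Barbalat's lemma for every rate used below.\<close>
  have uc: "uniformly_continuous_on {a..} (\<lambda>t. G (z t))" if G: "continuous_on K G" for G :: "_ \<Rightarrow> 'b::metric_space"
    unfolding uniformly_continuous_on_def
  proof (intro allI impI)
    fix e :: real assume "e > 0"
    then obtain d where d: "d > 0" "\<And>x y. x \<in> K \<Longrightarrow> y \<in> K \<Longrightarrow> dist y x < d \<Longrightarrow> dist (G y) (G x) < e"
      using compact_uniformly_continuous[OF G K] unfolding uniformly_continuous_on_def by blast
    obtain d' where "d' > 0" "\<forall>s\<in>{a..}. \<forall>t\<in>{a..}. dist t s < d' \<longrightarrow> dist (z t) (z s) < d"
      using lipschitz_on_uniformly_continuous[OF lip] d(1) unfolding uniformly_continuous_on_def by blast
    then show "\<exists>d>0. \<forall>s\<in>{a..}. \<forall>t\<in>{a..}. dist t s < d \<longrightarrow> dist (G (z t)) (G (z s)) < e"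
      using d(2) zK by (intro exI[of _ d']) auto
  qed
  note cont_K = continuous_on_subset[OF _ K_regular]
  have c_innov: "continuous_on K (\<lambda>x. innov A u k (fst x) q h)" for h
    by (intro cont_K continuous_on_innov q)
  have c_X: "continuous_on K (\<lambda>x. fst x $ h - mat 1)" for h
    by (intro continuous_intros)

  define g1 where "g1 x = - 2 * (norm (innov A u k (fst x) q 1))\<^sup>2" for x :: "((real^3^3)^2) \<times> (real^3)"
  have c1: "continuous_on K g1" unfolding g1_def[abs_def] by (intro continuous_intros c_innov)
  have lyap_der: "((\<lambda>t. lyap (X t, \<omega> t, q)) has_vector_derivative g1 (z t)) (at t within {s..b})"
    if "a \<le> s" "t \<in> {s..b}" for s b t
    unfolding g1_def z_def fst_conv
    by (rule lyap_derivative[OF q _ der[OF that]]) (use XSO3 that in auto)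
  obtain L where "((\<lambda>t. lyap (X t, \<omega> t, q)) \<longlongrightarrow> L) at_top"
  proof (rule antimono_bounded_tendsto_at_top[of a "\<lambda>t. lyap (X t, \<omega> t, q)" 0])
    fix s t assume st: "a \<le> s" "s \<le> t"
    then have "{s..t} \<times> {N} \<subseteq> E" using sub by auto
    from lyap_flow_le[OF sol st(2) this] show "lyap (X t, \<omega> t, q) \<le> lyap (X s, \<omega> s, q)"
      using st by (simp add: \<phi>)
  next
    fix t assume "a \<le> t"
    then show "0 \<le> lyap (X t, \<omega> t, q)" using inv(1)[of t] \<phi>[of t] lyap_le(3) by simp
  qed blast
  from barbalat[OF lyap_der this uc[OF c1]] have lim1: "((\<lambda>t. g1 (z t)) \<longlongrightarrow> 0) at_top" by simp
  \<comment> \<open>Points of \<open>K\<close> respect the gap bound of the flow set, so synergy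
    leaves only the identity.\<close>
  have zero: "fst x $ h = mat 1" if "x \<in> K" "innov A u k (fst x) q h = 0" for x h
    using that synergistic[of "fst x $ h" "q $ h" h] q
    by (auto simp: K_def flow_region_def innov_def)
  have lim_X1: "((\<lambda>t. fst (z t) $ 1 - mat 1) \<longlongrightarrow> 0) at_top"
    by (rule tendsto_zero_of_zeros_subset[OF K c1 c_X _ evK lim1]) (simp add: g1_def zero)

  define g2 where "g2 x = fst x $ 1 ** skew (frame_rate q (fst x) (snd x) 1)" for x :: "((real^3^3)^2) \<times> (real^3)"
  have c2: "continuous_on K g2"
    unfolding g2_def[abs_def]
    by (intro matrix_mult.continuous_on continuous_intros bounded_linear.continuous_on[OF bounded_linear_skew]
        cont_K continuous_on_frame_rate q)
  have der2: "((\<lambda>t. fst (z t) $ 1 - mat 1) has_vector_derivative g2 (z t)) (at t within {s..b})"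
    if "a \<le> s" "t \<in> {s..b}" for s b t
  proof -
    have "bounded_linear (\<lambda>x :: ((real^3^3)^2) \<times> (real^3). fst x $ 1)"
      by (rule bounded_linear_compose[OF bounded_linear_vec_nth bounded_linear_fst])
    from has_vector_derivative_diff[OF bounded_linear.has_vector_derivative[OF this der[OF that]]
        has_vector_derivative_const[of "mat 1"]]
    show ?thesis by (simp add: z_def g2_def field_def)
  qed
  from barbalat[OF der2 lim_X1 uc[OF c2]] have lim2: "((\<lambda>t. g2 (z t)) \<longlongrightarrow> 0) at_top" by simp
  have lim_\<omega>: "((\<lambda>t. snd (z t)) \<longlongrightarrow> 0) at_top"
  proof (rule tendsto_zero_of_zeros_subset[OF K _ _ _ evK])
    \<comment> \<open>A zero of \<open>g2\<close> yields only that the rotated velocity equals the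
      index-1 innovation; pairing with \<open>g1\<close> makes that innovation vanish, and rotations
      preserve norms.\<close>
    show "continuous_on K (\<lambda>x. (g1 x, g2 x))" by (intro continuous_intros c1 c2)
    show "continuous_on K snd" by (intro continuous_intros)
    show "((\<lambda>t. (g1 (z t), g2 (z t))) \<longlongrightarrow> 0) at_top"
      using tendsto_Pair[OF lim1 lim2] by (simp add: zero_prod_def)
    fix x assume x: "x \<in> K" "(g1 x, g2 x) = 0"
    have SO3: "fst x $ h \<in> SO3" for h using x(1) by (auto simp: K_def flow_region_def)
    have "innov A u k (fst x) q 1 = 0" "g2 x = 0" using x(2) by (auto simp: g1_def zero_prod_def)
    moreover have "skew (frame_rate q (fst x) (snd x) 1) = transpose (fst x $ 1) ** g2 x"
      by (simp add: g2_def matrix_mul_assoc SO3_D(1)[OF SO3])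
    ultimately have "ref_attitude Rd (fst x) $ 1 *v snd x = 0"
      by (simp add: matrix_mult.zero_right skew_eq_0_iff frame_rate_def)
    then show "snd x = 0"
      using norm_SO3_mult[OF ref_attitude_SO3[OF SO3], of 1 "snd x"] by simp
  qed

  define g3 where "g3 x = snd (field q x)" for x
  have c3: "continuous_on K g3"
    unfolding g3_def[abs_def] by (intro continuous_on_snd cont_K continuous_on_field q)
  have der3: "((\<lambda>t. snd (z t)) has_vector_derivative g3 (z t)) (at t within {s..b})"
    if "a \<le> s" "t \<in> {s..b}" for s b t
    using bounded_linear.has_vector_derivative[OF bounded_linear_snd der[OF that]] by (simp add: z_def g3_def)
  from barbalat[OF der3 lim_\<omega> uc[OF c3]] have lim3: "((\<lambda>t. g3 (z t)) \<longlongrightarrow> 0) at_top" by simp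
  have lim_X2: "((\<lambda>t. fst (z t) $ 2 - mat 1) \<longlongrightarrow> 0) at_top"
  proof (rule tendsto_zero_of_zeros_subset[OF K _ c_X _ evK])
    \<comment> \<open>With velocity and index-1 innovation zero, the acceleration reduces to the
      torque of index 2, which determines the second innovation.\<close>
    show "continuous_on K (\<lambda>x. (g1 x, snd x, g3 x))" by (intro continuous_intros c1 c3)
    show "((\<lambda>t. (g1 (z t), snd (z t), g3 (z t))) \<longlongrightarrow> 0) at_top"
      using tendsto_Pair[OF lim1 tendsto_Pair[OF lim_\<omega> lim3]] by (simp add: zero_prod_def)
    fix x assume x: "x \<in> K" "(g1 x, snd x, g3 x) = 0"
    have SO3: "fst x $ h \<in> SO3" for h using x(1) by (auto simp: K_def flow_region_def)
    have z1: "innov A u k (fst x) q 1 = 0" and \<omega>: "snd x = 0" and "g3 x = 0"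
      using x(2) by (auto simp: g1_def zero_prod_def)
    from \<open>g3 x = 0\<close> have "matrix_inv J *v torque A u k Rd (fst x) q = 0"
      by (simp add: g3_def field_def case_prod_unfold \<omega>)
    then have "torque A u k Rd (fst x) q = 0"
      using pos_def_solve[OF J, of 0 "torque A u k Rd (fst x) q"] by simp
    then have "transpose (ref_attitude Rd (fst x) $ 2) *v innov A u k (fst x) q 2 = 0"
      by (simp add: torque_def sum_2 z1 del: transpose_matrix_vector)
    then have "innov A u k (fst x) q 2 = 0"
      using norm_SO3_mult[OF transpose_SO3[OF ref_attitude_SO3[OF SO3]], of 2 "innov A u k (fst x) q 2"]
      by (simp del: transpose_matrix_vector)
    then show "fst x $ 2 - mat 1 = 0" using zero x(1) by simp
  qed

  have "((\<lambda>t. norm (fst (z t) $ 1 - mat 1) + norm (fst (z t) $ 2 - mat 1) + norm (snd (z t))) \<longlongrightarrow> 0 + 0 + 0) at_top"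
    by (intro tendsto_add tendsto_norm_zero lim_X1 lim_X2 lim_\<omega>)
  then have "((\<lambda>t. norm (fst (z t) $ 1 - mat 1) + norm (fst (z t) $ 2 - mat 1) + norm (snd (z t))) \<longlongrightarrow> 0) at_top"
    by simp
  then show ?thesis
  proof (rule Lim_null_comparison[rotated])
    show "\<forall>\<^sub>F t in at_top. norm (infdist (\<phi> (t, N)) (target_set Q)) \<le>
      norm (fst (z t) $ 1 - mat 1) + norm (fst (z t) $ 2 - mat 1) + norm (snd (z t))"
      using eventually_ge_at_top[of a]
    proof eventually_elim
      case (elim t)
      then show ?case
        using infdist_target_le[of "X t" "\<omega> t" q] inv(1)[of t] \<phi>[of t] by (simp add: z_def infdist_nonneg)
    qed
  qed
qed

theorem attractive: "globally_attractive H (target_set Q)"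
  unfolding globally_attractive_def
proof (intro allI impI)
  fix E \<phi> assume max: "maximal_solution H E \<phi>"
  then have sol: "hybrid_solution H E \<phi>" by (simp add: maximal_solution_def)
  obtain a N where E: "{a..} \<times> {N} \<subseteq> E" "\<And>t j. (t, j) \<in> E \<Longrightarrow> j < N \<Longrightarrow> t \<le> a"
    "\<And>t j. (t, j) \<in> E \<Longrightarrow> j \<le> N"
    by (rule maximal_solution_domain[OF max]) blast
  show "complete_domain E \<and>
     (\<forall>e>0. \<exists>K. \<forall>(t, j)\<in>E. K \<le> t + real j \<longrightarrow> infdist (\<phi> (t, j)) (target_set Q) < e)"
  proof (intro conjI allI impI)
    show "complete_domain E"
      unfolding complete_domain_def
    proof
      fix K :: real
      have "(max a K, N) \<in> E" using E(1) by auto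
      then show "\<exists>(t, j)\<in>E. K \<le> t + real j" by (rule rev_bexI) simp
    qed
  next
    fix e :: real assume "e > 0"
    have "\<forall>\<^sub>F t in at_top. infdist (\<phi> (t, N)) (target_set Q) < e"
      using tendstoD[OF tail_converges[OF sol E(1)] \<open>e > 0\<close>] by (simp add: infdist_nonneg)
    then obtain T where T: "\<And>t. T \<le> t \<Longrightarrow> infdist (\<phi> (t, N)) (target_set Q) < e"
      unfolding eventually_at_top_linorder by blast
    \<comment> \<open>For \<open>j < N\<close> one has \<open>t\<close> at most \<open>a\<close>, so
      \<open>t + real j\<close> stays below \<open>a + real N\<close>; beyond the chosen
      \<open>K\<close> only the tail remains, at times at least \<open>T\<close>.\<close>
    show "\<exists>K. \<forall>(t, j)\<in>E. K \<le> t + real j \<longrightarrow> infdist (\<phi> (t, j)) (target_set Q) < e"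
    proof (intro exI[of _ "max T a + real N"] ballI, clarify)
      fix t j assume tj: "(t, j) \<in> E" "max T a + real N \<le> t + real j"
      have "j = N"
      proof (rule ccontr)
        assume "j \<noteq> N"
        then have "j < N" using E(3)[OF tj(1)] by simp
        then show False using E(2)[OF tj(1)] tj(2) by simp
      qed
      then show "infdist (\<phi> (t, j)) (target_set Q) < e" using T[of t] tj(2) by simp
    qed
  qed
qed

end

theorem theorem3:
  fixes J Rd :: "real^3^3"
    and n :: nat and r :: "nat \<Rightarrow> real^3"
    and \<rho> :: "2 \<Rightarrow> nat \<Rightarrow> real" and A :: "2 \<Rightarrow> real^3^3"
    and u :: "2 \<Rightarrow> real^3"
    and Q :: "real set" and k :: "2 \<Rightarrow> real \<Rightarrow> real"
    and \<delta> :: "2 \<Rightarrow> real"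
  assumes "pos_def J"
    and "Rd \<in> SO3"
    and "n \<ge> 2"
    and "\<exists>S \<subseteq> r ` {1..n}. card S = 3 \<and> independent S"
    and "\<And>h i. i \<in> {1..n} \<Longrightarrow> \<rho> h i > 0"
    and "\<And>h. A h = (\<Sum>i=1..n. \<rho> h i *\<^sub>R outer_product (r i) (r i))"
    and "\<And>h. norm (u h) = 1"
    and "finite Q" and "Q \<subseteq> \<nat>"
    and "\<And>h p. p \<in> Q \<Longrightarrow> k h p \<noteq> 0"
    and "\<And>h p. p \<in> Q \<Longrightarrow>
           \<bar>k h p\<bar> < 1 / (2 * lambda_max (W_matrix (A h)) * sqrt (6 - max 1 (4 * (xi (A h))\<^sup>2)))"
    and "\<And>h. \<delta> h > 0"
    and "\<And>h. centrally_synergistic Q (potential A u k h) (\<delta> h)"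
  shows "globally_asymptotically_stable (closed_loop A u k Q \<delta> J Rd) (target_set Q)"
proof -
  have span: "span (r ` {1..n}) = UNIV"
  proof -
    obtain S where S: "S \<subseteq> r ` {1..n}" "card S = 3" "independent S" using assms(4) by blast
    \<comment> \<open>Three independent vectors fill the three-dimensional space.\<close>
    have "UNIV \<subseteq> span S"
      by (rule card_ge_dim_independent) (use S in \<open>simp_all add: dim_UNIV\<close>)
    then show ?thesis using span_mono[OF S(1)] by blast
  qed
  have directions: "weighted_directions {1..n} (\<rho> h) r (A h)" for h
    using assms(5,6) span by unfold_locales auto
  have warped: "warped_directions {1..n} (\<rho> h) r (A h) (u h) (k h p)" if "p \<in> Q" for h p
    using directions[of h] weighted_directions.gain_bound[OF directions assms(11)[OF that]] assms(7)
    by (intro warped_directions.intro) (auto simp: warped_directions_axioms_def)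
  have synergistic: "R = mat 1"
    if R: "R \<in> SO3" "p \<in> Q" "innovation (A h) (u h) (k h p) R = 0" "synergy_gap A u k Q h R p \<le> \<delta> h" for h R p
  proof (rule ccontr)
    assume "R \<noteq> mat 1"
    interpret warped_directions "{1..n}" "\<rho> h" r "A h" "u h" "k h p" by (rule warped[OF R(2)])
    let ?C = "critical_points Q (potential A u k h) - {mat 1} \<times> Q"
    let ?gap = "\<lambda>(R, p). potential A u k h R p - (MIN s\<in>Q. potential A u k h R s)"
    have "has_SO3_gradient (\<lambda>S. potential A u k h S p) 0 R"
      unfolding potential_def using SO3_gradient_zero[OF R(1,3)] .
    then have "(R, p) \<in> ?C" using R(1,2) \<open>R \<noteq> mat 1\<close> by (simp add: critical_points_def)
    \<comment> \<open>Gaps are nonnegative, and the set contains \<open>(R, p)\<close>; so the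
      infimum in the synergy hypothesis is a genuine lower bound for the gap at this point.\<close>
    moreover have "bdd_below (?gap ` ?C)"
      using assms(8) by (intro bdd_belowI[of _ 0]) (auto simp: critical_points_def)
    ultimately have "(INF x\<in>?C. ?gap x) \<le> ?gap (R, p)" by (intro cINF_lower)
    then show False
      using assms(13)[of h] R(4) by (simp add: centrally_synergistic_def synergy_gap_def)
  qed
  interpret synergistic_loop J Rd "{1..n}" r \<rho> A u Q k \<delta>
    by (rule synergistic_loop.intro) (fact assms(1,2,8,12) warped synergistic)+
  show ?thesis
    unfolding globally_asymptotically_stable_def using stable attractive by blast
qed

end
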